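(* Let $m\ge 1$ and $n>2m$ be integers and let $1\le p<\frac{n+2m}{n-2m}$. Let $u\in C^{2m}(\mathbb{S}^n)$ be a real-valued function with $u\ge 0$ satisfying $$P_{m,g_{\mathbb{S}^n}}(u)=u^{p}\quad\text{on } \mathbb{S}^n .$$ Then $u$ is constant.
   Context: $\mathbb{S}^n\subset\mathbb{R}^{n+1}$ is the unit sphere with its standard round metric $g_{\mathbb{S}^n}$, and $\Delta_{g_{\mathbb{S}^n}}$ is the Laplace-Beltrami operator (a nonpositive operator). Set $P_{1,g_{\mathbb{S}^n}}=-\Delta_{g_{\mathbb{S}^n}}+\frac{n(n-2)}{4}$. The GJMS operator of order $2m$ on $\mathbb{S}^n$ is $$P_{m,g_{\mathbb{S}^n}}=\prod_{k=1}^{m}\big(P_{1,g_{\mathbb{S}^n}}-k(k-1)\big)=P_{1,g_{\mathbb{S}^n}}(P_{1,g_{\mathbb{S}^n}}-2)(P_{1,g_{\mathbb{S}^n}}-6)\cdots(P_{1,g_{\mathbb{S}^n}}-m(m-1)).$$ *)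

theory Defs
  imports "HOL-Analysis.Analysis"
begin

text \<open>
  The unit sphere of dimension \<open>n\<close> is \<open>sphere 0 1\<close> in a Euclidean space \<open>'a\<close> with
  \<open>DIM('a) = n + 1\<close>. Functions on it are total functions on \<open>'a\<close>; everything below depends,
  at points of the sphere, only on their values on the sphere.
\<close>

text \<open>
  The differential of a map at a point \<open>x\<close> of the sphere is a linear map on the tangent space,
  the orthogonal complement of \<open>x\<close>. It is extended to \<open>'a\<close> by 0 on the normal line; derivatives
  within the sphere are otherwise not determined in the normal direction. See
  \<open>sphere_deriv_works\<close> and \<open>sphere_deriv_eqI\<close> for existence and uniqueness.
\<close>

definition sphere_deriv ::
    "('a::euclidean_space \<Rightarrow> 'b::real_normed_vector) \<Rightarrow> 'a \<Rightarrow> 'a \<Rightarrow> 'b"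
  where "sphere_deriv f x = (THE D. (f has_derivative D) (at x within sphere 0 1) \<and> D x = 0)"

lemma sphere_inner_ident:
  fixes x y :: "'a::euclidean_space"
  assumes "norm x = 1" "norm y = 1"
  shows "(y - x) \<bullet> x = - (norm (y - x))\<^sup>2 / 2"
proof -
  have "x \<bullet> x = 1" "y \<bullet> y = 1" using assms by (simp_all add: norm_eq_1)
  then show ?thesis
    by (simp add: power2_norm_eq_inner inner_diff_left inner_diff_right inner_commute[of x y])
qed

lemma sphere_normal_has_derivative_0:
  fixes x :: "'a::euclidean_space" and c :: "'b::real_normed_vector"
  assumes x: "x \<in> sphere 0 1"
  shows "((\<lambda>y. ((y - x) \<bullet> x) *\<^sub>R c) has_derivative (\<lambda>h. 0)) (at x within sphere 0 1)"
proof -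
  have "((\<lambda>y. (- (norm (y - x))\<^sup>2 / 2) *\<^sub>R c) has_derivative (\<lambda>h. 0)) (at x within sphere 0 1)"
    unfolding power2_norm_eq_inner by (auto intro!: derivative_eq_intros)
  then show ?thesis
    by (rule has_derivative_transform[rotated 2])
      (use x in \<open>auto simp: sphere_inner_ident\<close>)
qed

lemma sphere_deriv_unique:
  fixes f :: "'a::euclidean_space \<Rightarrow> 'b::real_normed_vector"
  assumes x: "x \<in> sphere 0 1"
    and D: "(f has_derivative D) (at x within sphere 0 1)" "D x = 0"
    and E: "(f has_derivative E) (at x within sphere 0 1)" "E x = 0"
  shows "D = E"
proof
  fix h
  interpret D: bounded_linear D using D(1) by (rule has_derivative_bounded_linear)
  interpret E: bounded_linear E using E(1) by (rule has_derivative_bounded_linear)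
  have xx: "x \<bullet> x = 1" using x by (simp add: norm_eq_1)
  have unit: "D e = E e" if e: "e \<bullet> x = 0" "norm e = 1" for e
  proof -
    define c where "c = (\<lambda>t::real. cos t *\<^sub>R x + sin t *\<^sub>R e)"
    have ee: "e \<bullet> e = 1" using e by (simp add: norm_eq_1)
    have c_in: "c ` UNIV \<subseteq> sphere 0 1"
    proof clarsimp
      fix t
      have "x \<bullet> e = 0" using e(1) by (simp add: inner_commute)
      then have "c t \<bullet> c t = (cos t)\<^sup>2 + (sin t)\<^sup>2"
        using xx ee e(1)
        by (simp add: c_def inner_add_left inner_add_right power2_eq_square)
      then show "norm (c t) = 1" by (simp add: norm_eq_1)
    qed
    have c0: "c 0 = x" by (simp add: c_def)
    have c': "(c has_derivative (\<lambda>s. s *\<^sub>R e)) (at 0)"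
      unfolding c_def by (auto intro!: derivative_eq_intros)
    have "((f \<circ> c) has_derivative (D \<circ> (\<lambda>s. s *\<^sub>R e))) (at 0)"
      by (rule diff_chain_within[OF c', simplified])
        (use D(1) c_in c0 in \<open>auto intro: has_derivative_subset\<close>)
    moreover have "((f \<circ> c) has_derivative (E \<circ> (\<lambda>s. s *\<^sub>R e))) (at 0)"
      by (rule diff_chain_within[OF c', simplified])
        (use E(1) c_in c0 in \<open>auto intro: has_derivative_subset\<close>)
    ultimately have "D \<circ> (\<lambda>s. s *\<^sub>R e) = E \<circ> (\<lambda>s. s *\<^sub>R e)"
      by (rule has_derivative_unique)
    from fun_cong[OF this, of 1] show ?thesis by simp
  qed
  have tang: "D e = E e" if e: "e \<bullet> x = 0" for e
  proof (cases "e = 0")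
    case False
    have "D (sgn e) = E (sgn e)"
      by (rule unit) (use e False in \<open>auto simp: sgn_div_norm\<close>)
    then show ?thesis
      using False by (simp add: sgn_div_norm D.scaleR E.scaleR)
  qed (simp add: D.zero E.zero)
  have "D (h - (h \<bullet> x) *\<^sub>R x) = E (h - (h \<bullet> x) *\<^sub>R x)"
    by (rule tang) (simp add: inner_diff_left xx)
  then show "D h = E h"
    by (simp add: D.diff E.diff D.scaleR E.scaleR D(2) E(2))
qed

lemma sphere_deriv_eqI:
  assumes "x \<in> sphere 0 1" "(f has_derivative D) (at x within sphere 0 1)" "D x = 0"
  shows "sphere_deriv f x = D"
  unfolding sphere_deriv_def
  by (rule the_equality) (use assms sphere_deriv_unique in blast)+

lemma sphere_deriv_eq_projection:
  fixes f :: "'a::euclidean_space \<Rightarrow> 'b::real_normed_vector"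
  assumes x: "x \<in> sphere 0 1" and D: "(f has_derivative D) (at x within sphere 0 1)"
  shows "(f has_derivative (\<lambda>h. D (h - (h \<bullet> x) *\<^sub>R x))) (at x within sphere 0 1)"
    and "sphere_deriv f x = (\<lambda>h. D (h - (h \<bullet> x) *\<^sub>R x))"
proof -
  interpret D: bounded_linear D using D by (rule has_derivative_bounded_linear)
  have xx: "x \<bullet> x = 1" using x by (simp add: norm_eq_1)
  have "((\<lambda>y. f y - ((y - x) \<bullet> x) *\<^sub>R D x + ((y - x) \<bullet> x) *\<^sub>R D x)
      has_derivative (\<lambda>h. (D h - (h \<bullet> x) *\<^sub>R D x) + 0)) (at x within sphere 0 1)"
    by (rule has_derivative_add[OF _ sphere_normal_has_derivative_0[OF x]])
      (auto intro!: derivative_eq_intros D)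
  then show *: "(f has_derivative (\<lambda>h. D (h - (h \<bullet> x) *\<^sub>R x))) (at x within sphere 0 1)"
    by (simp add: D.diff D.scaleR)
  show "sphere_deriv f x = (\<lambda>h. D (h - (h \<bullet> x) *\<^sub>R x))"
    by (rule sphere_deriv_eqI[OF x *]) (simp add: xx D.zero)
qed

lemma sphere_deriv_works:
  assumes "x \<in> sphere 0 1" "f differentiable (at x within sphere 0 1)"
  shows "(f has_derivative sphere_deriv f x) (at x within sphere 0 1)"
proof -
  from assms(2) obtain D where "(f has_derivative D) (at x within sphere 0 1)"
    unfolding differentiable_def by blast
  from sphere_deriv_eq_projection[OF assms(1) this] show ?thesis by simp
qed

text \<open>The tangent vector representing the differential of \<open>u\<close> in the round metric.\<close>

definition sphere_grad :: "('a::euclidean_space \<Rightarrow> real) \<Rightarrow> 'a \<Rightarrow> 'a"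
  where "sphere_grad u x = (\<Sum>b\<in>Basis. sphere_deriv u x b *\<^sub>R b)"

text \<open>
  The divergence of a tangent field \<open>X\<close> is the trace of its covariant derivative, and the
  Levi-Civita connection of the round metric is the tangential part of the derivative in \<open>'a\<close>.
  Neither the projection nor the restriction of the trace to the tangent space is visible in the
  formula: \<open>D = sphere_deriv X x\<close> vanishes at \<open>x\<close>, so the trace of \<open>D\<close> over \<open>'a\<close> equals the trace
  of the tangential part of \<open>D\<close> over the tangent space.
\<close>

definition sphere_div :: "('a::euclidean_space \<Rightarrow> 'a) \<Rightarrow> 'a \<Rightarrow> real"
  where "sphere_div X x = (\<Sum>b\<in>Basis. sphere_deriv X x b \<bullet> b)"

definition laplace_beltrami :: "('a::euclidean_space \<Rightarrow> real) \<Rightarrow> 'a \<Rightarrow> real"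
  where "laplace_beltrami u = sphere_div (sphere_grad u)"

text \<open>Class \<open>C\<^sup>k\<close> on the sphere; the functions in the recursion are the components of the gradient.\<close>

primrec Ck_sphere :: "nat \<Rightarrow> ('a::euclidean_space \<Rightarrow> real) \<Rightarrow> bool"
  where
    "Ck_sphere 0 u \<longleftrightarrow> continuous_on (sphere 0 1) u"
  | "Ck_sphere (Suc k) u \<longleftrightarrow>
      u differentiable_on sphere 0 1 \<and> (\<forall>b\<in>Basis. Ck_sphere k (\<lambda>x. sphere_grad u x \<bullet> b))"

definition conformal_laplacian :: "('a::euclidean_space \<Rightarrow> real) \<Rightarrow> 'a \<Rightarrow> real"
  where "conformal_laplacian u x =
    (let n = real DIM('a) - 1 in - laplace_beltrami u x + n * (n - 2) / 4 * u x)"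

text \<open>As in \<open>P\<^sub>1 (P\<^sub>1 - 2) \<dots> (P\<^sub>1 - m (m - 1))\<close>, the factor with the largest index acts first.\<close>

primrec gjms :: "nat \<Rightarrow> ('a::euclidean_space \<Rightarrow> real) \<Rightarrow> 'a \<Rightarrow> real"
  where
    "gjms 0 u = u"
  | "gjms (Suc m) u =
      gjms m (\<lambda>x. conformal_laplacian u x - real (Suc m) * (real (Suc m) - 1) * u x)"

end

theory Submission
  imports Defs
begin

text \<open>
  With \<open>s = 1 - x \<bullet> y\<close>, the factor \<open>P\<^sub>1 - k (k - 1)\<close> maps \<open>s powr (k - n / 2)\<close> to a multiple of
  \<open>s powr (k - 1 - n / 2)\<close>, and to a Dirac mass when \<open>k = 1\<close>. The factors commute, so Green's identity
  gives \<open>u y = K * \<integral> s powr (- \<alpha>) * u x powr p\<close> with \<open>\<alpha> = n / 2 - m\<close> and \<open>K > 0\<close>.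

  Let \<open>R\<close> be the conformal reflection of the sphere in the boundary of the cap \<open>x \<bullet> e > t\<close>, and let
  \<open>v\<close> be the transform of \<open>u\<close> under \<open>R\<close>. The integral equation is conformally covariant up to a power
  of the conformal factor whose sign is favourable because \<open>p\<close> is subcritical. Hence, as long as the
  part of the cap on which \<open>v < u\<close> has small measure, it is empty. Moving the cap from \<open>t = 1\<close> down to
  \<open>t = 0\<close> gives \<open>u x \<le> u (R x)\<close> for the orthogonal reflection \<open>R\<close> in every hyperplane through 0 and
  every \<open>x\<close> on its positive side. Any two points are exchanged by such a reflection, so \<open>u\<close> is constant.
\<close>

section \<open>Lorentz reflections of the light cone\<close>

text \<open>No maximum principle is at hand for an operator of order \<open>2 * m\<close>, so signs
  are read off an integral kernel. Write N for \<open>stretch t e x\<close>. The reflected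
  nonlinearity carries the weight \<open>N powr (\<alpha> - n)\<close>, the p-th power of the
  reflected function carries \<open>N powr (- \<alpha> * p)\<close>. The weights agree at the
  critical exponent; on a cap with \<open>t > 0\<close>, where N < 1, subcriticality makes the first
  one larger. At \<open>t = 0\<close>, N is 1 and the reflection is orthogonal. The conformal
  reflection is induced by a reflection of the cone over the sphere that moves points only along
  \<open>e\<close>: its effect on \<open>x \<bullet> y\<close> is a quadratic identity, and its
  Jacobian is a one-variable derivative. Integrals over the sphere are Lebesgue integrals of
  homogeneous extensions against a radial cutoff, so the divergence theorem reduces to translation
  invariance. The kernel is singular at \<open>x = y\<close>. Green's identity is therefore applied
  to \<open>1 + \<epsilon> - x \<bullet> y\<close>, and \<epsilon> tends to 0. The error term
  vanishes in the limit for factors with \<open>k > 1\<close> and becomes the Dirac mass for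
  \<open>k = 1\<close>.\<close>

lemma nn_integral_lborel_translation:
  fixes c :: "'a::euclidean_space"
  assumes [measurable]: "H \<in> borel_measurable borel"
  shows "(\<integral>\<^sup>+x. H (c + x) \<partial>lborel) = (\<integral>\<^sup>+x. H x \<partial>lborel)"
proof -
  have "(\<integral>\<^sup>+x. H x \<partial>lborel) = (\<integral>\<^sup>+x. H x \<partial>distr lborel borel ((+) c))"
    by (simp add: lborel_distr_plus)
  also have "\<dots> = (\<integral>\<^sup>+x. H (c + x) \<partial>lborel)"
    by (rule nn_integral_distr) auto
  finally show ?thesis by simp
qed

lemma nn_integral_lborel_scaleR:
  fixes H :: "'a::euclidean_space \<Rightarrow> ennreal"
  assumes [measurable]: "H \<in> borel_measurable borel" and c: "c > 0"
  shows "(\<integral>\<^sup>+x. H x \<partial>lborel) = ennreal (c ^ DIM('a)) * (\<integral>\<^sup>+x. H (c *\<^sub>R x) \<partial>lborel)"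
proof -
  have "(\<integral>\<^sup>+x. H x \<partial>lborel) =
      (\<integral>\<^sup>+x. H x \<partial>density (distr lborel borel (\<lambda>x. 0 + c *\<^sub>R x)) (\<lambda>x. ennreal (\<bar>c\<bar> ^ DIM('a))))"
    using lborel_affine[of c "0::'a"] c by simp
  also have "\<dots> = (\<integral>\<^sup>+x. ennreal (c ^ DIM('a)) * H (c *\<^sub>R x) \<partial>lborel)"
    using c by (simp add: nn_integral_density nn_integral_distr)
  also have "\<dots> = ennreal (c ^ DIM('a)) * (\<integral>\<^sup>+x. H (c *\<^sub>R x) \<partial>lborel)"
    by (rule nn_integral_cmult) measurable
  finally show ?thesis .
qed

text \<open>
  Averaging over translates along \<open>e\<close> integrates line by line in an arbitrary direction, without
  rotating the coordinate axes.
\<close>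

lemma nn_integral_lborel_by_lines:
  fixes e :: "'a::euclidean_space"
  assumes [measurable]: "H \<in> borel_measurable borel" and e: "norm e = 1"
  shows "(\<integral>\<^sup>+x. H x \<partial>lborel) =
    (\<integral>\<^sup>+x. indicator {0..1} (x \<bullet> e) * (\<integral>\<^sup>+s. H (x + s *\<^sub>R e) \<partial>lborel) \<partial>lborel)"
proof -
  have ee: "e \<bullet> e = 1" using e by (simp add: norm_eq_1)
  have "(\<integral>\<^sup>+x. indicator {0..1} (x \<bullet> e) * (\<integral>\<^sup>+s. H (x + s *\<^sub>R e) \<partial>lborel) \<partial>lborel)
      = (\<integral>\<^sup>+x. (\<integral>\<^sup>+s. indicator {0..1::real} (x \<bullet> e) * H (x + s *\<^sub>R e) \<partial>lborel) \<partial>lborel)"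
    by (intro nn_integral_cong nn_integral_cmult[symmetric]) measurable
  also have "\<dots> = (\<integral>\<^sup>+s. (\<integral>\<^sup>+x. indicator {0..1::real} (x \<bullet> e) * H (x + s *\<^sub>R e) \<partial>lborel) \<partial>lborel)"
    by (rule lborel_pair.Fubini'[symmetric]) measurable
  also have "\<dots> = (\<integral>\<^sup>+s. (\<integral>\<^sup>+x. indicator {0..1} (x \<bullet> e - s) * H x \<partial>lborel) \<partial>lborel)"
  proof (rule nn_integral_cong)
    fix s :: real
    have "(\<integral>\<^sup>+x. indicator {0..1} (x \<bullet> e - s) * H x \<partial>lborel)
        = (\<integral>\<^sup>+x. indicator {0..1} ((s *\<^sub>R e + x) \<bullet> e - s) * H (s *\<^sub>R e + x) \<partial>lborel)"
      by (rule nn_integral_lborel_translation[symmetric]) measurable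
    then show "(\<integral>\<^sup>+x. indicator {0..1} (x \<bullet> e) * H (x + s *\<^sub>R e) \<partial>lborel) =
        (\<integral>\<^sup>+x. indicator {0..1} (x \<bullet> e - s) * H x \<partial>lborel)"
      by (simp add: inner_add_left ee add.commute)
  qed
  also have "\<dots> = (\<integral>\<^sup>+x. (\<integral>\<^sup>+s. indicator {0..1} (x \<bullet> e - s) * H x \<partial>lborel) \<partial>lborel)"
    by (rule lborel_pair.Fubini') measurable
  also have "\<dots> = (\<integral>\<^sup>+x. H x \<partial>lborel)"
  proof (rule nn_integral_cong)
    fix x
    have "(\<integral>\<^sup>+s. indicator {0..1} (x \<bullet> e - s) * H x \<partial>lborel)
        = (\<integral>\<^sup>+s. indicator {x \<bullet> e - 1..x \<bullet> e} s * H x \<partial>lborel)"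
      by (intro nn_integral_cong) (auto simp: indicator_def)
    also have "\<dots> = H x"
      by (simp add: nn_integral_multc)
    finally show "(\<integral>\<^sup>+s. indicator {0..1} (x \<bullet> e - s) * H x \<partial>lborel) = H x" .
  qed
  finally show ?thesis ..
qed

text \<open>Since \<open>g\<close> is its own inverse, the preimage of \<open>{l<..<u}\<close> is
  the interval from \<open>g u\<close> to \<open>g l\<close>, whose mass under the density
  \<open>g'\<close> is \<open>g (g u) - g (g l) = u - l\<close>. So the image measure agrees with
  Lebesgue measure on intervals.\<close>

lemma nn_integral_decreasing_involution:
  fixes g g' :: "real \<Rightarrow> real"
  assumes d: "\<And>s. (g has_real_derivative - g' s) (at s)"
    and pos: "\<And>s. g' s > 0" and cont: "continuous_on UNIV g'" and inv: "\<And>s. g (g s) = s"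
    and [measurable]: "F \<in> borel_measurable borel"
  shows "(\<integral>\<^sup>+s. F (g s) * ennreal (g' s) \<partial>lborel) = (\<integral>\<^sup>+s. F s \<partial>lborel)"
proof -
  have contg: "continuous_on UNIV g"
    using d by (meson DERIV_isCont continuous_at_imp_continuous_on)
  have [measurable]: "g \<in> borel_measurable borel" "g' \<in> borel_measurable borel"
    using cont contg by (auto intro: borel_measurable_continuous_onI)
  have less: "g x > g y" if "x < y" for x y
    by (rule DERIV_neg_imp_decreasing_open[OF that])
      (use d pos continuous_on_subset[OF contg] in \<open>auto intro!: exI[of _ "- g' _"]\<close>)
  have eq: "g x < y \<longleftrightarrow> g y < x" for x y
    using less[of "g x" y] less[of "g y" x] inv by (metis linorder_neqE_linordered_idom order_less_asym)
  define M where "M = distr (density lborel (\<lambda>s. ennreal (g' s))) borel g"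
  have "lborel = M"
  proof (rule lborel_eqI)
    fix l u :: real assume lu: "\<And>b. b \<in> Basis \<Longrightarrow> l \<bullet> b \<le> u \<bullet> b"
    then have lu: "l \<le> u" by simp
    have gul: "g u \<le> g l" using less[of l u] lu by (cases "l = u") auto
    have vim: "g -` {l<..<u} = {g u<..<g l}"
    proof -
      have "l < g s \<longleftrightarrow> s < g l" for s
        using eq[of "g s" "g l"] inv eq less by metis
      moreover have "g s < u \<longleftrightarrow> g u < s" for s by (rule eq)
      ultimately show ?thesis by auto
    qed
    have "emeasure M {l<..<u} = emeasure (density lborel (\<lambda>s. ennreal (g' s))) {g u<..<g l}"
      unfolding M_def by (subst emeasure_distr) (auto simp: vim)
    also have "\<dots> = (\<integral>\<^sup>+s. ennreal (g' s) * indicator {g u<..<g l} s \<partial>lborel)"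
      by (subst emeasure_density) auto
    also have "\<dots> = (\<integral>\<^sup>+s. ennreal (g' s) * indicator {g u..g l} s \<partial>lborel)"
    proof (rule nn_integral_cong_AE)
      show "AE s in lborel. ennreal (g' s) * indicator {g u<..<g l} s
          = ennreal (g' s) * indicator {g u..g l} s"
        using AE_lborel_singleton[of "g u"] AE_lborel_singleton[of "g l"]
        by eventually_elim (auto simp: indicator_def)
    qed
    also have "\<dots> = ennreal (- g (g l) - - g (g u))"
      by (rule nn_integral_FTC_Icc[of _ _ _ "\<lambda>s. - g s"])
        (use gul pos d in \<open>auto intro!: derivative_eq_intros less_imp_le\<close>)
    also have "\<dots> = ennreal (u - l)" by (simp add: inv)
    finally show "emeasure M (box l u) = (\<Prod>b\<in>Basis. (u - l) \<bullet> b)"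
      by (simp add: box_real)
  qed (simp add: M_def)
  then have "(\<integral>\<^sup>+s. F s \<partial>lborel) = (\<integral>\<^sup>+s. F s \<partial>M)" by simp
  also have "\<dots> = (\<integral>\<^sup>+s. F (g s) * ennreal (g' s) \<partial>lborel)"
    unfolding M_def by (simp add: nn_integral_distr nn_integral_density mult.commute)
  finally show ?thesis ..
qed

text \<open>
  For \<open>norm e = 1\<close> and \<open>\<bar>t\<bar> < 1\<close>, the map \<open>(x, norm x) \<mapsto> (cone_refl t e x, stretch t e x)\<close> is
  the Lorentz reflection of the light cone in the hyperplane \<open>x \<bullet> e = t * norm x\<close>. It induces on
  the sphere the conformal reflection that fixes the boundary of the cap \<open>x \<bullet> e > t\<close>; the
  conformal factor is the inverse of \<open>stretch t e\<close>.
\<close>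

definition cone_refl :: "real \<Rightarrow> 'a::euclidean_space \<Rightarrow> 'a \<Rightarrow> 'a"
  where "cone_refl t e x = x - (2 * (x \<bullet> e - t * norm x) / (1 - t\<^sup>2)) *\<^sub>R e"

definition stretch :: "real \<Rightarrow> 'a::euclidean_space \<Rightarrow> 'a \<Rightarrow> real"
  where "stretch t e x = ((1 + t\<^sup>2) * norm x - 2 * t * (x \<bullet> e)) / (1 - t\<^sup>2)"

lemma one_minus_power2_pos: "\<bar>t\<bar> < 1 \<Longrightarrow> 0 < 1 - (t::real)\<^sup>2"
  using abs_square_less_1 by auto

context
  fixes e :: "'a::euclidean_space" and t :: real
  assumes e: "norm e = 1" and t: "\<bar>t\<bar> < 1"
begin

text \<open>By Cauchy-Schwarz the numerator is at least \<open>norm x\<close> times the square of 1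
  - |t|.\<close>

lemma stretch_pos:
  assumes "x \<noteq> 0" shows "stretch t e x > 0"
proof -
  have "\<bar>t * (x \<bullet> e)\<bar> \<le> \<bar>t\<bar> * norm x"
    using Cauchy_Schwarz_ineq2[of x e] e by (simp add: abs_mult mult_left_mono)
  moreover have "0 < (1 - \<bar>t\<bar>)\<^sup>2 * norm x" using t assms by simp
  moreover have "(1 - \<bar>t\<bar>)\<^sup>2 = 1 + t\<^sup>2 - 2 * \<bar>t\<bar>" by (simp add: power2_eq_square algebra_simps)
  ultimately have "0 < (1 + t\<^sup>2) * norm x - 2 * t * (x \<bullet> e)"
    by (simp add: algebra_simps)
  then show ?thesis
    using one_minus_power2_pos[OF t] by (simp add: stretch_def)
qed

text \<open>Invariance of the Minkowski product of two light-cone vectors. The case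
  \<open>x = y\<close> shows that the image stays on the cone; distinct points give, after
  normalization, the scaling of \<open>1 - x \<bullet> y\<close> under the spherical
  reflection.\<close>

lemma cone_refl_lorentz:
  "stretch t e x * stretch t e y - cone_refl t e x \<bullet> cone_refl t e y
    = norm x * norm y - x \<bullet> y"
proof -
  define k where "k = 1 - t\<^sup>2"
  have k: "k \<noteq> 0" using one_minus_power2_pos[OF t] by (simp add: k_def)
  have t2: "t\<^sup>2 = 1 - k" by (simp add: k_def)
  have ee: "e \<bullet> e = 1" using e by (simp add: norm_eq_1)
  define a b where "a = x \<bullet> e" and "b = y \<bullet> e"
  have "cone_refl t e x \<bullet> cone_refl t e y = x \<bullet> y - (2 * (b - t * norm y) / k) * a
      - (2 * (a - t * norm x) / k) * b
      + (2 * (a - t * norm x) / k) * (2 * (b - t * norm y) / k)"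
    by (simp add: cone_refl_def inner_diff_left inner_diff_right ee inner_commute[of e y]
        a_def[symmetric] b_def[symmetric] k_def[symmetric] algebra_simps)
  moreover have "stretch t e x * stretch t e y =
      ((2 - k) * norm x - 2 * t * a) / k * (((2 - k) * norm y - 2 * t * b) / k)"
    by (simp add: stretch_def a_def[symmetric] b_def[symmetric] t2)
  moreover have "((2 - k) * X - 2 * t * a) / k * (((2 - k) * Y - 2 * t * b) / k)
     + (2 * (b - t * Y) / k) * a + (2 * (a - t * X) / k) * b
     - (2 * (a - t * X) / k) * (2 * (b - t * Y) / k) = X * Y" for X Y
  proof -
    have tt: "t * t = 1 - k" using t2 by (simp add: power2_eq_square)
    have "((2 - k) * X - 2 * t * a) * ((2 - k) * Y - 2 * t * b)
     + k * (2 * (b - t * Y) * a) + k * (2 * (a - t * X) * b)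
     - (2 * (a - t * X)) * (2 * (b - t * Y)) = k * k * (X * Y)"
      using tt by algebra
    then show ?thesis using k by (simp add: divide_simps) (simp add: algebra_simps)
  qed
  from this[of "norm x" "norm y"] show ?thesis
    using calculation by simp
qed

lemma norm_cone_refl: "norm (cone_refl t e x) = stretch t e x"
proof -
  have "(norm (cone_refl t e x))\<^sup>2 = (stretch t e x)\<^sup>2"
    using cone_refl_lorentz[of x x]
    by (simp add: dot_square_norm power2_eq_square[symmetric])
  moreover have "stretch t e x \<ge> 0"
    using stretch_pos[of x] by (cases "x = 0") (auto simp: stretch_def)
  ultimately show ?thesis by simp
qed

text \<open>The linear form that defines the mirror changes sign, so a second application subtracts
  the opposite multiple of \<open>e\<close> and the map is an involution.\<close>

lemma inner_cone_refl:
  "cone_refl t e x \<bullet> e - t * stretch t e x = - (x \<bullet> e - t * norm x)"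
proof -
  have k: "1 - t\<^sup>2 \<noteq> 0" using one_minus_power2_pos[OF t] by simp
  have ee: "e \<bullet> e = 1" using e by (simp add: norm_eq_1)
  show ?thesis
    using k by (simp add: cone_refl_def stretch_def inner_diff_left ee divide_simps)
      (simp add: algebra_simps power2_eq_square)
qed

lemma cone_refl_involution: "cone_refl t e (cone_refl t e x) = x"
proof -
  have "cone_refl t e (cone_refl t e x) = cone_refl t e x
      - (2 * - (x \<bullet> e - t * norm x) / (1 - t\<^sup>2)) *\<^sub>R e"
    by (simp only: cone_refl_def[where x="cone_refl t e x"] norm_cone_refl inner_cone_refl)
  also have "\<dots> = x"
    by (simp only: cone_refl_def mult_minus_right minus_divide_left[symmetric] scaleR_minus_left) simp
  finally show ?thesis .
qed

lemma stretch_cone_refl: "stretch t e (cone_refl t e x) = norm x"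
  by (metis norm_cone_refl cone_refl_involution)

text \<open>Only one argument is reflected. The extra term is a product of heights over the mirror:
  it is positive for two points on the same side, which later makes a point of the cap outweigh its
  mirror image.\<close>

lemma cone_refl_lorentz_mixed:
  "norm x * stretch t e y - x \<bullet> cone_refl t e y
    = norm x * norm y - x \<bullet> y + 2 * (x \<bullet> e - t * norm x) * (y \<bullet> e - t * norm y) / (1 - t\<^sup>2)"
proof -
  have k: "1 - t\<^sup>2 \<noteq> 0" using one_minus_power2_pos[OF t] by simp
  show ?thesis
    using k by (simp add: cone_refl_def stretch_def inner_diff_right divide_simps)
      (simp add: algebra_simps power2_eq_square)
qed

lemma measurable_cone_refl [measurable]: "cone_refl t e \<in> borel_measurable borel"
  and measurable_stretch [measurable]: "stretch t e \<in> borel_measurable borel"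
  unfolding cone_refl_def[abs_def] stretch_def[abs_def] by measurable

text \<open>Points move only along \<open>e\<close>, so the substitution takes place on each line
  parallel to \<open>e\<close>, where the map is a decreasing involution with derivative
  \<open>- stretch t e x / norm x\<close>. The line through 0, where the norm is not differentiable,
  is null in dimension at least 2.\<close>

lemma nn_integral_cone_refl:
  assumes [measurable]: "F \<in> borel_measurable borel" and dim: "DIM('a) \<ge> 2"
  shows "(\<integral>\<^sup>+x. F (cone_refl t e x) * ennreal (stretch t e x / norm x) \<partial>lborel)
    = (\<integral>\<^sup>+x. F x \<partial>lborel)"
proof -
  define H where "H = (\<lambda>x. F (cone_refl t e x) * ennreal (stretch t e x / norm x))"
  have [measurable]: "H \<in> borel_measurable borel" unfolding H_def by measurable
  have k: "1 - t\<^sup>2 > 0" using one_minus_power2_pos[OF t] by simp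
  have ee: "e \<bullet> e = 1" using e by (simp add: norm_eq_1)
  have line: "(\<integral>\<^sup>+s. H (x + s *\<^sub>R e) \<partial>lborel) = (\<integral>\<^sup>+s. F (x + s *\<^sub>R e) \<partial>lborel)"
    if x: "x \<notin> span {e}" for x
  proof -
    define g where "g = (\<lambda>s. s - 2 * ((x + s *\<^sub>R e) \<bullet> e - t * norm (x + s *\<^sub>R e)) / (1 - t\<^sup>2))"
    define g' where "g' = (\<lambda>s. stretch t e (x + s *\<^sub>R e) / norm (x + s *\<^sub>R e))"
    have nz: "x + s *\<^sub>R e \<noteq> 0" for s
    proof
      assume "x + s *\<^sub>R e = 0"
      then have "x = (- s) *\<^sub>R e" by (simp add: add_eq_0_iff2)
      then show False using x by (metis span_base span_mul insertI1)
    qed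
    have g: "cone_refl t e (x + s *\<^sub>R e) = x + g s *\<^sub>R e" for s
      by (simp add: cone_refl_def g_def algebra_simps)
    have gg: "g (g s) = s" for s
    proof -
      have "x + g (g s) *\<^sub>R e = cone_refl t e (cone_refl t e (x + s *\<^sub>R e))"
        by (simp only: g)
      also have "\<dots> = x + s *\<^sub>R e" by (rule cone_refl_involution)
      finally show ?thesis using e by auto
    qed
    have dn: "((\<lambda>s. norm (x + s *\<^sub>R e)) has_real_derivative
        ((x + s *\<^sub>R e) \<bullet> e / norm (x + s *\<^sub>R e))) (at s)" for s
      unfolding has_field_derivative_def
      by (rule has_derivative_eq_rhs, rule has_derivative_norm[THEN has_derivative_compose[rotated]])
        (auto intro!: derivative_eq_intros nz simp: sgn_div_norm divide_inverse inner_commute)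
    have "(g has_real_derivative - g' s) (at s)" for s
    proof -
      have n: "norm (x + s *\<^sub>R e) > 0" using nz by simp
      have "(g has_real_derivative
        (1 - 2 * (1 - t * ((x + s *\<^sub>R e) \<bullet> e / norm (x + s *\<^sub>R e))) / (1 - t\<^sup>2))) (at s)"
        unfolding g_def inner_add_left inner_scaleR_left ee
        using k by (auto intro!: derivative_eq_intros dn simp: inner_add_left ee)
      moreover have "1 - 2 * (1 - t * ((x + s *\<^sub>R e) \<bullet> e / norm (x + s *\<^sub>R e))) / (1 - t\<^sup>2) = - g' s"
        using n k by (simp add: g'_def stretch_def field_simps)
      ultimately show ?thesis by simp
    qed
    moreover have "g' s > 0" for s using stretch_pos[OF nz] nz by (simp add: g'_def)
    moreover have "continuous_on UNIV g'"
      unfolding g'_def stretch_def using nz k by (intro continuous_intros) auto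
    moreover have "(\<lambda>s. F (x + s *\<^sub>R e)) \<in> borel_measurable borel" by measurable
    ultimately have "(\<integral>\<^sup>+s. F (x + g s *\<^sub>R e) * ennreal (g' s) \<partial>lborel)
        = (\<integral>\<^sup>+s. F (x + s *\<^sub>R e) \<partial>lborel)"
      using gg by (intro nn_integral_decreasing_involution[where F="\<lambda>s. F (x + s *\<^sub>R e)"])
    then show ?thesis by (simp add: H_def g g'_def)
  qed
  have "dim (span {e}) < DIM('a)"
    using dim dim_le_card[of "{e}" "{e}"] by (simp add: dim_span)
  then have "negligible (span {e})" by (rule negligible_lowdim)
  then have neg: "span {e} \<in> null_sets lborel"
    by (simp add: negligible_iff_null_sets null_sets_completion_iff closed_span borel_closed)
  have "(\<integral>\<^sup>+x. H x \<partial>lborel)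
      = (\<integral>\<^sup>+x. indicator {0..1} (x \<bullet> e) * (\<integral>\<^sup>+s. H (x + s *\<^sub>R e) \<partial>lborel) \<partial>lborel)"
    by (rule nn_integral_lborel_by_lines[OF _ e]) measurable
  also have "\<dots> = (\<integral>\<^sup>+x. indicator {0..1} (x \<bullet> e) * (\<integral>\<^sup>+s. F (x + s *\<^sub>R e) \<partial>lborel) \<partial>lborel)"
    by (rule nn_integral_cong_AE, rule AE_mp[OF AE_not_in[OF neg]]) (auto simp: line)
  also have "\<dots> = (\<integral>\<^sup>+x. F x \<partial>lborel)"
    by (rule nn_integral_lborel_by_lines[OF _ e, symmetric]) measurable
  finally show ?thesis by (simp add: H_def)
qed

end

section \<open>Measure on the sphere and conformal reflections\<close>

text \<open>The square makes the positive part continuously differentiable, as the divergence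
  theorem requires. The support between 1 and 2 keeps radial integrals away from 0 and
  infinity.\<close>

definition cutoff :: "real \<Rightarrow> real"
  where "cutoff r = (max 0 ((r - 1) * (2 - r)))\<^sup>2"

lemma cutoff_nonneg [simp]: "cutoff r \<ge> 0"
  by (simp add: cutoff_def)

lemma cutoff_eq_0: "r \<le> 1 \<or> r \<ge> 2 \<Longrightarrow> cutoff r = 0"
  by (auto simp: cutoff_def mult_nonneg_nonpos mult_nonpos_nonneg)

lemma cutoff_0 [simp]: "cutoff 0 = 0"
  by (rule cutoff_eq_0) simp

lemma cutoff_pos: "1 < r \<Longrightarrow> r < 2 \<Longrightarrow> cutoff r > 0"
  by (simp add: cutoff_def)

lemma cutoff_le_1: "cutoff r \<le> 1"
proof -
  have "(r - 1) * (2 - r) \<le> 1"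
    using zero_le_power2[of "r - 3 / 2"] by (simp add: power2_eq_square algebra_simps)
  then show ?thesis
    by (auto simp: cutoff_def intro!: power_le_one)
qed

lemma measurable_cutoff [measurable]: "cutoff \<in> borel_measurable borel"
  unfolding cutoff_def[abs_def] by measurable

lemma nn_integral_cutoff_exp:
  assumes "b > 0"
  shows "(\<integral>\<^sup>+s. cutoff (exp s * b) \<partial>lborel) = (\<integral>\<^sup>+s. cutoff (exp s) \<partial>lborel)"
proof -
  have "(\<integral>\<^sup>+s. cutoff (exp s * b) \<partial>lborel) = (\<integral>\<^sup>+s. cutoff (exp (ln b + s)) \<partial>lborel)"
    using assms by (simp add: exp_add mult.commute)
  also have "\<dots> = (\<integral>\<^sup>+s. cutoff (exp s) \<partial>lborel)"
    by (rule nn_integral_lborel_translation) measurable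
  finally show ?thesis .
qed

text \<open>Both bounds serve to cancel this constant in \<open>ennreal\<close>.\<close>

lemma nn_integral_cutoff_exp_bounds:
  "(\<integral>\<^sup>+s. cutoff (exp s) \<partial>lborel) \<noteq> 0" "(\<integral>\<^sup>+s. cutoff (exp s) \<partial>lborel) \<noteq> \<infinity>"
proof -
  show "(\<integral>\<^sup>+s. cutoff (exp s) \<partial>lborel) \<noteq> 0"
  proof
    assume "(\<integral>\<^sup>+s. cutoff (exp s) \<partial>lborel) = 0"
    then have "AE s in lborel. ennreal (cutoff (exp s)) = 0"
      by (subst (asm) nn_integral_0_iff_AE) auto
    then have "AE s in lborel. s \<notin> {0<..<ln 2 :: real}"
    proof eventually_elim
      case (elim s)
      then have "\<not> cutoff (exp s) > 0" by (simp add: ennreal_eq_0_iff)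
      then have "\<not> (1 < exp s \<and> exp s < 2)" using cutoff_pos by blast
      moreover have "exp s < 2 \<longleftrightarrow> s < ln 2" by (metis exp_less_cancel_iff exp_ln zero_less_numeral)
      ultimately show ?case by simp
    qed
    then have "emeasure lborel {0<..<ln 2 :: real} = 0"
      by (subst (asm) AE_iff_measurable[where N="{0<..<ln 2}"]) auto
    then show False by simp
  qed
  have "(\<integral>\<^sup>+s. cutoff (exp s) \<partial>lborel) \<le> (\<integral>\<^sup>+s. indicator {0..ln 2 :: real} s \<partial>lborel)"
  proof (rule nn_integral_mono)
    fix s :: real
    have "cutoff (exp s) = 0" if "s \<notin> {0..ln 2}"
    proof (rule cutoff_eq_0)
      have "exp s \<ge> 2" if "s > ln 2"
        using that by (metis exp_le_cancel_iff exp_ln less_imp_le zero_less_numeral)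
      then show "exp s \<le> 1 \<or> exp s \<ge> 2" using that by fastforce
    qed
    then show "ennreal (cutoff (exp s)) \<le> indicator {0..ln 2} s"
      using cutoff_le_1[of "exp s"] by (auto simp: indicator_def)
  qed
  also have "\<dots> < \<infinity>" by simp
  finally show "(\<integral>\<^sup>+s. cutoff (exp s) \<partial>lborel) \<noteq> \<infinity>" by simp
qed

text \<open>
  Both sides are compared with the double integral over \<open>x\<close> and the scaling parameter
  \<open>exp s\<close>, which is symmetric in \<open>a\<close> and \<open>b\<close>.
\<close>

lemma nn_integral_section_independent:
  fixes H :: "'a::euclidean_space \<Rightarrow> ennreal" and a b :: "'a \<Rightarrow> real"
  assumes [measurable]: "H \<in> borel_measurable borel" "a \<in> borel_measurable borel"
      "b \<in> borel_measurable borel"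
    and H: "\<And>c x. c > 0 \<Longrightarrow> x \<noteq> 0 \<Longrightarrow> ennreal (c ^ DIM('a)) * H (c *\<^sub>R x) = H x"
    and a: "\<And>c x. c > 0 \<Longrightarrow> a (c *\<^sub>R x) = c * a x" "\<And>x. x \<noteq> 0 \<Longrightarrow> a x > 0"
    and b: "\<And>c x. c > 0 \<Longrightarrow> b (c *\<^sub>R x) = c * b x" "\<And>x. x \<noteq> 0 \<Longrightarrow> b x > 0"
  shows "(\<integral>\<^sup>+x. H x * cutoff (a x) \<partial>lborel) = (\<integral>\<^sup>+x. H x * cutoff (b x) \<partial>lborel)"
proof -
  define c where "c = (\<integral>\<^sup>+s. cutoff (exp s) \<partial>lborel)"
  define J where "J = (\<lambda>(a::'a \<Rightarrow> real) (b::'a \<Rightarrow> real).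
    (\<integral>\<^sup>+x. (\<integral>\<^sup>+s. H x * cutoff (a x) * cutoff (exp s * b x) \<partial>lborel) \<partial>lborel))"
  have J: "J a b = (\<integral>\<^sup>+x. H x * cutoff (a x) \<partial>lborel) * c"
    if [measurable]: "a \<in> borel_measurable borel" "b \<in> borel_measurable borel"
      and b: "\<And>x. x \<noteq> 0 \<Longrightarrow> b x > 0" for a b :: "'a \<Rightarrow> real"
  proof -
    have "J a b = (\<integral>\<^sup>+x. H x * cutoff (a x) * c \<partial>lborel)"
      unfolding J_def
    proof (rule nn_integral_cong_AE, rule AE_mp[OF AE_lborel_singleton[of 0]], intro AE_I2 impI)
      fix x :: 'a assume "x \<noteq> 0"
      then have "c = (\<integral>\<^sup>+s. cutoff (exp s * b x) \<partial>lborel)"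
        using nn_integral_cutoff_exp[OF b] by (simp add: c_def)
      then show "(\<integral>\<^sup>+s. H x * cutoff (a x) * cutoff (exp s * b x) \<partial>lborel) =
          H x * cutoff (a x) * c"
        by (simp add: nn_integral_cmult)
    qed
    then show ?thesis by (simp add: nn_integral_multc)
  qed
  have "J a b = (\<integral>\<^sup>+s. (\<integral>\<^sup>+x. H x * cutoff (a x) * cutoff (exp s * b x) \<partial>lborel) \<partial>lborel)"
    unfolding J_def by (rule lborel_pair.Fubini'[symmetric]) measurable
  \<comment> \<open>Replacing \<open>x\<close> by \<open>exp (- s) *\<^sub>R x\<close> moves the
    scaling from \<open>b\<close> to \<open>a\<close>: the Jacobian is absorbed by the homogeneity
    of \<open>H\<close> of degree minus the dimension. The change of sign of \<open>s\<close> then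
    exchanges the roles of \<open>a\<close> and \<open>b\<close>.\<close>
  also have "\<dots> = (\<integral>\<^sup>+s. (\<integral>\<^sup>+x. H x * cutoff (exp (- s) * a x) * cutoff (b x) \<partial>lborel) \<partial>lborel)"
  proof (rule nn_integral_cong)
    fix s :: real
    have "(\<integral>\<^sup>+x. H x * cutoff (a x) * cutoff (exp s * b x) \<partial>lborel) =
      ennreal (exp (- s) ^ DIM('a)) * (\<integral>\<^sup>+x. H (exp (- s) *\<^sub>R x) *
        cutoff (a (exp (- s) *\<^sub>R x)) * cutoff (exp s * b (exp (- s) *\<^sub>R x)) \<partial>lborel)"
      by (rule nn_integral_lborel_scaleR) auto
    also have "\<dots> = (\<integral>\<^sup>+x. ennreal (exp (- s) ^ DIM('a)) * (H (exp (- s) *\<^sub>R x) *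
        cutoff (a (exp (- s) *\<^sub>R x)) * cutoff (exp s * b (exp (- s) *\<^sub>R x))) \<partial>lborel)"
      by (rule nn_integral_cmult[symmetric]) measurable
    also have "\<dots> = (\<integral>\<^sup>+x. H x * cutoff (exp (- s) * a x) * cutoff (b x) \<partial>lborel)"
    proof (rule nn_integral_cong_AE, rule AE_mp[OF AE_lborel_singleton[of 0]], intro AE_I2 impI)
      fix x :: 'a assume "x \<noteq> 0"
      then have "ennreal (exp (- s) ^ DIM('a)) * H (exp (- s) *\<^sub>R x) = H x"
        using H[of "exp (- s)" x] by simp
      then show "ennreal (exp (- s) ^ DIM('a)) * (H (exp (- s) *\<^sub>R x) *
        cutoff (a (exp (- s) *\<^sub>R x)) * cutoff (exp s * b (exp (- s) *\<^sub>R x)))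
        = H x * cutoff (exp (- s) * a x) * cutoff (b x)"
        by (simp only: a(1)[OF exp_gt_zero] b(1)[OF exp_gt_zero] mult.assoc[symmetric] exp_minus_inverse mult_1)
    qed
    finally show "(\<integral>\<^sup>+x. H x * cutoff (a x) * cutoff (exp s * b x) \<partial>lborel) =
      (\<integral>\<^sup>+x. H x * cutoff (exp (- s) * a x) * cutoff (b x) \<partial>lborel)" .
  qed
  also have "\<dots> = (\<integral>\<^sup>+s. (\<integral>\<^sup>+x. H x * cutoff (exp s * a x) * cutoff (b x) \<partial>lborel) \<partial>lborel)"
    by (subst nn_integral_real_affine[where c="-1" and t=0]) auto
  also have "\<dots> = J b a"
    unfolding J_def by (subst lborel_pair.Fubini') (auto simp: mult_ac)
  finally have "(\<integral>\<^sup>+x. H x * cutoff (a x) \<partial>lborel) * c =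
      (\<integral>\<^sup>+x. H x * cutoff (b x) \<partial>lborel) * c"
    using J[of a b] J[of b a] a b by simp
  then have "c * (\<integral>\<^sup>+x. H x * cutoff (a x) \<partial>lborel) = c * (\<integral>\<^sup>+x. H x * cutoff (b x) \<partial>lborel)"
    by (simp only: mult.commute)
  moreover have "c \<noteq> 0" "c \<noteq> top"
    using nn_integral_cutoff_exp_bounds by (simp_all add: c_def)
  ultimately show ?thesis by (simp add: ennreal_mult_cancel_left)
qed

text \<open>
  A rotation invariant measure on the unit sphere: the weight makes it a constant multiple of the
  surface measure, and only the measure up to a constant factor matters.
\<close>

definition surf :: "'a::euclidean_space measure"
  where "surf = distr
    (restrict_space (density lborel (\<lambda>x. ennreal (cutoff (norm x) / norm x ^ DIM('a)))) (- {0}))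
    (restrict_space borel (sphere 0 1)) sgn"

lemma space_surf [simp]: "space surf = sphere 0 1"
  and sets_surf [measurable_cong, simp]:
    "sets surf = sets (restrict_space borel (sphere 0 1))"
  by (auto simp: surf_def space_restrict_space)

lemma measurable_sgn_sphere:
  assumes M: "sets M = sets (borel :: 'a::euclidean_space measure)"
  shows "sgn \<in> restrict_space M (- {0}) \<rightarrow>\<^sub>M restrict_space borel (sphere (0::'a) 1)"
proof (rule measurable_restrict_space2)
  show "sgn \<in> space (restrict_space M (- {0})) \<rightarrow> sphere (0::'a) 1"
    by (auto simp: space_restrict_space norm_sgn)
  have "sgn = (\<lambda>x::'a. x /\<^sub>R norm x)" by (simp add: fun_eq_iff sgn_div_norm)
  then have "sgn \<in> borel_measurable (borel :: 'a measure)" by simp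
  then have "sgn \<in> borel_measurable M" using M measurable_cong_sets by blast
  then show "sgn \<in> borel_measurable (restrict_space M (- {0}))"
    by (rule measurable_restrict_space1)
qed

lemma measurable_radial_extension:
  assumes f: "f \<in> borel_measurable (surf :: 'a::euclidean_space measure)"
  shows "(\<lambda>x::'a. f (sgn x) * indicator (- {0}) x :: ennreal) \<in> borel_measurable borel"
proof -
  have "f \<in> borel_measurable (restrict_space borel (sphere (0::'a) 1))"
    using f measurable_cong_sets[OF sets_surf refl] by blast
  then have "(\<lambda>x. f (sgn x)) \<in> borel_measurable (restrict_space borel (- {0::'a}))"
    using measurable_compose[OF measurable_sgn_sphere[of borel]] by auto
  then show ?thesis
    by (subst (asm) borel_measurable_restrict_space_iff_ennreal) (auto simp: mult.commute)
qed

lemma nn_integral_surf: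
  fixes f :: "'a::euclidean_space \<Rightarrow> ennreal"
  assumes f: "f \<in> borel_measurable surf"
  shows "(\<integral>\<^sup>+x. f x \<partial>surf) = (\<integral>\<^sup>+x. f (sgn x) * indicator (- {0}) x *
    ennreal (cutoff (norm x) / norm x ^ DIM('a)) \<partial>lborel)"
proof -
  let ?D = "density lborel (\<lambda>x::'a. ennreal (cutoff (norm x) / norm x ^ DIM('a)))"
  have "(\<integral>\<^sup>+x. f x \<partial>surf) = (\<integral>\<^sup>+x. f (sgn x) \<partial>restrict_space ?D (- {0}))"
    unfolding surf_def
    by (rule nn_integral_distr) (use f in \<open>auto simp: surf_def intro!: measurable_sgn_sphere\<close>)
  also have "\<dots> = (\<integral>\<^sup>+x. f (sgn x) * indicator (- {0}) x \<partial>?D)"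
    by (rule nn_integral_restrict_space) auto
  also have "\<dots> = (\<integral>\<^sup>+x. f (sgn x) * indicator (- {0}) x *
    ennreal (cutoff (norm x) / norm x ^ DIM('a)) \<partial>lborel)"
    using measurable_radial_extension[OF f]
    by (subst nn_integral_density) (auto simp: mult.commute)
  finally show ?thesis .
qed

section \<open>Change of variables under spherical reflections\<close>

definition sphere_refl :: "real \<Rightarrow> 'a::euclidean_space \<Rightarrow> 'a \<Rightarrow> 'a"
  where "sphere_refl t e x = sgn (cone_refl t e x)"

lemma
  fixes e :: "'a::euclidean_space"
  assumes e: "norm e = 1" and t: "\<bar>t\<bar> < 1"
  shows cone_refl_eq_0_iff: "cone_refl t e x = 0 \<longleftrightarrow> x = 0"
    and measurable_sphere_refl: "sphere_refl t e \<in> surf \<rightarrow>\<^sub>M (surf :: 'a measure)"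
    and measurable_stretch_sphere: "stretch t e \<in> borel_measurable surf"
proof -
  note [measurable] = measurable_cone_refl[OF e t] measurable_stretch[OF e t]
  show nz: "cone_refl t e x = 0 \<longleftrightarrow> x = 0" for x
    using cone_refl_involution[OF e t, of x] norm_cone_refl[OF e t, of x] stretch_pos[OF e t, of x]
    by (cases "x = 0") (auto simp: cone_refl_def)
  have "cone_refl t e \<in> restrict_space borel (sphere 0 1) \<rightarrow>\<^sub>M restrict_space borel (- {0})"
    by (rule measurable_restrict_space2)
      (auto simp: space_restrict_space nz intro!: measurable_restrict_space1)
  then have "sphere_refl t e \<in> restrict_space borel (sphere 0 1) \<rightarrow>\<^sub>M restrict_space borel (sphere (0::'a) 1)"
    unfolding sphere_refl_def[abs_def] by (rule measurable_compose[OF _ measurable_sgn_sphere]) simp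
  then show "sphere_refl t e \<in> surf \<rightarrow>\<^sub>M (surf :: 'a measure)"
    using measurable_cong_sets[OF sets_surf sets_surf] by blast
  have "stretch t e \<in> borel_measurable (restrict_space borel (sphere (0::'a) 1))"
    by (rule measurable_restrict_space1) simp
  then show "stretch t e \<in> borel_measurable surf"
    using measurable_cong_sets[OF sets_surf refl] by blast
qed

text \<open>The extension \<open>H\<close>, homogeneous of degree minus the dimension, has the same
  integral against the cutoff of any section of the cone. Taking the section
  \<open>stretch t e\<close> before applying the cone reflection turns it into \<open>norm\<close>
  afterwards. Homogeneity contributes \<open>stretch t e x\<close> to the power minus the dimension
  and the Jacobian returns one factor, hence the exponent \<open>DIM('a) - 1\<close>.\<close>

lemma nn_integral_sphere_refl:
  fixes e :: "'a::euclidean_space"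
  assumes e: "norm e = 1" and t: "\<bar>t\<bar> < 1" and dim: "DIM('a) \<ge> 2"
    and f: "f \<in> borel_measurable surf"
  shows "(\<integral>\<^sup>+x. f x \<partial>surf) =
    (\<integral>\<^sup>+x. f (sphere_refl t e x) * ennreal (1 / stretch t e x ^ (DIM('a) - 1)) \<partial>surf)"
proof -
  note [measurable] = measurable_cone_refl[OF e t] measurable_stretch[OF e t]
  note nz = cone_refl_eq_0_iff[OF e t] and R = measurable_sphere_refl[OF e t]
    and N = measurable_stretch_sphere[OF e t]
  have hom: "cone_refl t e (c *\<^sub>R x) = c *\<^sub>R cone_refl t e x"
    "stretch t e (c *\<^sub>R x) = c * stretch t e x" if "c > 0" for c x
    using that by (simp_all add: cone_refl_def stretch_def algebra_simps)
  define f0 where "f0 = (\<lambda>x. f (sgn x) * indicator (- {0}) x)"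
  have [measurable]: "f0 \<in> borel_measurable borel"
    unfolding f0_def by (rule measurable_radial_extension[OF f])
  define H where "H = (\<lambda>x. f0 x * ennreal (1 / norm x ^ DIM('a)))"
  have [measurable]: "H \<in> borel_measurable borel" unfolding H_def by measurable
  have fN: "(\<lambda>x. f (sphere_refl t e x) * ennreal (1 / stretch t e x ^ (DIM('a) - 1)))
      \<in> borel_measurable surf"
    using N measurable_compose[OF R f] by measurable
  have "(\<integral>\<^sup>+x. f x \<partial>surf) = (\<integral>\<^sup>+x. H x * cutoff (norm x) \<partial>lborel)"
    unfolding nn_integral_surf[OF f]
    by (intro nn_integral_cong) (simp add: H_def f0_def mult.assoc ennreal_mult[symmetric])
  also have "\<dots> = (\<integral>\<^sup>+x. H x * cutoff (stretch t e x) \<partial>lborel)"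
  proof (rule nn_integral_section_independent)
    fix c :: real and x :: 'a assume c: "c > 0" and x: "x \<noteq> 0"
    have "ennreal (c ^ DIM('a)) * H (c *\<^sub>R x) = f0 (c *\<^sub>R x) * (ennreal (c ^ DIM('a)) * ennreal (1 / norm (c *\<^sub>R x) ^ DIM('a)))"
      by (simp add: H_def mult_ac)
    also have "f0 (c *\<^sub>R x) = f0 x" using c by (simp add: f0_def sgn_scaleR indicator_def)
    also have "ennreal (c ^ DIM('a)) * ennreal (1 / norm (c *\<^sub>R x) ^ DIM('a)) = ennreal (1 / norm x ^ DIM('a))"
      using c by (simp add: ennreal_mult[symmetric] power_mult_distrib)
    finally show "ennreal (c ^ DIM('a)) * H (c *\<^sub>R x) = H x" by (simp add: H_def)
  qed (auto simp: hom stretch_pos[OF e t])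
  also have "\<dots> = (\<integral>\<^sup>+x. H (cone_refl t e x) * cutoff (stretch t e (cone_refl t e x)) *
      ennreal (stretch t e x / norm x) \<partial>lborel)"
    by (rule nn_integral_cone_refl[OF e t _ dim, symmetric]) measurable
  also have "\<dots> = (\<integral>\<^sup>+x. f (sphere_refl t e x) * ennreal (1 / stretch t e x ^ (DIM('a) - 1)) \<partial>surf)"
    unfolding nn_integral_surf[OF fN]
  proof (rule nn_integral_cong)
    fix x :: 'a
    show "H (cone_refl t e x) * cutoff (stretch t e (cone_refl t e x)) *
      ennreal (stretch t e x / norm x) = f (sphere_refl t e (sgn x)) *
      ennreal (1 / stretch t e (sgn x) ^ (DIM('a) - 1)) * indicator (- {0}) x *
      ennreal (cutoff (norm x) / norm x ^ DIM('a))"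
    proof (cases "x = 0")
      case False
      define r N where "r = norm x" and "N = stretch t e x"
      have r: "r > 0" and N: "N > 0" using False stretch_pos[OF e t] by (auto simp: r_def N_def)
      have s: "sgn x = (1 / r) *\<^sub>R x" by (simp add: sgn_div_norm r_def divide_inverse)
      obtain d where d: "DIM('a) = Suc d" using dim by (cases "DIM('a)") auto
      have "sgn (cone_refl t e (sgn x)) = sgn (cone_refl t e x)"
        using r unfolding s by (subst hom) (auto simp: sgn_scaleR)
      moreover have "stretch t e (sgn x) = N / r"
        using r unfolding s by (subst hom) (auto simp: N_def)
      moreover have "1 / N ^ Suc d * cutoff r * (N / r) = 1 / (N / r) ^ d * (cutoff r / r ^ Suc d)"
        using r N by (simp add: field_simps)
      then have "ennreal (1 / N ^ Suc d) * ennreal (cutoff r) * ennreal (N / r)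
          = ennreal (1 / (N / r) ^ d) * ennreal (cutoff r / r ^ Suc d)"
        using r N by (simp add: ennreal_mult[symmetric])
      ultimately show ?thesis
        using False nz by (simp add: H_def f0_def norm_cone_refl[OF e t] stretch_cone_refl[OF e t]
            sphere_refl_def d r_def[symmetric] N_def[symmetric] mult.assoc)
    qed (simp add: H_def f0_def nz)
  qed
  finally show "(\<integral>\<^sup>+x. f x \<partial>surf) =
    (\<integral>\<^sup>+x. f (sphere_refl t e x) * ennreal (1 / stretch t e x ^ (DIM('a) - 1)) \<partial>surf)" .
qed

text \<open>Stated for the measure itself, so that Bochner integrals transform by the rules for
  \<open>distr\<close> and \<open>density\<close>.\<close>

lemma surf_sphere_refl:
  fixes e :: "'a::euclidean_space"
  assumes e: "norm e = 1" and t: "\<bar>t\<bar> < 1" and dim: "DIM('a) \<ge> 2"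
  shows "surf = distr
    (density surf (\<lambda>x. ennreal (1 / stretch t e x ^ (DIM('a) - 1)))) surf (sphere_refl t e)"
    (is "_ = distr (density _ ?w) _ _")
proof (rule measure_eqI)
  note [measurable] = measurable_sphere_refl[OF e t]
    measurable_stretch_sphere[OF e t]
  fix A :: "'a set" assume [measurable]: "A \<in> sets surf"
  have "emeasure surf A = (\<integral>\<^sup>+x. indicator A x \<partial>surf)"
    by (rule nn_integral_indicator[symmetric]) fact
  also have "\<dots> = (\<integral>\<^sup>+x. indicator A (sphere_refl t e x) * ?w x \<partial>surf)"
    by (rule nn_integral_sphere_refl[OF e t dim]) measurable
  also have "\<dots> = (\<integral>\<^sup>+x. indicator A (sphere_refl t e x) \<partial>density surf ?w)"
    by (subst nn_integral_density) (auto simp: mult.commute)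
  also have "\<dots> = (\<integral>\<^sup>+x. indicator A x \<partial>distr (density surf ?w) surf (sphere_refl t e))"
    by (subst nn_integral_distr) auto
  also have "\<dots> = emeasure (distr (density surf ?w) surf (sphere_refl t e)) A"
    by (rule nn_integral_indicator) (use \<open>A \<in> sets surf\<close> in simp)
  finally show "emeasure surf A =
      emeasure (distr (density surf ?w) surf (sphere_refl t e)) A" .
qed simp

lemma
  fixes e :: "'a::euclidean_space" and f :: "'a \<Rightarrow> real"
  assumes e: "norm e = 1" and t: "\<bar>t\<bar> < 1" and dim: "DIM('a) \<ge> 2"
    and f: "f \<in> borel_measurable surf"
  shows integral_sphere_refl: "(LINT x|surf. f x) =
      (LINT x|surf. f (sphere_refl t e x) / stretch t e x ^ (DIM('a) - 1))"
    and integrable_sphere_refl: "integrable surf f \<Longrightarrow>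
      integrable surf (\<lambda>x. f (sphere_refl t e x) / stretch t e x ^ (DIM('a) - 1))"
proof -
  note [measurable] = measurable_sphere_refl[OF e t]
    measurable_stretch_sphere[OF e t] f
  define w where "w = (\<lambda>x::'a. 1 / stretch t e x ^ (DIM('a) - 1))"
  have [measurable]: "w \<in> borel_measurable surf" unfolding w_def by measurable
  have w: "AE x in surf. w x \<ge> 0"
  proof (rule AE_I2)
    fix x :: 'a assume "x \<in> space surf"
    then show "w x \<ge> 0" using stretch_pos[OF e t, of x] by (force simp: w_def)
  qed
  let ?M = "density surf (\<lambda>x. ennreal (w x))"
  have M: "surf = distr ?M surf (sphere_refl t e)"
    unfolding w_def by (rule surf_sphere_refl[OF e t dim])
  have w_eq: "w x *\<^sub>R f (sphere_refl t e x) = f (sphere_refl t e x) / stretch t e x ^ (DIM('a) - 1)" for x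
    by (simp add: w_def)
  have "(LINT x|surf. f x) = (\<integral>x. f x \<partial>distr ?M surf (sphere_refl t e))"
    using M by simp
  also have "\<dots> = (\<integral>x. f (sphere_refl t e x) \<partial>?M)"
    by (rule integral_distr) measurable
  also have "\<dots> = (LINT x|surf. w x *\<^sub>R f (sphere_refl t e x))"
    by (rule integral_density) (use w in auto)
  finally show "(LINT x|surf. f x) =
      (LINT x|surf. f (sphere_refl t e x) / stretch t e x ^ (DIM('a) - 1))"
    unfolding w_eq .
  assume "integrable surf f"
  then have "integrable (distr ?M surf (sphere_refl t e)) f" using M by simp
  then have "integrable ?M (\<lambda>x. f (sphere_refl t e x))"
    by (subst (asm) integrable_distr_eq) auto
  then have "integrable surf (\<lambda>x. w x *\<^sub>R f (sphere_refl t e x))"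
    by (subst (asm) integrable_density) (use w in auto)
  then show "integrable surf (\<lambda>x. f (sphere_refl t e x) / stretch t e x ^ (DIM('a) - 1))"
    unfolding w_eq .
qed

lemma nn_integral_surf_1:
  "(\<integral>\<^sup>+x. 1 \<partial>(surf :: 'a::euclidean_space measure)) = (\<integral>\<^sup>+x. indicator (- {0}) (x::'a) *
    ennreal (cutoff (norm x) / norm x ^ DIM('a)) \<partial>lborel)"
  by (subst nn_integral_surf) simp_all

lemma finite_measure_surf: "finite_measure (surf :: 'a::euclidean_space measure)"
proof
  have "emeasure surf (space (surf :: 'a measure)) = (\<integral>\<^sup>+x. 1 \<partial>(surf :: 'a measure))"
    by simp
  also have "\<dots> \<le> (\<integral>\<^sup>+x. indicator (cball 0 2) (x::'a) \<partial>lborel)"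
    unfolding nn_integral_surf_1
  proof (rule nn_integral_mono)
    fix x :: 'a
    have "cutoff (norm x) / norm x ^ DIM('a) \<le> indicator (cball 0 2) x"
    proof (cases "1 < norm x \<and> norm x < 2")
      case True
      then have "cutoff (norm x) / norm x ^ DIM('a) \<le> 1 / 1"
        using cutoff_le_1 by (intro frac_le) (auto simp: one_le_power)
      then show ?thesis using True by simp
    qed (auto simp: cutoff_eq_0 not_less)
    then have "ennreal (cutoff (norm x) / norm x ^ DIM('a)) \<le> ennreal (indicator (cball 0 2) x)"
      by (rule ennreal_leI)
    then show "indicator (- {0}) x * ennreal (cutoff (norm x) / norm x ^ DIM('a))
        \<le> indicator (cball 0 2) x"
      by (cases "x = 0") (simp_all add: ennreal_indicator)
  qed
  also have "\<dots> = emeasure lborel (cball (0::'a) 2)" by simp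
  also have "\<dots> < \<infinity>" by (rule emeasure_lborel_cball_finite)
  finally show "emeasure surf (space (surf :: 'a measure)) \<noteq> \<infinity>" by simp
qed

lemma emeasure_surf_pos:
  "emeasure surf (sphere (0 :: 'a::euclidean_space) 1) \<noteq> 0"
proof
  assume "emeasure surf (sphere (0 :: 'a) 1) = 0"
  then have "(\<integral>\<^sup>+x. 1 \<partial>(surf :: 'a measure)) = 0" by simp
  then have "AE x in (lborel :: 'a measure). indicator (- {0}) x * ennreal (cutoff (norm x) / norm x ^ DIM('a)) = 0"
    unfolding nn_integral_surf_1
    by (subst (asm) nn_integral_0_iff_AE) auto
  then have "AE x in (lborel :: 'a measure). x \<notin> ball 0 2 - cball 0 1"
  proof eventually_elim
    case (elim x)
    show ?case
    proof
      assume x: "x \<in> ball 0 2 - cball 0 1"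
      then have "cutoff (norm x) > 0" by (intro cutoff_pos) auto
      moreover have "norm x > 0" using x by auto
      ultimately have "cutoff (norm x) / norm x ^ DIM('a) > 0" by simp
      then show False using elim x by (auto simp: indicator_def ennreal_eq_0_iff split: if_splits)
    qed
  qed
  then have "emeasure lborel (ball 0 2 - cball (0::'a) 1) = 0"
    by (subst (asm) AE_iff_measurable[where N="ball 0 2 - cball 0 1"]) auto
  then have "negligible (ball 0 2 - cball (0::'a) 1)"
    by (simp add: negligible_iff_null_sets null_sets_def completion.complete emeasure_completion)
  moreover obtain b :: 'a where "b \<in> Basis" using nonempty_Basis by blast
  then have "(3/2) *\<^sub>R b \<in> ball 0 2 - cball (0::'a) 1" by simp
  then have "ball 0 2 - cball (0::'a) 1 \<noteq> {}" by blast
  then have "\<not> negligible (ball 0 2 - cball (0::'a) 1)"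
    by (intro open_not_negligible open_Diff open_ball closed_cball)
  ultimately show False by simp
qed

section \<open>Divergence theorem on the sphere\<close>

lemma borel_measurable_surf_continuous:
  fixes f :: "'a::euclidean_space \<Rightarrow> 'b::topological_space"
  shows "continuous_on (sphere 0 1) f \<Longrightarrow> f \<in> borel_measurable surf"
  by (subst measurable_cong_sets[OF sets_surf refl])
    (rule borel_measurable_continuous_on_restrict)

lemma continuous_on_sphere_bounded:
  fixes f :: "'a::euclidean_space \<Rightarrow> 'b::real_normed_vector"
  assumes "continuous_on (sphere 0 1) f"
  obtains C where "C \<ge> 0" "\<And>x. norm x = 1 \<Longrightarrow> norm (f x) \<le> C"
proof -
  have "bounded (f ` sphere 0 1)"
    by (intro compact_imp_bounded compact_continuous_image assms compact_sphere)
  then obtain C where C: "\<And>y. y \<in> f ` sphere 0 1 \<Longrightarrow> norm y \<le> C" unfolding bounded_iff by blast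
  have "norm (f x) \<le> max C 0" if "norm x = 1" for x
    using C[of "f x"] that by fastforce
  then show thesis using that[of "max C 0"] by simp
qed

lemma integrable_surf_continuous:
  fixes f :: "'a::euclidean_space \<Rightarrow> real"
  assumes "continuous_on (sphere 0 1) f"
  shows "integrable surf f"
proof -
  interpret finite_measure "surf :: 'a measure" by (rule finite_measure_surf)
  obtain C where "\<And>x. norm x = 1 \<Longrightarrow> norm (f x) \<le> C"
    using continuous_on_sphere_bounded[OF assms] by blast
  then show ?thesis
    by (intro integrable_const_bound[where B=C] AE_I2)
      (auto intro: borel_measurable_surf_continuous assms)
qed

lemma integral_surf:
  fixes f :: "'a::euclidean_space \<Rightarrow> real"
  assumes f: "f \<in> borel_measurable surf"
  shows "(LINT x|surf. f x) = (\<integral>x. indicator (- {0}) x *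
    (cutoff (norm x) / norm x ^ DIM('a) * f (sgn x)) \<partial>lborel)"
proof -
  let ?w = "\<lambda>x::'a. cutoff (norm x) / norm x ^ DIM('a)"
  let ?D = "density lborel (\<lambda>x. ennreal (?w x))"
  have f': "f \<in> borel_measurable (restrict_space borel (sphere (0::'a) 1))"
    using f measurable_cong_sets[OF sets_surf refl] by blast
  have "(\<lambda>x. f (sgn x)) \<in> borel_measurable (restrict_space borel (- {0::'a}))"
    using measurable_compose[OF measurable_sgn_sphere[of borel] f'] by simp
  then have m: "(\<lambda>x. indicator (- {0::'a}) x *\<^sub>R f (sgn x)) \<in> borel_measurable borel"
    by (subst (asm) borel_measurable_restrict_space_iff) auto
  have "(LINT x|surf. f x) = (\<integral>x. f (sgn x) \<partial>restrict_space ?D (- {0}))"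
    unfolding surf_def
    by (rule integral_distr) (use f' in \<open>auto intro!: measurable_sgn_sphere\<close>)
  also have "\<dots> = (\<integral>x. indicator (- {0}) x *\<^sub>R f (sgn x) \<partial>?D)"
    by (rule integral_restrict_space) auto
  also have "\<dots> = (\<integral>x. ?w x *\<^sub>R (indicator (- {0}) x *\<^sub>R f (sgn x)) \<partial>lborel)"
    by (rule integral_density) (use m in auto)
  also have "\<dots> = (\<integral>x. indicator (- {0}) x * (?w x * f (sgn x)) \<partial>lborel)"
    by (intro Bochner_Integration.integral_cong) (auto simp: mult_ac)
  finally show ?thesis .
qed

text \<open>By translation invariance every difference quotient of \<open>F\<close> along
  \<open>b\<close> has integral 0. The mean value inequality bounds the quotients by
  \<open>C\<close> on a fixed ball, and dominated convergence passes to their pointwise limit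
  \<open>G\<close>.\<close>

lemma has_bochner_integral_directional_derivative:
  fixes F G :: "'a::euclidean_space \<Rightarrow> real"
  assumes deriv: "\<And>x. ((\<lambda>s. F (x + s *\<^sub>R b)) has_real_derivative G x) (at 0)"
    and bound: "\<And>x. \<bar>G x\<bar> \<le> C" and supp: "\<And>x. norm x \<ge> R \<Longrightarrow> F x = 0"
    and b: "norm b = 1" and R: "R \<ge> 0" and [measurable]: "F \<in> borel_measurable borel"
  shows "has_bochner_integral lborel G 0"
proof -
  have C: "C \<ge> 0" using bound[of 0] by simp
  have d: "((\<lambda>s. F (x + s *\<^sub>R b)) has_real_derivative G (x + s *\<^sub>R b)) (at s within A)" for x s A
  proof (rule has_field_derivative_at_within)
    have "((\<lambda>r. F (x + s *\<^sub>R b + r *\<^sub>R b)) has_real_derivative G (x + s *\<^sub>R b)) (at (s - s))"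
      using deriv by simp
    then have "((\<lambda>r. F (x + s *\<^sub>R b + (r - s) *\<^sub>R b)) has_real_derivative G (x + s *\<^sub>R b)) (at s)"
      by (rule DERIV_cong[OF DERIV_chain2[where g="\<lambda>r. r - s"]]) (auto intro!: derivative_eq_intros)
    then show "((\<lambda>s. F (x + s *\<^sub>R b)) has_real_derivative G (x + s *\<^sub>R b)) (at s)"
      by (simp add: algebra_simps)
  qed
  have lip: "\<bar>F (x + h *\<^sub>R b) - F x\<bar> \<le> C * \<bar>h\<bar>" for x h
    using field_differentiable_bound[of UNIV "\<lambda>s. F (x + s *\<^sub>R b)" "\<lambda>s. G (x + s *\<^sub>R b)" C 0 h]
      d bound by simp
  \<comment> \<open>A step of length \<open>2 * R + 1\<close> along \<open>b\<close> leaves the ball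
    of radius \<open>R\<close>, where \<open>F\<close> is 0; the Lipschitz bound along this step
    bounds \<open>F x\<close>.\<close>
  have Fb: "\<bar>F x\<bar> \<le> C * (2 * R + 1) * indicator (cball 0 R) x" for x
  proof (cases "norm x \<le> R")
    case True
    have "norm ((2 * R + 1) *\<^sub>R b) \<le> norm (x + (2 * R + 1) *\<^sub>R b) + norm x"
      using norm_triangle_ineq[of "x + (2 * R + 1) *\<^sub>R b" "- x"] by simp
    then have "norm (x + (2 * R + 1) *\<^sub>R b) \<ge> R" using True R b by simp
    then have "F (x + (2 * R + 1) *\<^sub>R b) = 0" by (rule supp)
    then show ?thesis using lip[of x "2 * R + 1"] True R by simp
  qed (simp add: supp)
  have ind: "integrable lborel (\<lambda>x. c * indicator (cball (0::'a) r) x :: real)" for c r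
    using emeasure_lborel_cball_finite[of "0::'a" r]
    by (intro integrable_mult_right integrable_real_indicator) auto
  have Fi: "integrable lborel F"
    by (rule Bochner_Integration.integrable_bound[OF ind[of "C * (2 * R + 1)" R]])
      (use Fb in \<open>auto intro!: AE_I2 intro: order_trans[OF _ abs_ge_self]\<close>)
  define q where "q = (\<lambda>k x. (F (x + (1 / real (Suc k)) *\<^sub>R b) - F x) * real (Suc k))"
  have shift: "has_bochner_integral lborel (\<lambda>x. F (x + c)) (integral\<^sup>L lborel F)" for c
  proof -
    have "integrable (distr lborel borel ((+) c)) F" using Fi by (simp only: lborel_distr_plus)
    then have 1: "integrable lborel (\<lambda>x. F (c + x))" by (subst (asm) integrable_distr_eq) auto
    have "integral\<^sup>L (distr lborel borel ((+) c)) F = integral\<^sup>L lborel (\<lambda>x. F (c + x))"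
      by (rule integral_distr) auto
    then have "integral\<^sup>L lborel F = integral\<^sup>L lborel (\<lambda>x. F (c + x))"
      by (simp only: lborel_distr_plus)
    then show ?thesis
      using has_bochner_integral_integrable[OF 1] by (simp only: add.commute[of c])
  qed
  have q: "has_bochner_integral lborel (q k) 0" for k
  proof -
    have "has_bochner_integral lborel (\<lambda>x. F (x + (1 / real (Suc k)) *\<^sub>R b) - F x) 0"
      using has_bochner_integral_diff[OF shift[of "(1 / real (Suc k)) *\<^sub>R b"]
        has_bochner_integral_integrable[OF Fi]] by (simp only: diff_self)
    from has_bochner_integral_mult_left[OF this, of "real (Suc k)"]
    show ?thesis unfolding q_def by (simp only: mult_zero_left)
  qed
  have qG: "(\<lambda>k. q k x) \<longlonglongrightarrow> G x" for x
  proof -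
    have "(\<lambda>h. (F (x + h *\<^sub>R b) - F x) / h) \<midarrow>0\<rightarrow> G x"
      using deriv[of x] unfolding DERIV_def by simp
    moreover have "filterlim (\<lambda>k. 1 / real (Suc k)) (at 0) sequentially"
      unfolding filterlim_at using LIMSEQ_Suc[OF lim_1_over_n[where 'a=real]] by simp
    ultimately have "((\<lambda>k. (F (x + (1 / real (Suc k)) *\<^sub>R b) - F x) / (1 / real (Suc k))) \<longlongrightarrow> G x) sequentially"
      by (rule filterlim_compose)
    then show ?thesis by (simp add: q_def)
  qed
  have [measurable]: "q k \<in> borel_measurable lborel" for k
    by (rule borel_measurable_has_bochner_integral[OF q])
  have Gm: "G \<in> borel_measurable lborel"
    by (rule borel_measurable_LIMSEQ_real[where u=q]) (use qG in auto)
  have qb: "norm (q k x) \<le> C * indicator (cball 0 (R + 1)) x" for k x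
  proof (cases "norm x \<le> R + 1")
    case True
    have "\<bar>F (x + (1 / real (Suc k)) *\<^sub>R b) - F x\<bar> * real (Suc k) \<le> C * \<bar>1 / real (Suc k)\<bar> * real (Suc k)"
      by (intro mult_right_mono lip) simp
    then show ?thesis using True by (simp add: q_def abs_mult)
  next
    case False
    have "norm x \<le> norm (x + (1 / real (Suc k)) *\<^sub>R b) + norm ((1 / real (Suc k)) *\<^sub>R b)"
      using norm_triangle_ineq4[of "x + (1 / real (Suc k)) *\<^sub>R b" "(1 / real (Suc k)) *\<^sub>R b"] by simp
    moreover have "norm ((1 / real (Suc k)) *\<^sub>R b) \<le> 1" using b by simp
    ultimately have "norm (x + (1 / real (Suc k)) *\<^sub>R b) \<ge> R" using False by linarith
    then have "F (x + (1 / real (Suc k)) *\<^sub>R b) = 0" by (rule supp)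
    moreover have "F x = 0" using False by (intro supp) simp
    ultimately show ?thesis using C by (simp add: q_def)
  qed
  have "integrable lborel G"
    by (rule integrable_dominated_convergence[OF Gm _ ind, of q C "R + 1"]) (use qG qb in auto)
  moreover have "(\<lambda>k. integral\<^sup>L lborel (q k)) \<longlonglongrightarrow> integral\<^sup>L lborel G"
    by (rule integral_dominated_convergence[OF Gm _ ind, of q C "R + 1"]) (use qG qb in auto)
  then have "integral\<^sup>L lborel G = 0"
    using has_bochner_integral_integral_eq[OF q] by (simp add: LIMSEQ_const_iff)
  ultimately show ?thesis by (simp add: has_bochner_integral_iff)
qed

section \<open>Continuously differentiable functions on the sphere\<close>

text \<open>A relational form of class \<open>C^1\<close>: unlike \<open>sphere_grad\<close>, which
  rests on a definite description, it can be derived by rules for sums, products and compositions.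
  Tangency makes \<open>G\<close> unique on the sphere.\<close>

definition has_sphere_grad :: "('a::euclidean_space \<Rightarrow> real) \<Rightarrow> ('a \<Rightarrow> 'a) \<Rightarrow> bool"
  where "has_sphere_grad f G \<longleftrightarrow> (\<forall>x\<in>sphere 0 1.
      (f has_derivative (\<lambda>h. G x \<bullet> h)) (at x within sphere 0 1) \<and> G x \<bullet> x = 0) \<and>
    continuous_on (sphere 0 1) G"

lemma has_sphere_gradD:
  assumes "has_sphere_grad f G"
  shows "norm x = 1 \<Longrightarrow> (f has_derivative (\<lambda>h. G x \<bullet> h)) (at x within sphere 0 1)"
    and "norm x = 1 \<Longrightarrow> G x \<bullet> x = 0"
    and "continuous_on (sphere 0 1) G"
    and "continuous_on (sphere 0 1) f"
proof -
  show d: "norm x = 1 \<Longrightarrow> (f has_derivative (\<lambda>h. G x \<bullet> h)) (at x within sphere 0 1)"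
    and "norm x = 1 \<Longrightarrow> G x \<bullet> x = 0" and "continuous_on (sphere 0 1) G" for x
    using assms by (simp_all add: has_sphere_grad_def)
  show "continuous_on (sphere 0 1) f"
    unfolding continuous_on_eq_continuous_within using d has_derivative_continuous by (metis mem_sphere_0)
qed

lemma has_sphere_grad_unique:
  fixes f :: "'a::euclidean_space \<Rightarrow> real"
  assumes "has_sphere_grad f G" and x: "norm x = 1"
  shows "sphere_grad f x = G x"
proof -
  have "sphere_deriv f x = (\<lambda>h. G x \<bullet> h)"
    using assms by (intro sphere_deriv_eqI) (auto dest: has_sphere_gradD)
  then show ?thesis by (simp add: sphere_grad_def euclidean_representation)
qed

lemma has_sphere_grad_Ck:
  fixes f :: "'a::euclidean_space \<Rightarrow> real"
  assumes "Ck_sphere (Suc 0) f"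
  shows "has_sphere_grad f (sphere_grad f)"
  unfolding has_sphere_grad_def
proof (intro conjI ballI)
  have f: "f differentiable (at x within sphere 0 1)" if "norm x = 1" for x
    using assms that by (auto simp: differentiable_on_def)
  show "continuous_on (sphere 0 1) (sphere_grad f)"
    using assms by (subst continuous_on_componentwise) auto
  fix x :: 'a assume x: "x \<in> sphere 0 1"
  have d: "(f has_derivative sphere_deriv f x) (at x within sphere 0 1)"
    using x f by (intro sphere_deriv_works) auto
  interpret bounded_linear "sphere_deriv f x" using d by (rule has_derivative_bounded_linear)
  have *: "sphere_deriv f x h = sphere_grad f x \<bullet> h" for h
  proof -
    have "sphere_deriv f x h = sphere_deriv f x (\<Sum>b\<in>Basis. (h \<bullet> b) *\<^sub>R b)"
      by (simp add: euclidean_representation)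
    also have "\<dots> = sphere_grad f x \<bullet> h"
      by (simp add: sum scaleR sphere_grad_def inner_sum_left) (simp add: inner_commute mult.commute)
    finally show ?thesis .
  qed
  have "sphere_deriv f x = (\<lambda>h. sphere_grad f x \<bullet> h)" by (rule ext) (rule *)
  then show "(f has_derivative (\<lambda>h. sphere_grad f x \<bullet> h)) (at x within sphere 0 1)"
    using d by simp
  have "sphere_deriv f x x = 0"
    using sphere_deriv_eq_projection(2)[OF x d] x
    by (metis (no_types, lifting) diff_self dot_square_norm mem_sphere_0 power_one scaleR_one zero)
  then show "sphere_grad f x \<bullet> x = 0" by (simp add: *)
qed

lemma has_sphere_grad_const: "has_sphere_grad (\<lambda>x. c) (\<lambda>x. 0)"
  by (simp add: has_sphere_grad_def)

lemma has_sphere_grad_add: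
  fixes f g :: "'a::euclidean_space \<Rightarrow> real"
  assumes "has_sphere_grad f F" "has_sphere_grad g G"
  shows "has_sphere_grad (\<lambda>x. f x + g x) (\<lambda>x. F x + G x)"
  unfolding has_sphere_grad_def
proof (intro conjI ballI continuous_on_add has_sphere_gradD(3)[OF assms(1)] has_sphere_gradD(3)[OF assms(2)])
  fix x :: 'a assume "x \<in> sphere 0 1"
  then have x: "norm x = 1" by simp
  show "((\<lambda>x. f x + g x) has_derivative (\<lambda>h. (F x + G x) \<bullet> h)) (at x within sphere 0 1)"
    using has_derivative_add[OF has_sphere_gradD(1)[OF assms(1) x] has_sphere_gradD(1)[OF assms(2) x]]
    by (simp add: inner_add_left)
  show "(F x + G x) \<bullet> x = 0"
    using has_sphere_gradD(2)[OF assms(1) x] has_sphere_gradD(2)[OF assms(2) x] by (simp add: inner_add_left)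
qed

lemma has_sphere_grad_mult:
  fixes f g :: "'a::euclidean_space \<Rightarrow> real"
  assumes "has_sphere_grad f F" "has_sphere_grad g G"
  shows "has_sphere_grad (\<lambda>x. f x * g x) (\<lambda>x. f x *\<^sub>R G x + g x *\<^sub>R F x)"
  unfolding has_sphere_grad_def
proof (intro conjI ballI)
  show "continuous_on (sphere 0 1) (\<lambda>x. f x *\<^sub>R G x + g x *\<^sub>R F x)"
    by (intro continuous_on_add continuous_on_scaleR has_sphere_gradD(3,4)[OF assms(1)]
        has_sphere_gradD(3,4)[OF assms(2)])
  fix x :: 'a assume "x \<in> sphere 0 1"
  then have x: "norm x = 1" by simp
  show "((\<lambda>x. f x * g x) has_derivative (\<lambda>h. (f x *\<^sub>R G x + g x *\<^sub>R F x) \<bullet> h)) (at x within sphere 0 1)"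
    using has_derivative_mult[OF has_sphere_gradD(1)[OF assms(1) x] has_sphere_gradD(1)[OF assms(2) x]]
    by (simp add: inner_add_left mult.commute)
  show "(f x *\<^sub>R G x + g x *\<^sub>R F x) \<bullet> x = 0"
    using has_sphere_gradD(2)[OF assms(1) x] has_sphere_gradD(2)[OF assms(2) x] by (simp add: inner_add_left)
qed

lemma has_sphere_grad_cmult:
  "has_sphere_grad f F \<Longrightarrow> has_sphere_grad (\<lambda>x. c * f x) (\<lambda>x. c *\<^sub>R F x)"
  using has_sphere_grad_mult[OF has_sphere_grad_const[of c], of f F] by simp

lemma has_sphere_grad_diff:
  assumes "has_sphere_grad f F" "has_sphere_grad g G"
  shows "has_sphere_grad (\<lambda>x. f x - g x) (\<lambda>x. F x - G x)"
  using has_sphere_grad_add[OF assms(1) has_sphere_grad_cmult[OF assms(2), of "-1"]] by simp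

lemma has_sphere_grad_inner:
  fixes y :: "'a::euclidean_space"
  shows "has_sphere_grad (\<lambda>x. x \<bullet> y) (\<lambda>x. y - (x \<bullet> y) *\<^sub>R x)"
  unfolding has_sphere_grad_def
proof (intro conjI ballI)
  fix x :: 'a assume x: "x \<in> sphere 0 1"
  have "((\<lambda>x. x \<bullet> y) has_derivative (\<lambda>h. h \<bullet> y)) (at x within sphere 0 1)"
    by (auto intro!: derivative_eq_intros)
  from sphere_deriv_eq_projection(1)[OF x this]
  show "((\<lambda>x. x \<bullet> y) has_derivative (\<lambda>h. (y - (x \<bullet> y) *\<^sub>R x) \<bullet> h)) (at x within sphere 0 1)"
    by (rule has_derivative_eq_rhs)
      (simp add: fun_eq_iff inner_diff_left inner_diff_right inner_commute mult.commute)
  show "(y - (x \<bullet> y) *\<^sub>R x) \<bullet> x = 0"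
    using x by (simp add: inner_diff_left inner_diff_right inner_commute norm_eq_1)
qed (intro continuous_intros)

lemma has_sphere_grad_compose:
  fixes f :: "'a::euclidean_space \<Rightarrow> real"
  assumes f: "has_sphere_grad f F"
    and p: "\<And>x. norm x = 1 \<Longrightarrow> (p has_real_derivative p' (f x)) (at (f x))"
    and p': "continuous_on (f ` sphere 0 1) p'"
  shows "has_sphere_grad (\<lambda>x. p (f x)) (\<lambda>x. p' (f x) *\<^sub>R F x)"
  unfolding has_sphere_grad_def
proof (intro conjI ballI)
  show "continuous_on (sphere 0 1) (\<lambda>x. p' (f x) *\<^sub>R F x)"
    using has_sphere_gradD(3,4)[OF f] p' by (intro continuous_intros continuous_on_compose2[OF p']) auto
  fix x :: 'a assume "x \<in> sphere 0 1"
  then have x: "norm x = 1" by simp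
  show "p' (f x) *\<^sub>R F x \<bullet> x = 0" using has_sphere_gradD(2)[OF f x] by simp
  show "((\<lambda>x. p (f x)) has_derivative (\<lambda>h. p' (f x) *\<^sub>R F x \<bullet> h)) (at x within sphere 0 1)"
    using has_derivative_compose[OF has_sphere_gradD(1)[OF f x] p[OF x, unfolded has_field_derivative_def]]
    by simp
qed

text \<open>The derivative of \<open>sgn\<close> is the tangential projection at
  \<open>sgn x\<close> divided by \<open>norm x\<close>; the projection disappears because
  \<open>F (sgn x)\<close> is already tangential.\<close>

lemma has_derivative_radial_extension:
  fixes f :: "'a::euclidean_space \<Rightarrow> real"
  assumes f: "has_sphere_grad f F" and x: "x \<noteq> 0"
  shows "((\<lambda>x. f (sgn x)) has_derivative (\<lambda>h. F (sgn x) \<bullet> h / norm x)) (at x)"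
proof -
  have s: "norm (sgn x) = 1" using x by (simp add: norm_sgn)
  have "(sgn has_derivative (\<lambda>h. (h - (sgn x \<bullet> h) *\<^sub>R sgn x) /\<^sub>R norm x)) (at x)"
  proof -
    have sgn_eq: "sgn = (\<lambda>x::'a. inverse (norm x) *\<^sub>R x)" by (simp add: fun_eq_iff sgn_div_norm)
    show ?thesis
      unfolding sgn_eq using x
      by (auto intro!: derivative_eq_intros has_derivative_norm
          simp: sgn_div_norm algebra_simps inner_commute power2_eq_square)
  qed
  then have "(sgn has_derivative (\<lambda>h. (h - (sgn x \<bullet> h) *\<^sub>R sgn x) /\<^sub>R norm x)) (at x within - {0})"
    by (rule has_derivative_at_withinI)
  moreover have "(f has_derivative (\<lambda>h. F (sgn x) \<bullet> h)) (at (sgn x) within sgn ` (- {0}))"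
    by (rule has_derivative_subset[OF has_sphere_gradD(1)[OF f s]]) (auto simp: norm_sgn split: if_splits)
  ultimately have "(f \<circ> sgn has_derivative (\<lambda>h. F (sgn x) \<bullet> h) \<circ>
      (\<lambda>h. (h - (sgn x \<bullet> h) *\<^sub>R sgn x) /\<^sub>R norm x)) (at x within - {0})"
    by (rule diff_chain_within)
  then have "(f \<circ> sgn has_derivative (\<lambda>h. F (sgn x) \<bullet> h) \<circ>
      (\<lambda>h. (h - (sgn x \<bullet> h) *\<^sub>R sgn x) /\<^sub>R norm x)) (at x)"
    using x by (subst (asm) at_within_open) auto
  then show ?thesis
    using has_sphere_gradD(2)[OF f s]
    by (simp add: o_def inner_diff_right divide_inverse mult.commute)
qed

lemma has_real_derivative_max_0_square:
  "((\<lambda>r::real. (max 0 r)\<^sup>2) has_real_derivative 2 * max 0 r) (at r)"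
proof -
  consider "r < 0" | "r > 0" | "r = 0" by linarith
  then show ?thesis
  proof cases
    case 1
    have "((\<lambda>r::real. 0) has_real_derivative 2 * max 0 r) (at r)" using 1 by simp
    then show ?thesis
      by (rule has_field_derivative_transform_within_open[where S="{..<0}"]) (use 1 in auto)
  next
    case 2
    have "((\<lambda>r::real. r\<^sup>2) has_real_derivative 2 * max 0 r) (at r)"
      using 2 by (auto intro!: derivative_eq_intros)
    then show ?thesis
      by (rule has_field_derivative_transform_within_open[where S="{0<..}"]) (use 2 in auto)
  next
    case 3
    have "((\<lambda>h::real. (max 0 h)\<^sup>2 / h) \<longlongrightarrow> 0) (at 0)"
    proof (rule Lim_null_comparison)
      show "\<forall>\<^sub>F h::real in at 0. norm ((max 0 h)\<^sup>2 / h) \<le> \<bar>h\<bar>"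
        by (rule always_eventually) (auto simp: max_def power2_eq_square)
      show "((\<lambda>h::real. \<bar>h\<bar>) \<longlongrightarrow> 0) (at 0)" by (rule tendsto_rabs_zero) simp
    qed
    then show ?thesis using 3 by (simp add: DERIV_def)
  qed
qed

lemma cutoff_has_real_derivative:
  "(cutoff has_real_derivative 2 * max 0 ((r - 1) * (2 - r)) * (3 - 2 * r)) (at r)"
  unfolding cutoff_def[abs_def]
  by (rule DERIV_cong[OF DERIV_chain2[OF has_real_derivative_max_0_square]])
    (auto intro!: derivative_eq_intros simp: algebra_simps)

text \<open>The field is extended to \<open>'a\<close> as
  \<open>\<zeta> (norm x) *\<^sub>R X (sgn x)\<close>. Its divergence has a radial part, which is
  zero because \<open>X\<close> is tangential, and \<open>\<zeta> (norm x) / norm x\<close> times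
  the spherical divergence. With \<open>\<zeta> r = cutoff r / r ^ n\<close> this factor is exactly
  the weight in \<open>surf\<close>, so the integral over the sphere is that of a compactly
  supported divergence.\<close>

lemma sphere_divergence_theorem:
  fixes X :: "'a::euclidean_space \<Rightarrow> 'a"
  assumes X: "\<And>b. b \<in> Basis \<Longrightarrow> has_sphere_grad (\<lambda>x. X x \<bullet> b) (G b)"
    and tangent: "\<And>x. norm x = 1 \<Longrightarrow> X x \<bullet> x = 0"
  shows "(LINT x|surf. (\<Sum>b\<in>Basis. G b x \<bullet> b)) = 0"
proof -
  define n where "n = DIM('a) - 1"
  have n: "DIM('a) = Suc n" using DIM_positive[where 'a='a] by (simp add: n_def)
  define \<zeta> where "\<zeta> = (\<lambda>r. cutoff r / r ^ n)"
  define \<zeta>' where "\<zeta>' = (\<lambda>r. 2 * max 0 ((r - 1) * (2 - r)) * (3 - 2 * r) / r ^ n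
    - real n * cutoff r / r ^ Suc n)"
  have \<zeta>_deriv: "(\<zeta> has_real_derivative \<zeta>' r) (at r)" if r: "r > 0" for r
  proof -
    have "(\<zeta> has_real_derivative (2 * max 0 ((r - 1) * (2 - r)) * (3 - 2 * r) * r ^ n
        - cutoff r * (real n * r ^ (n - 1))) / (r ^ n * r ^ n)) (at r)"
      unfolding \<zeta>_def using r
      by (intro DERIV_divide cutoff_has_real_derivative) (auto intro!: derivative_eq_intros)
    moreover have "(2 * max 0 ((r - 1) * (2 - r)) * (3 - 2 * r) * r ^ n
        - cutoff r * (real n * r ^ (n - 1))) / (r ^ n * r ^ n) = \<zeta>' r"
      unfolding \<zeta>'_def using r by (cases n) (auto simp: field_simps)
    ultimately show ?thesis by simp
  qed
  have zero: "\<zeta> r = 0" "\<zeta>' r = 0" if "r \<le> 1 \<or> r \<ge> 2" for r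
  proof -
    have "max 0 ((r - 1) * (2 - r)) = 0"
      using that by (auto simp: mult_nonneg_nonpos mult_nonpos_nonneg)
    then show "\<zeta>' r = 0" unfolding \<zeta>'_def cutoff_eq_0[OF that] by simp
    show "\<zeta> r = 0" unfolding \<zeta>_def cutoff_eq_0[OF that] by simp
  qed
  have pow: "1 \<le> r ^ k" if "1 \<le> r" for r :: real and k using that by (rule one_le_power)
  have \<zeta>_le: "\<bar>\<zeta> r\<bar> / r \<le> 1" if "r > 0" for r
  proof (cases "1 < r \<and> r < 2")
    case True
    then have "cutoff r / (r ^ n * r) \<le> 1 / 1"
      using cutoff_le_1[of r] pow[of r "Suc n"] by (intro frac_le) (auto simp: mult.commute)
    then show ?thesis using True by (simp add: \<zeta>_def)
  qed (use zero in auto)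
  have \<zeta>'_le: "\<bar>\<zeta>' r\<bar> \<le> 2 + real n" if "r > 0" for r
  proof (cases "1 < r \<and> r < 2")
    case True
    have a: "(r - 1) * (2 - r) \<le> 1" "(r - 1) * (2 - r) \<ge> 0" "\<bar>3 - 2 * r\<bar> \<le> 1"
      using True mult_mono[of "r - 1" 1 "2 - r" 1] by auto
    have "\<bar>2 * max 0 ((r - 1) * (2 - r)) * (3 - 2 * r)\<bar> \<le> 2"
      using a mult_mono[of "(r - 1) * (2 - r)" 1 "\<bar>3 - 2 * r\<bar>" 1] by (simp add: abs_mult)
    then have "\<bar>2 * max 0 ((r - 1) * (2 - r)) * (3 - 2 * r)\<bar> / r ^ n \<le> 2 / 1"
      using pow[of r n] True by (intro frac_le) auto
    moreover have "real n * cutoff r / r ^ Suc n \<le> real n / 1"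
      using cutoff_le_1[of r] pow[of r "Suc n"] True
      by (intro frac_le) (auto simp: mult_left_le)
    moreover have "real n * cutoff r / r ^ Suc n \<ge> 0" using True by simp
    ultimately show ?thesis
      using True abs_triangle_ineq4[of "2 * max 0 ((r - 1) * (2 - r)) * (3 - 2 * r) / r ^ n"
          "real n * cutoff r / r ^ Suc n"]
      by (simp add: \<zeta>'_def abs_divide)
  qed (use zero in auto)
  \<comment> \<open>\<open>Y b\<close> is the derivative in direction \<open>b\<close> of the
    component along \<open>b\<close> of the extended field. It is 0 at the origin because the cutoff
    vanishes in the unit ball.\<close>
  define Y where "Y = (\<lambda>b x. if x = 0 then 0 else
    \<zeta>' (norm x) * (sgn x \<bullet> b) * (X (sgn x) \<bullet> b) + \<zeta> (norm x) / norm x * (G b (sgn x) \<bullet> b))"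
  have Y: "has_bochner_integral lborel (Y b) 0" if b: "b \<in> Basis" for b
  proof -
    define F where "F = (\<lambda>x. \<zeta> (norm x) * (X (sgn x) \<bullet> b))"
    have F': "(F has_derivative (\<lambda>h. \<zeta>' (norm x) * (sgn x \<bullet> h) * (X (sgn x) \<bullet> b)
        + \<zeta> (norm x) / norm x * (G b (sgn x) \<bullet> h))) (at x)" if x: "x \<noteq> 0" for x
    proof -
      have "((\<lambda>x. \<zeta> (norm x)) has_derivative (\<lambda>h. \<zeta>' (norm x) * (sgn x \<bullet> h))) (at x)"
        using has_derivative_compose[OF has_derivative_norm[OF x] \<zeta>_deriv[unfolded has_field_derivative_def, of "norm x"]] x
        by (simp add: inner_commute)
      from has_derivative_mult[OF this has_derivative_radial_extension[OF X[OF b] x]]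
      show ?thesis
        unfolding F_def by (rule has_derivative_eq_rhs) (simp add: fun_eq_iff algebra_simps)
    qed
    have F0: "(F has_derivative (\<lambda>h. 0)) (at 0)"
    proof (rule has_derivative_transform_within_open[of "\<lambda>x. 0" _ _ _ "ball 0 1"])
      show "0 = F x" if "x \<in> ball 0 1" for x using that zero(1)[of "norm x"] by (simp add: F_def)
    qed auto
    have "((\<lambda>s. F (x + s *\<^sub>R b)) has_real_derivative Y b x) (at 0)" for x
    proof -
      define D where "D = (if x = 0 then (\<lambda>h. 0) else (\<lambda>h. \<zeta>' (norm x) * (sgn x \<bullet> h) * (X (sgn x) \<bullet> b)
        + \<zeta> (norm x) / norm x * (G b (sgn x) \<bullet> h)))"
      have D: "(F has_derivative D) (at (x + 0 *\<^sub>R b))" using F' F0 by (simp add: D_def)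
      have "((\<lambda>s. x + s *\<^sub>R b) has_derivative (\<lambda>s. s *\<^sub>R b)) (at 0)"
        by (auto intro!: derivative_eq_intros)
      from has_derivative_compose[OF this D]
      show ?thesis
        unfolding has_field_derivative_def
        by (rule has_derivative_eq_rhs) (auto simp: fun_eq_iff D_def Y_def algebra_simps)
    qed
    moreover obtain C1 where C1: "C1 \<ge> 0" "\<And>x. norm x = 1 \<Longrightarrow> norm (X x \<bullet> b) \<le> C1"
      using continuous_on_sphere_bounded[OF has_sphere_gradD(4)[OF X[OF b]]] by blast
    obtain C2 where C2: "C2 \<ge> 0" "\<And>x. norm x = 1 \<Longrightarrow> norm (G b x) \<le> C2"
      using continuous_on_sphere_bounded[OF has_sphere_gradD(3)[OF X[OF b]]] by blast
    have "\<bar>Y b x\<bar> \<le> (2 + real n) * C1 + C2" for x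
    proof (cases "x = 0")
      case False
      have s: "norm (sgn x) = 1" using False by (simp add: norm_sgn)
      have "\<bar>sgn x \<bullet> b\<bar> \<le> 1" "\<bar>G b (sgn x) \<bullet> b\<bar> \<le> C2"
        using Cauchy_Schwarz_ineq2[of "sgn x" b] Cauchy_Schwarz_ineq2[of "G b (sgn x)" b] b s C2(2)[OF s]
        by auto
      then have "\<bar>\<zeta>' (norm x)\<bar> * \<bar>sgn x \<bullet> b\<bar> * \<bar>X (sgn x) \<bullet> b\<bar> \<le> (2 + real n) * 1 * C1"
        "\<bar>\<zeta> (norm x)\<bar> / norm x * \<bar>G b (sgn x) \<bullet> b\<bar> \<le> 1 * C2"
        using \<zeta>'_le[of "norm x"] \<zeta>_le[of "norm x"] False C1(2)[OF s] C1(1) C2(1)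
        by (intro mult_mono; force)+
      moreover have "\<bar>Y b x\<bar> \<le> \<bar>\<zeta>' (norm x)\<bar> * \<bar>sgn x \<bullet> b\<bar> * \<bar>X (sgn x) \<bullet> b\<bar>
          + \<bar>\<zeta> (norm x)\<bar> / norm x * \<bar>G b (sgn x) \<bullet> b\<bar>"
        using False abs_triangle_ineq[of "\<zeta>' (norm x) * (sgn x \<bullet> b) * (X (sgn x) \<bullet> b)"
          "\<zeta> (norm x) / norm x * (G b (sgn x) \<bullet> b)"]
        by (simp only: Y_def abs_mult abs_divide abs_norm_cancel if_False)
      ultimately show ?thesis by linarith
    qed (simp add: Y_def C1 C2)
    moreover have "continuous_on UNIV F"
    proof (intro continuous_at_imp_continuous_on ballI)
      show "isCont F x" for x
        using F'[of x] F0 by (cases "x = 0") (auto dest: has_derivative_continuous)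
    qed
    then have "F \<in> borel_measurable borel" by (rule borel_measurable_continuous_onI)
    moreover have "F x = 0" if "norm x \<ge> 2" for x
      using zero(1)[of "norm x"] that by (simp add: F_def)
    ultimately show ?thesis
      using norm_Basis[OF b]
      by (intro has_bochner_integral_directional_derivative[where F=F and R=2 and b=b and C="(2 + real n) * C1 + C2"])
        simp_all
  qed
  have "has_bochner_integral lborel (\<lambda>x. \<Sum>b\<in>Basis. Y b x) (\<Sum>b\<in>(Basis::'a set). 0)"
    by (intro has_bochner_integral_sum Y)
  then have "(\<Sum>b\<in>(Basis::'a set). 0) = (\<integral>x. (\<Sum>b\<in>Basis. Y b x) \<partial>lborel)"
    by (rule has_bochner_integral_integral_eq[symmetric])
  then have Y0: "0 = (\<integral>x. (\<Sum>b\<in>Basis. Y b x) \<partial>lborel)" by (simp only: sum.neutral_const)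
  have Y_eq: "(\<lambda>x. \<Sum>b\<in>Basis. Y b x) = (\<lambda>x. indicator (- {0}) x *
      (cutoff (norm x) / norm x ^ DIM('a) * (\<Sum>b\<in>Basis. G b (sgn x) \<bullet> b)))"
  proof
    fix x :: 'a
    show "(\<Sum>b\<in>Basis. Y b x) = indicator (- {0}) x *
      (cutoff (norm x) / norm x ^ DIM('a) * (\<Sum>b\<in>Basis. G b (sgn x) \<bullet> b))"
    proof (cases "x = 0")
      case False
      have "(\<Sum>b\<in>Basis. (sgn x \<bullet> b) * (X (sgn x) \<bullet> b)) = sgn x \<bullet> X (sgn x)"
        by (rule euclidean_inner[symmetric])
      also have "\<dots> = 0" using tangent[of "sgn x"] False by (simp add: norm_sgn inner_commute)
      finally have "(\<Sum>b\<in>Basis. \<zeta>' (norm x) * (sgn x \<bullet> b) * (X (sgn x) \<bullet> b)) = 0"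
        by (simp add: sum_distrib_left[symmetric] mult.assoc)
      moreover have "(\<Sum>b\<in>Basis. Y b x) =
          (\<Sum>b\<in>Basis. \<zeta>' (norm x) * (sgn x \<bullet> b) * (X (sgn x) \<bullet> b)) +
          \<zeta> (norm x) / norm x * (\<Sum>b\<in>Basis. G b (sgn x) \<bullet> b)"
        using False by (simp only: Y_def sum.distrib sum_distrib_left if_False)
      moreover have "\<zeta> (norm x) / norm x = cutoff (norm x) / norm x ^ DIM('a)"
        by (simp add: \<zeta>_def n mult.commute)
      ultimately show ?thesis using False by simp
    qed (simp add: Y_def)
  qed
  have "(\<integral>x. indicator (- {0}) x * (cutoff (norm x) / norm x ^ DIM('a) *
      (\<Sum>b\<in>Basis. G b (sgn x) \<bullet> b)) \<partial>lborel) = (LINT x|surf. (\<Sum>b\<in>Basis. G b x \<bullet> b))"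
    by (rule integral_surf[symmetric], rule borel_measurable_surf_continuous)
      (intro continuous_intros has_sphere_gradD(3)[OF X])
  then show ?thesis using Y0 unfolding Y_eq by (rule trans[OF sym sym])
qed

section \<open>The Laplacian and Green's identity\<close>

text \<open>Relational counterpart of \<open>laplace_beltrami\<close>, packaged with the
  \<open>C^2\<close> regularity that Green's identity uses. As in \<open>sphere_div\<close>, the
  trace runs over all of \<open>'a\<close>.\<close>

definition has_sphere_laplacian :: "('a::euclidean_space \<Rightarrow> real) \<Rightarrow> ('a \<Rightarrow> real) \<Rightarrow> bool"
  where "has_sphere_laplacian u A \<longleftrightarrow> (\<exists>U V. has_sphere_grad u U \<and>
    (\<forall>b\<in>Basis. has_sphere_grad (\<lambda>x. U x \<bullet> b) (V b)) \<and>
    (\<forall>x\<in>sphere 0 1. A x = (\<Sum>b\<in>Basis. V b x \<bullet> b)))"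

lemma has_sphere_laplacian_continuous:
  assumes "has_sphere_laplacian u A"
  shows "continuous_on (sphere 0 1) u" "continuous_on (sphere 0 1) A"
proof -
  from assms obtain U V where *: "has_sphere_grad u U"
    "\<And>b. b \<in> Basis \<Longrightarrow> has_sphere_grad (\<lambda>x. U x \<bullet> b) (V b)"
    "\<And>x. x \<in> sphere 0 1 \<Longrightarrow> A x = (\<Sum>b\<in>Basis. V b x \<bullet> b)"
    unfolding has_sphere_laplacian_def by blast
  show "continuous_on (sphere 0 1) u" using *(1) by (rule has_sphere_gradD)
  have "continuous_on (sphere 0 1) (\<lambda>x. \<Sum>b\<in>Basis. V b x \<bullet> b)"
    by (intro continuous_intros has_sphere_gradD(3)[OF *(2)])
  then show "continuous_on (sphere 0 1) A"
    by (rule continuous_on_eq) (simp add: *(3))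
qed

lemma has_sphere_laplacian_const: "has_sphere_laplacian (\<lambda>x. c) (\<lambda>x. 0)"
  unfolding has_sphere_laplacian_def
  by (rule exI[of _ "\<lambda>x. 0"], rule exI[of _ "\<lambda>b x. 0"]) (simp add: has_sphere_grad_const)

text \<open>The divergence theorem for the tangent field
  \<open>g x *\<^sub>R U x - u x *\<^sub>R W x\<close>; the two mixed gradient terms cancel.\<close>

lemma sphere_green:
  assumes u: "has_sphere_laplacian u A" and g: "has_sphere_laplacian g B"
  shows "(LINT x|surf. g x * A x) = (LINT x|surf. u x * B x)"
proof -
  obtain U V where U: "has_sphere_grad u U"
    "\<And>b. b \<in> Basis \<Longrightarrow> has_sphere_grad (\<lambda>x. U x \<bullet> b) (V b)"
    "\<And>x. x \<in> sphere 0 1 \<Longrightarrow> A x = (\<Sum>b\<in>Basis. V b x \<bullet> b)"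
    using u unfolding has_sphere_laplacian_def by blast
  obtain W Z where W: "has_sphere_grad g W"
    "\<And>b. b \<in> Basis \<Longrightarrow> has_sphere_grad (\<lambda>x. W x \<bullet> b) (Z b)"
    "\<And>x. x \<in> sphere 0 1 \<Longrightarrow> B x = (\<Sum>b\<in>Basis. Z b x \<bullet> b)"
    using g unfolding has_sphere_laplacian_def by blast
  define X where "X = (\<lambda>x. g x *\<^sub>R U x - u x *\<^sub>R W x)"
  define G where "G = (\<lambda>b x. (g x *\<^sub>R V b x + (U x \<bullet> b) *\<^sub>R W x) - (u x *\<^sub>R Z b x + (W x \<bullet> b) *\<^sub>R U x))"
  have XG: "has_sphere_grad (\<lambda>x. X x \<bullet> b) (G b)" if "b \<in> Basis" for b
    unfolding X_def G_def inner_diff_left inner_scaleR_left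
    by (intro has_sphere_grad_diff has_sphere_grad_mult U(1,2) W(1,2) that)
  have "(LINT x|surf. (\<Sum>b\<in>Basis. G b x \<bullet> b)) = 0"
    by (rule sphere_divergence_theorem[OF XG])
      (simp_all add: X_def inner_diff_left has_sphere_gradD(2)[OF U(1)] has_sphere_gradD(2)[OF W(1)])
  moreover have "(\<Sum>b\<in>Basis. G b x \<bullet> b) = g x * A x - u x * B x" if "x \<in> sphere 0 1" for x
  proof -
    have "(\<Sum>b\<in>Basis. (U x \<bullet> b) * (W x \<bullet> b)) = U x \<bullet> W x"
      by (rule euclidean_inner[symmetric])
    moreover have "(\<Sum>b\<in>Basis. (W x \<bullet> b) * (U x \<bullet> b)) = W x \<bullet> U x"
      by (rule euclidean_inner[symmetric])
    ultimately show ?thesis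
      by (simp add: inner_commute[of "U x" "W x"] G_def U(3)[OF that] W(3)[OF that] inner_diff_left inner_add_left
          sum.distrib sum_subtractf sum_distrib_left)
  qed
  ultimately have "(LINT x|surf. g x * A x - u x * B x) = 0"
    using Bochner_Integration.integral_cong[OF refl, of surf
      "\<lambda>x. \<Sum>b\<in>Basis. G b x \<bullet> b" "\<lambda>x. g x * A x - u x * B x"] by simp
  moreover have "integrable surf (\<lambda>x. g x * A x)" "integrable surf (\<lambda>x. u x * B x)"
    by (intro integrable_surf_continuous continuous_on_mult
        has_sphere_laplacian_continuous[OF u] has_sphere_laplacian_continuous[OF g])+
  ultimately show ?thesis using Bochner_Integration.integral_diff[of surf "\<lambda>x. g x * A x" "\<lambda>x. u x * B x"]
    by linarith
qed

section \<open>Riesz kernels\<close>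

text \<open>On the sphere \<open>1 - x \<bullet> y\<close> is half the squared distance, so order
  \<gamma> means the power \<open>- 2 * \<gamma>\<close> of the distance; this explains the
  integrability condition \<open>2 * \<gamma> < real DIM('a) - 1\<close> below. A positive
  \<epsilon> removes the singularity. For \<epsilon> = 0 the value at \<open>x = y\<close> is
  \<open>0 powr (- \<gamma>) = 0\<close>, on what will turn out to be a null set.\<close>

definition riesz :: "real \<Rightarrow> real \<Rightarrow> 'a::euclidean_space \<Rightarrow> 'a \<Rightarrow> real"
  where "riesz \<epsilon> \<gamma> y x = (1 + \<epsilon> - x \<bullet> y) powr (- \<gamma>)"

lemma sphere_inner_le_1: "norm x = 1 \<Longrightarrow> norm y = 1 \<Longrightarrow> x \<bullet> y \<le> 1"
  using norm_cauchy_schwarz[of x y] by simp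

lemma sphere_inner_eq_1_iff:
  "norm x = 1 \<Longrightarrow> norm y = 1 \<Longrightarrow> x \<bullet> y = 1 \<longleftrightarrow> x = y"
  using norm_cauchy_schwarz_eq[of x y] by auto

lemma riesz_nonneg [simp]: "riesz \<epsilon> \<gamma> y x \<ge> 0"
  by (simp add: riesz_def)

lemma continuous_on_riesz:
  assumes "\<epsilon> > 0" "norm y = 1"
  shows "continuous_on (sphere 0 1) (riesz \<epsilon> \<gamma> y)"
  unfolding riesz_def[abs_def]
  using assms sphere_inner_le_1[of _ y] by (intro continuous_intros) force+

lemma measurable_riesz: "riesz \<epsilon> \<gamma> y \<in> borel_measurable surf"
proof -
  have "riesz \<epsilon> \<gamma> y \<in> borel_measurable borel"
    unfolding riesz_def[abs_def] by measurable
  then have "riesz \<epsilon> \<gamma> y \<in> borel_measurable (restrict_space borel (sphere 0 1))"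
    by (rule measurable_restrict_space1)
  then show ?thesis using measurable_cong_sets[OF sets_surf refl] by blast
qed

text \<open>For a function \<phi> of \<xi> = \<open>x \<bullet> y\<close> the Laplacian is (1 -
  \<xi>^2) \<phi>'' - n \<xi> \<phi>'. With \<sigma> = 1 + \<epsilon> - \<xi> one has 1 - \<xi>^2 =
  - \<epsilon> (2 + \<epsilon>) + 2 (1 + \<epsilon>) \<sigma> - \<sigma>^2, and sorting by powers of
  \<sigma> gives the three terms. The most singular one is the price of the regularization and
  carries a factor \<epsilon>.\<close>

lemma riesz_laplacian:
  fixes y :: "'a::euclidean_space"
  assumes \<epsilon>: "\<epsilon> > 0" and y: "norm y = 1"
  defines "n \<equiv> real DIM('a) - 1"
  shows "has_sphere_laplacian (riesz \<epsilon> \<beta> y) (\<lambda>x. \<beta> * (n - 1 - \<beta>) * riesz \<epsilon> \<beta> y x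
    - (1 + \<epsilon>) * \<beta> * (n - 2 - 2 * \<beta>) * riesz \<epsilon> (\<beta> + 1) y x
    - \<epsilon> * (2 + \<epsilon>) * \<beta> * (\<beta> + 1) * riesz \<epsilon> (\<beta> + 2) y x)"
proof -
  have pos: "0 < 1 + \<epsilon> - x \<bullet> y" if "norm x = 1" for x
    using sphere_inner_le_1[OF that y] \<epsilon> by simp
  have grad: "has_sphere_grad (riesz \<epsilon> \<gamma> y)
      (\<lambda>x. (\<gamma> * riesz \<epsilon> (\<gamma> + 1) y x) *\<^sub>R (y - (x \<bullet> y) *\<^sub>R x))" for \<gamma>
  proof -
    have "has_sphere_grad (\<lambda>x. (1 + \<epsilon> - x \<bullet> y) powr (- \<gamma>))
      (\<lambda>x. (\<gamma> * (1 + \<epsilon> - x \<bullet> y) powr (- (\<gamma> + 1))) *\<^sub>R (y - (x \<bullet> y) *\<^sub>R x))"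
    proof (rule has_sphere_grad_compose[OF has_sphere_grad_inner])
      fix x :: 'a assume x: "norm x = 1"
      show "((\<lambda>z. (1 + \<epsilon> - z) powr (- \<gamma>)) has_real_derivative
          \<gamma> * (1 + \<epsilon> - x \<bullet> y) powr (- (\<gamma> + 1))) (at (x \<bullet> y))"
      proof -
        have eq: "- (\<gamma> + 1) = - \<gamma> - 1" by simp
        show ?thesis
          unfolding eq using pos[OF x] by (auto intro!: derivative_eq_intros)
      qed
    next
      show "continuous_on ((\<lambda>x. x \<bullet> y) ` sphere 0 1) (\<lambda>z. \<gamma> * (1 + \<epsilon> - z) powr (- (\<gamma> + 1)))"
        using pos by (intro continuous_intros) force+
    qed
    then show ?thesis by (simp add: riesz_def[abs_def])
  qed
  define U where "U = (\<lambda>x. (\<beta> * riesz \<epsilon> (\<beta> + 1) y x) *\<^sub>R (y - (x \<bullet> y) *\<^sub>R x))"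
  define V where "V = (\<lambda>b x. (\<beta> * riesz \<epsilon> (\<beta> + 1) y x) *\<^sub>R
      (0 - ((x \<bullet> y) *\<^sub>R (b - (x \<bullet> b) *\<^sub>R x) + (x \<bullet> b) *\<^sub>R (y - (x \<bullet> y) *\<^sub>R x)))
    + (y \<bullet> b - (x \<bullet> y) * (x \<bullet> b)) *\<^sub>R
      (\<beta> *\<^sub>R (((\<beta> + 1) * riesz \<epsilon> (\<beta> + 2) y x) *\<^sub>R (y - (x \<bullet> y) *\<^sub>R x))))"
  have "has_sphere_grad (\<lambda>x. U x \<bullet> b) (V b)" for b
  proof -
    have "has_sphere_grad (\<lambda>x. (\<beta> * riesz \<epsilon> (\<beta> + 1) y x) * (y \<bullet> b - (x \<bullet> y) * (x \<bullet> b))) (V b)"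
      unfolding V_def
      by (intro has_sphere_grad_mult has_sphere_grad_cmult has_sphere_grad_diff has_sphere_grad_const
          has_sphere_grad_inner) (use grad[of "\<beta> + 1"] in \<open>simp add: add.assoc\<close>)
    then show ?thesis by (simp add: U_def inner_diff_left)
  qed
  moreover have "\<beta> * (n - 1 - \<beta>) * riesz \<epsilon> \<beta> y x
    - (1 + \<epsilon>) * \<beta> * (n - 2 - 2 * \<beta>) * riesz \<epsilon> (\<beta> + 1) y x
    - \<epsilon> * (2 + \<epsilon>) * \<beta> * (\<beta> + 1) * riesz \<epsilon> (\<beta> + 2) y x = (\<Sum>b\<in>Basis. V b x \<bullet> b)"
    if "x \<in> sphere 0 1" for x
  proof -
    have x: "norm x = 1" and xx: "x \<bullet> x = 1" and yy: "y \<bullet> y = 1"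
      using that y by (simp_all add: norm_eq_1)
    define \<xi> \<sigma> k where "\<xi> = x \<bullet> y" and "\<sigma> = 1 + \<epsilon> - x \<bullet> y" and "k = \<sigma> powr (- \<beta> - 2)"
    have \<sigma>: "\<sigma> > 0" using pos[OF x] by (simp add: \<sigma>_def)
    have k: "riesz \<epsilon> (\<beta> + 2) y x = k" "riesz \<epsilon> (\<beta> + 1) y x = k * \<sigma>"
      "riesz \<epsilon> \<beta> y x = k * \<sigma> * \<sigma>"
    proof -
      have a: "\<sigma> powr (c + 1) = \<sigma> powr c * \<sigma>" for c using \<sigma> by (simp add: powr_add)
      have "\<sigma> powr (- (\<beta> + 2)) = \<sigma> powr (- \<beta> - 2)" by simp
      moreover have "\<sigma> powr (- (\<beta> + 1)) = \<sigma> powr (- \<beta> - 2 + 1)" by (rule arg_cong[where f="(powr) \<sigma>"]) simp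
      moreover have "\<sigma> powr (- \<beta>) = \<sigma> powr (- \<beta> - 2 + 1 + 1)" by simp
      ultimately show "riesz \<epsilon> (\<beta> + 2) y x = k" "riesz \<epsilon> (\<beta> + 1) y x = k * \<sigma>"
        "riesz \<epsilon> \<beta> y x = k * \<sigma> * \<sigma>"
        unfolding riesz_def \<sigma>_def[symmetric] k_def by (simp_all only: a)
    qed
    have sums: "(\<Sum>b\<in>Basis. (x \<bullet> b) * (x \<bullet> b)) = 1" "(\<Sum>b\<in>Basis. (x \<bullet> b) * (y \<bullet> b)) = \<xi>"
      "(\<Sum>b\<in>Basis. (y \<bullet> b) * (y \<bullet> b)) = 1"
      using xx yy by (simp_all only: euclidean_inner[symmetric] \<xi>_def)
    have "(\<Sum>b\<in>Basis. V b x \<bullet> b) = (\<Sum>b\<in>Basis. - (\<beta> * k * \<sigma> * \<xi>)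
        + (2 * \<beta> * k * \<sigma> * \<xi> + \<beta> * (\<beta> + 1) * k * \<xi>\<^sup>2) * ((x \<bullet> b) * (x \<bullet> b))
        - (\<beta> * k * \<sigma> + 2 * \<beta> * (\<beta> + 1) * k * \<xi>) * ((x \<bullet> b) * (y \<bullet> b))
        + \<beta> * (\<beta> + 1) * k * ((y \<bullet> b) * (y \<bullet> b)))"
    proof (rule sum.cong[OF refl])
      fix b :: 'a assume "b \<in> Basis"
      then have bb: "b \<bullet> b = 1" by simp
      show "V b x \<bullet> b = - (\<beta> * k * \<sigma> * \<xi>)
        + (2 * \<beta> * k * \<sigma> * \<xi> + \<beta> * (\<beta> + 1) * k * \<xi>\<^sup>2) * ((x \<bullet> b) * (x \<bullet> b))
        - (\<beta> * k * \<sigma> + 2 * \<beta> * (\<beta> + 1) * k * \<xi>) * ((x \<bullet> b) * (y \<bullet> b))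
        + \<beta> * (\<beta> + 1) * k * ((y \<bullet> b) * (y \<bullet> b))"
        by (simp add: V_def k \<xi>_def[symmetric] inner_diff_left inner_add_left bb)
          (simp add: algebra_simps power2_eq_square)
    qed
    also have "\<dots> = - (\<beta> * k * \<sigma> * \<xi>) * (n + 1) + (2 * \<beta> * k * \<sigma> * \<xi> + \<beta> * (\<beta> + 1) * k * \<xi>\<^sup>2) * 1
        - (\<beta> * k * \<sigma> + 2 * \<beta> * (\<beta> + 1) * k * \<xi>) * \<xi> + \<beta> * (\<beta> + 1) * k * 1"
      unfolding sum.distrib sum_subtractf sum_distrib_left[symmetric] sums
      by (simp add: n_def)
    also have "\<dots> = \<beta> * k * ((\<beta> + 1) * (1 - \<xi>\<^sup>2) - n * \<xi> * \<sigma>)"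
      by (simp add: algebra_simps power2_eq_square)
    also have "\<dots> = \<beta> * (n - 1 - \<beta>) * (k * \<sigma> * \<sigma>) - (1 + \<epsilon>) * \<beta> * (n - 2 - 2 * \<beta>) * (k * \<sigma>)
        - \<epsilon> * (2 + \<epsilon>) * \<beta> * (\<beta> + 1) * k"
    proof -
      have \<xi>: "\<xi> = 1 + \<epsilon> - \<sigma>" by (simp add: \<xi>_def \<sigma>_def)
      show ?thesis unfolding \<xi> by (simp add: algebra_simps power2_eq_square)
    qed
    finally show ?thesis by (simp only: k)
  qed
  ultimately show ?thesis
    unfolding has_sphere_laplacian_def using grad[of \<beta>] by (intro exI[of _ U] exI[of _ V]) (simp add: U_def)
qed

text \<open>For \<beta> = n / 2 - k the coefficient \<open>\<beta> * (n - 1 - \<beta>)\<close>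
  equals n (n - 2) / 4 - k (k - 1), so the left side tests the factor of index k, applied to
  \<open>u\<close>, against the kernel.\<close>

lemma green_riesz_reg:
  fixes u A :: "'a::euclidean_space \<Rightarrow> real"
  assumes u: "has_sphere_laplacian u A" and \<epsilon>: "\<epsilon> > 0" and y: "norm y = 1"
  defines "n \<equiv> real DIM('a) - 1"
  shows "(LINT x|surf. riesz \<epsilon> \<beta> y x * (\<beta> * (n - 1 - \<beta>) * u x - A x))
    = (1 + \<epsilon>) * \<beta> * (n - 2 - 2 * \<beta>) * (LINT x|surf. riesz \<epsilon> (\<beta> + 1) y x * u x)
      + \<epsilon> * (2 + \<epsilon>) * \<beta> * (\<beta> + 1) * (LINT x|surf. riesz \<epsilon> (\<beta> + 2) y x * u x)"
proof -
  have i: "integrable surf (\<lambda>x. riesz \<epsilon> \<gamma> y x * f x)"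
    if "continuous_on (sphere 0 1) f" for \<gamma> f
    by (intro integrable_surf_continuous continuous_on_mult continuous_on_riesz \<epsilon> y that)
  note c = has_sphere_laplacian_continuous[OF u]
  have "(LINT x|surf. riesz \<epsilon> \<beta> y x * A x) =
      (LINT x|surf. \<beta> * (n - 1 - \<beta>) * (riesz \<epsilon> \<beta> y x * u x)
        - (1 + \<epsilon>) * \<beta> * (n - 2 - 2 * \<beta>) * (riesz \<epsilon> (\<beta> + 1) y x * u x)
        - \<epsilon> * (2 + \<epsilon>) * \<beta> * (\<beta> + 1) * (riesz \<epsilon> (\<beta> + 2) y x * u x))"
    unfolding sphere_green[OF u riesz_laplacian[OF \<epsilon> y]] n_def
    by (intro Bochner_Integration.integral_cong refl) (simp add: algebra_simps)
  moreover have "(LINT x|surf. riesz \<epsilon> \<beta> y x * (\<beta> * (n - 1 - \<beta>) * u x - A x)) =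
      (LINT x|surf. \<beta> * (n - 1 - \<beta>) * (riesz \<epsilon> \<beta> y x * u x) - riesz \<epsilon> \<beta> y x * A x)"
    by (intro Bochner_Integration.integral_cong refl) (simp add: algebra_simps)
  ultimately show ?thesis
    by (simp add: i c)
qed

text \<open>
  Green's identity for \<open>u = 1\<close> bounds the mass of the kernel of order \<open>\<gamma>\<close> by that of order
  \<open>\<gamma> - 1\<close>, which is absorbed.
\<close>

lemma riesz_reg_mass_bounded:
  assumes \<gamma>: "1 < \<gamma>" "2 * \<gamma> < real DIM('a::euclidean_space) - 1"
  shows "\<exists>C. \<forall>\<epsilon>>0. \<forall>y::'a. norm y = 1 \<longrightarrow> (LINT x|surf. riesz \<epsilon> \<gamma> y x) \<le> C"
proof -
  interpret finite_measure "surf :: 'a measure" by (rule finite_measure_surf)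
  define n \<beta> where "n = real DIM('a) - 1" and "\<beta> = \<gamma> - 1"
  have \<beta>: "\<beta> > 0" "n - 2 - 2 * \<beta> > 0" using \<gamma> by (simp_all add: \<beta>_def n_def)
  have \<gamma>\<beta>: "\<gamma> = \<beta> + 1" by (simp add: \<beta>_def)
  define K where "K = (n - 1 - \<beta>) / (n - 2 - 2 * \<beta>)"
  have K: "K > 0" using \<beta> by (simp add: K_def)
  define \<mu> where "\<mu> = measure surf (sphere (0::'a) 1)"
  have "(LINT x|surf. riesz \<epsilon> \<gamma> y x) \<le> 2 * K * ((2 * K) powr \<beta> * \<mu>)"
    if \<epsilon>: "\<epsilon> > 0" and y: "norm y = 1" for \<epsilon> and y :: 'a
  proof -
    define I where "I = (\<lambda>\<gamma>. LINT x|surf. riesz \<epsilon> \<gamma> y x)"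
    have int: "integrable surf (riesz \<epsilon> \<gamma> y)" for \<gamma>
      by (intro integrable_surf_continuous continuous_on_riesz \<epsilon> y)
    have I_nonneg: "I \<gamma> \<ge> 0" for \<gamma> by (simp add: I_def)
    have "\<beta> * (n - 1 - \<beta>) * I \<beta> = (1 + \<epsilon>) * \<beta> * (n - 2 - 2 * \<beta>) * I \<gamma>
        + \<epsilon> * (2 + \<epsilon>) * \<beta> * (\<beta> + 1) * I (\<beta> + 2)"
      using green_riesz_reg[OF has_sphere_laplacian_const[of 1] \<epsilon> y, of \<beta>]
      by (simp add: I_def n_def[symmetric] \<gamma>\<beta> mult.commute)
    moreover have "\<epsilon> * (2 + \<epsilon>) * \<beta> * (\<beta> + 1) * I (\<beta> + 2) \<ge> 0"
      using \<epsilon> \<beta> I_nonneg by simp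
    moreover have "1 * (\<beta> * (n - 2 - 2 * \<beta>) * I \<gamma>) \<le> (1 + \<epsilon>) * (\<beta> * (n - 2 - 2 * \<beta>) * I \<gamma>)"
      using \<epsilon> \<beta> I_nonneg by (intro mult_right_mono) auto
    ultimately have "\<beta> * ((n - 2 - 2 * \<beta>) * I \<gamma>) \<le> \<beta> * ((n - 1 - \<beta>) * I \<beta>)"
      by (simp add: mult.assoc)
    then have "(n - 2 - 2 * \<beta>) * I \<gamma> \<le> (n - 1 - \<beta>) * I \<beta>"
      using \<beta>(1) by simp
    then have 1: "I \<gamma> \<le> K * I \<beta>" using \<beta> by (simp add: K_def field_simps)
    \<comment> \<open>Split at \<sigma> = 1 / (2 K). Below it, one factor \<sigma> of the kernel of
      order \<gamma> is at most 1 / (2 K), so that only half of \<open>I \<gamma>\<close> reappears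
      on the right and can be subtracted.\<close>
    have "I \<beta> \<le> (\<integral>x. riesz \<epsilon> \<gamma> y x / (2 * K) + (2 * K) powr \<beta> \<partial>(surf :: 'a measure))"
      unfolding I_def
    proof (rule integral_mono)
      fix x :: 'a assume "x \<in> space surf"
      then have \<sigma>: "1 + \<epsilon> - x \<bullet> y > 0" using sphere_inner_le_1[of x y] y \<epsilon> by simp
      define \<sigma> where "\<sigma> = 1 + \<epsilon> - x \<bullet> y"
      have pos: "\<sigma> > 0" using \<sigma> by (simp add: \<sigma>_def)
      show "riesz \<epsilon> \<beta> y x \<le> riesz \<epsilon> \<gamma> y x / (2 * K) + (2 * K) powr \<beta>"
      proof (cases "\<sigma> \<le> 1 / (2 * K)")
        case True
        have "\<sigma> powr (- \<beta>) = \<sigma> powr (- \<gamma>) * \<sigma>"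
          using pos powr_add[of \<sigma> "- \<gamma>" 1] by (simp add: \<gamma>\<beta>)
        also have "\<dots> \<le> \<sigma> powr (- \<gamma>) * (1 / (2 * K))" using True by (intro mult_left_mono) auto
        finally show ?thesis by (simp add: riesz_def \<sigma>_def[symmetric] add_increasing2)
      next
        case False
        then have "\<sigma> powr (- \<beta>) \<le> (1 / (2 * K)) powr (- \<beta>)"
          using K \<beta> by (intro powr_mono2') auto
        also have "\<dots> = (2 * K) powr \<beta>" using K by (simp add: powr_minus powr_divide)
        finally show ?thesis using K by (simp add: riesz_def \<sigma>_def[symmetric] add_increasing)
      qed
    qed (auto intro!: int)
    also have "\<dots> = I \<gamma> / (2 * K) + (2 * K) powr \<beta> * \<mu>"
      using int by (simp add: I_def \<mu>_def)
    finally have "K * I \<beta> \<le> K * (I \<gamma> / (2 * K) + (2 * K) powr \<beta> * \<mu>)"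
      using K by (intro mult_left_mono) auto
    also have "\<dots> = I \<gamma> / 2 + K * ((2 * K) powr \<beta> * \<mu>)" using K by (simp add: field_simps)
    finally show ?thesis using 1 by (simp add: I_def)
  qed
  then show ?thesis by blast
qed

section \<open>Passage to the singular kernel\<close>

lemma eps_tendsto_0: "(\<lambda>k. 1 / real (Suc k)) \<longlonglongrightarrow> 0"
  using LIMSEQ_Suc[OF lim_1_over_n[where 'a=real]] by simp

text \<open>At \<open>x = y\<close> the regularized kernel equals
  \<open>\<epsilon> powr (- \<gamma>)\<close>. Since its integral is bounded uniformly in
  \<epsilon>, the point \<open>y\<close> has measure at most
  \<open>C * \<epsilon> powr \<gamma>\<close>, which tends to 0.\<close>

lemma AE_surf_neq:
  fixes y :: "'a::euclidean_space"
  assumes dim: "DIM('a) \<ge> 4" and y: "norm y = 1"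
  shows "AE x in surf. x \<noteq> y"
proof -
  interpret finite_measure "surf :: 'a measure" by (rule finite_measure_surf)
  \<comment> \<open>The midpoint of 1 and half the dimension of the sphere; it lies strictly between
    them because the sphere has dimension at least 3.\<close>
  define \<gamma> where "\<gamma> = (1 + (real DIM('a) - 1) / 2) / 2"
  have "real DIM('a) \<ge> 4" using of_nat_mono[OF dim, where 'a=real] by simp
  then have \<gamma>: "1 < \<gamma>" "2 * \<gamma> < real DIM('a) - 1" by (simp_all add: \<gamma>_def field_simps)
  obtain C where C: "\<epsilon> > 0 \<Longrightarrow> (LINT x|surf. riesz \<epsilon> \<gamma> y x) \<le> C" for \<epsilon>
    using riesz_reg_mass_bounded[OF \<gamma>] y by blast
  have [measurable]: "{y} \<in> sets surf"
    using y by (auto simp: sets_restrict_space image_iff intro!: bexI[of _ "{y}"])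
  have "measure surf {y} \<le> C * \<epsilon> powr \<gamma>" if \<epsilon>: "\<epsilon> > 0" for \<epsilon>
  proof -
    have "(LINT x|surf. indicator {y} x * \<epsilon> powr (- \<gamma>)) \<le> (LINT x|surf. riesz \<epsilon> \<gamma> y x)"
    proof (rule integral_mono)
      show "integrable surf (riesz \<epsilon> \<gamma> y)"
        by (intro integrable_surf_continuous continuous_on_riesz \<epsilon> y)
      show "indicator {y} x * \<epsilon> powr (- \<gamma>) \<le> riesz \<epsilon> \<gamma> y x" for x
        using y by (auto simp: indicator_def riesz_def dot_square_norm)
      show "integrable surf (\<lambda>x. indicator {y} x * \<epsilon> powr (- \<gamma>))"
        by (intro integrable_mult_left integrable_real_indicator \<open>{y} \<in> sets surf\<close>)
          (simp add: emeasure_eq_measure)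
    qed
    then have "measure surf {y} * \<epsilon> powr (- \<gamma>) \<le> C"
      using C[OF \<epsilon>] y by (simp add: Int_absorb2)
    then show ?thesis using \<epsilon> by (simp add: powr_minus field_simps)
  qed
  then have le: "measure surf {y} \<le> C * (1 / real (Suc k)) powr \<gamma>" for k by simp
  have "(\<lambda>k. C * (1 / real (Suc k)) powr \<gamma>) \<longlonglongrightarrow> C * 0 powr \<gamma>"
    by (intro tendsto_mult tendsto_const tendsto_powr2 eps_tendsto_0) (use \<gamma> in \<open>auto intro!: always_eventually\<close>)
  then have "measure surf {y} \<le> C * 0 powr \<gamma>"
    by (rule LIMSEQ_le_const) (use le in auto)
  then have "measure surf {y} \<le> 0" by simp
  then have "emeasure surf {y} = 0"
    by (simp add: emeasure_eq_measure measure_le_0_iff)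
  then show ?thesis
    by (intro AE_I[where N="{y}"]) (use \<open>{y} \<in> sets surf\<close> in auto)
qed

lemma riesz_mono:
  assumes "norm x = 1" "norm y = 1" "x \<noteq> y" "\<gamma> \<ge> 0" "\<epsilon> \<ge> 0"
  shows "riesz \<epsilon> \<gamma> y x \<le> riesz 0 \<gamma> y x"
proof -
  have "x \<bullet> y < 1"
    using assms sphere_inner_le_1[of x y] sphere_inner_eq_1_iff[of x y] by (simp add: order_less_le)
  then show ?thesis
    unfolding riesz_def using assms by (intro powr_mono2') auto
qed

lemma riesz_reg_tendsto:
  assumes "norm x = 1" "norm y = 1" "x \<noteq> y"
  shows "(\<lambda>k. riesz (1 / real (Suc k)) \<gamma> y x) \<longlonglongrightarrow> riesz 0 \<gamma> y x"
proof -
  have "x \<bullet> y < 1"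
    using assms sphere_inner_le_1[of x y] sphere_inner_eq_1_iff[of x y] by (simp add: order_less_le)
  then show ?thesis
    unfolding riesz_def by (intro tendsto_intros eps_tendsto_0) auto
qed

text \<open>Fatou's lemma carries the uniform bound over to \<epsilon> = 0 for an order \<gamma>' >
  1 with \<gamma>' \<ge> \<gamma>. The order \<gamma> follows because its kernel is at most 1 plus
  the kernel of order \<gamma>'.\<close>

lemma riesz_mass_bounded:
  assumes dim: "DIM('a::euclidean_space) \<ge> 4" and \<gamma>: "0 \<le> \<gamma>" "2 * \<gamma> < real DIM('a) - 1"
  shows "\<exists>C. \<forall>y::'a. norm y = 1 \<longrightarrow> integrable surf (riesz 0 \<gamma> y) \<and>
    (LINT x|surf. riesz 0 \<gamma> y x) \<le> C"
proof -
  interpret finite_measure "surf :: 'a measure" by (rule finite_measure_surf)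
  define \<gamma>' where "\<gamma>' = max \<gamma> ((1 + (real DIM('a) - 1) / 2) / 2)"
  have "real DIM('a) \<ge> 4" using of_nat_mono[OF dim, where 'a=real] by simp
  then have \<gamma>': "1 < \<gamma>'" "2 * \<gamma>' < real DIM('a) - 1" "\<gamma> \<le> \<gamma>'"
    using \<gamma> by (simp_all add: \<gamma>'_def max_def field_simps)
  obtain C where C: "\<epsilon> > 0 \<Longrightarrow> norm y = 1 \<Longrightarrow> (LINT x|surf. riesz \<epsilon> \<gamma>' y x) \<le> C"
    for \<epsilon> and y :: 'a
    using riesz_reg_mass_bounded[OF \<gamma>'(1,2)] by blast
  note m = measurable_riesz
  have *: "integrable surf (riesz 0 \<gamma>' y) \<and>
      (LINT x|surf. riesz 0 \<gamma>' y x) \<le> C" if y: "norm y = 1" for y :: 'a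
  proof -
    have "0 \<le> (LINT x|surf. riesz 1 \<gamma>' y x)" by simp
    then have C0: "C \<ge> 0" using C[of 1 y] y by linarith
    have "(\<integral>\<^sup>+x. ennreal (riesz 0 \<gamma>' y x) \<partial>surf) =
        (\<integral>\<^sup>+x. liminf (\<lambda>k. ennreal (riesz (1 / real (Suc k)) \<gamma>' y x)) \<partial>surf)"
    proof (rule nn_integral_cong_AE, rule AE_mp[OF AE_surf_neq[OF dim y]], intro AE_I2 impI)
      fix x :: 'a assume "x \<in> space surf" "x \<noteq> y"
      then have "(\<lambda>k. ennreal (riesz (1 / real (Suc k)) \<gamma>' y x)) \<longlonglongrightarrow> ennreal (riesz 0 \<gamma>' y x)"
        using y by (intro tendsto_ennrealI riesz_reg_tendsto) auto
      then show "ennreal (riesz 0 \<gamma>' y x) = liminf (\<lambda>k. ennreal (riesz (1 / real (Suc k)) \<gamma>' y x))"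
        by (intro lim_imp_Liminf[symmetric]) auto
    qed
    also have "\<dots> \<le> liminf (\<lambda>k. \<integral>\<^sup>+x. ennreal (riesz (1 / real (Suc k)) \<gamma>' y x) \<partial>surf)"
      by (rule nn_integral_liminf) (use m in measurable)
    also have "\<dots> \<le> liminf (\<lambda>k::nat. ennreal C)"
    proof (intro Liminf_mono always_eventually allI)
      fix k
      have "integrable surf (riesz (1 / real (Suc k)) \<gamma>' y)"
        by (intro integrable_surf_continuous continuous_on_riesz y) simp
      then show "(\<integral>\<^sup>+x. ennreal (riesz (1 / real (Suc k)) \<gamma>' y x) \<partial>surf) \<le> ennreal C"
        by (subst nn_integral_eq_integral) (use C[of "1 / real (Suc k)" y] y in \<open>auto intro!: ennreal_leI\<close>)
    qed
    also have "\<dots> = ennreal C" by (simp add: Liminf_const)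
    finally have le: "(\<integral>\<^sup>+x. ennreal (riesz 0 \<gamma>' y x) \<partial>surf) \<le> ennreal C" .
    then have int: "integrable surf (riesz 0 \<gamma>' y)"
      by (intro integrableI_nonneg m) (auto simp: le_less_trans[OF le])
    with le show ?thesis
      by (subst (asm) nn_integral_eq_integral[OF int]) (use C0 in auto)
  qed
  have le: "riesz 0 \<gamma> y x \<le> 1 + riesz 0 \<gamma>' y x" if "norm x = 1" "norm y = 1" for x y :: 'a
  proof -
    have s: "0 \<le> 1 - x \<bullet> y" using sphere_inner_le_1[OF that] by simp
    consider "1 - x \<bullet> y = 0" | "0 < 1 - x \<bullet> y" "1 - x \<bullet> y \<le> 1" | "1 \<le> 1 - x \<bullet> y" using s by linarith
    then show ?thesis
    proof cases
      case 2
      then have "(1 - x \<bullet> y) powr (- \<gamma>) \<le> (1 - x \<bullet> y) powr (- \<gamma>')"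
        using \<gamma>' by (intro powr_mono') auto
      then show ?thesis by (simp add: riesz_def)
    next
      case 3
      then have "(1 - x \<bullet> y) powr (- \<gamma>) \<le> 1 powr (- \<gamma>)" using \<gamma> by (intro powr_mono2') auto
      then show ?thesis by (simp add: riesz_def add_increasing2)
    qed (simp add: riesz_def)
  qed
  have int: "integrable surf (riesz 0 \<gamma> y)" if y: "norm y = 1" for y :: 'a
    by (rule Bochner_Integration.integrable_bound[of _ "\<lambda>x. 1 + riesz 0 \<gamma>' y x"])
      (use * y le m in \<open>auto intro!: AE_I2\<close>)
  have "(LINT x|surf. riesz 0 \<gamma> y x) \<le> measure surf (sphere (0::'a) 1) + C"
    if y: "norm y = 1" for y :: 'a
  proof -
    have "(LINT x|surf. riesz 0 \<gamma> y x) \<le> (LINT x|surf. 1 + riesz 0 \<gamma>' y x)"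
      by (rule integral_mono) (use * y int le in auto)
    also have "\<dots> \<le> measure surf (sphere (0::'a) 1) + C"
      using *[OF y] by simp
    finally show ?thesis .
  qed
  with int show ?thesis by blast
qed

context
  fixes \<gamma> :: real and y :: "'a::euclidean_space" and u :: "'a \<Rightarrow> real"
  assumes dim: "DIM('a) \<ge> 4" and \<gamma>: "0 \<le> \<gamma>" "2 * \<gamma> < real DIM('a) - 1"
    and y: "norm y = 1" and u: "continuous_on (sphere 0 1) u"
begin

lemma integrable_riesz_mult: "integrable surf (\<lambda>x. riesz 0 \<gamma> y x * u x)"
proof -
  obtain M where M: "\<And>x. norm x = 1 \<Longrightarrow> norm (u x) \<le> M"
    using continuous_on_sphere_bounded[OF u] by blast
  have "integrable surf (riesz 0 \<gamma> y)"
    using riesz_mass_bounded[OF dim \<gamma>] y by blast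
  then show ?thesis
    using borel_measurable_surf_continuous[OF u] M
    by (intro Bochner_Integration.integrable_bound[of _ "\<lambda>x. riesz 0 \<gamma> y x * M"
          "\<lambda>x. riesz 0 \<gamma> y x * u x"])
      (auto intro!: AE_I2 borel_measurable_times measurable_riesz mult_left_mono
        intro: order_trans[OF _ abs_ge_self] simp: abs_mult)
qed

lemma riesz_reg_integral_tendsto:
  "(\<lambda>k. LINT x|surf. riesz (1 / real (Suc k)) \<gamma> y x * u x)
    \<longlonglongrightarrow> (LINT x|surf. riesz 0 \<gamma> y x * u x)"
proof (rule integral_dominated_convergence[where w="\<lambda>x. \<bar>riesz 0 \<gamma> y x * u x\<bar>"])
  note AE = AE_mp[OF AE_surf_neq[OF dim y]]
  show "AE x in surf. (\<lambda>k. riesz (1 / real (Suc k)) \<gamma> y x * u x)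
      \<longlonglongrightarrow> riesz 0 \<gamma> y x * u x"
    by (rule AE) (auto intro!: AE_I2 tendsto_mult riesz_reg_tendsto y simp del: of_nat_Suc)
  show "AE x in surf. norm (riesz (1 / real (Suc k)) \<gamma> y x * u x)
      \<le> \<bar>riesz 0 \<gamma> y x * u x\<bar>" for k
    by (rule AE) (auto intro!: AE_I2 mult_right_mono riesz_mono y \<gamma> simp: abs_mult simp del: of_nat_Suc)
qed (use borel_measurable_surf_continuous[OF u] integrable_riesz_mult in
    \<open>auto intro!: borel_measurable_times measurable_riesz\<close>)

text \<open>The order \<open>\<gamma> + 1\<close> may be too singular to be integrable in the limit.
  However, \<epsilon> is at most 1 + \<epsilon> - \<open>x \<bullet> y\<close>, so the factor
  \<epsilon> lowers the order by one and the integrable kernel of order \<gamma> dominates.\<close>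

lemma riesz_reg_error_tendsto:
  "(\<lambda>k. 1 / real (Suc k) * (LINT x|surf. riesz (1 / real (Suc k)) (\<gamma> + 1) y x * u x))
    \<longlonglongrightarrow> 0"
proof -
  have "(\<lambda>k. LINT x|surf. 1 / real (Suc k) * (riesz (1 / real (Suc k)) (\<gamma> + 1) y x * u x))
    \<longlonglongrightarrow> (\<integral>x. 0 \<partial>(surf :: 'a measure))"
  proof (rule integral_dominated_convergence[where w="\<lambda>x. \<bar>riesz 0 \<gamma> y x * u x\<bar>"])
    note AE = AE_mp[OF AE_surf_neq[OF dim y]]
    show "AE x in surf. (\<lambda>k. 1 / real (Suc k) * (riesz (1 / real (Suc k)) (\<gamma> + 1) y x * u x))
      \<longlonglongrightarrow> 0"
    proof (rule AE, intro AE_I2 impI)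
      fix x :: 'a assume x: "x \<in> space surf" "x \<noteq> y"
      have "(\<lambda>k. 1 / real (Suc k) * (riesz (1 / real (Suc k)) (\<gamma> + 1) y x * u x))
          \<longlonglongrightarrow> 0 * (riesz 0 (\<gamma> + 1) y x * u x)"
        by (intro tendsto_mult eps_tendsto_0 riesz_reg_tendsto y tendsto_const) (use x in auto)
      then show "(\<lambda>k. 1 / real (Suc k) * (riesz (1 / real (Suc k)) (\<gamma> + 1) y x * u x)) \<longlonglongrightarrow> 0"
        by simp
    qed
    show "AE x in surf. norm (1 / real (Suc k) * (riesz (1 / real (Suc k)) (\<gamma> + 1) y x * u x))
      \<le> \<bar>riesz 0 \<gamma> y x * u x\<bar>" for k
    proof (rule AE, intro AE_I2 impI)
      fix x :: 'a assume x: "x \<in> space surf" "x \<noteq> y"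
      define \<epsilon> where "\<epsilon> = 1 / real (Suc k)"
      have \<epsilon>: "\<epsilon> > 0" by (simp add: \<epsilon>_def)
      define \<sigma> where "\<sigma> = 1 + \<epsilon> - x \<bullet> y"
      have \<sigma>: "\<epsilon> \<le> \<sigma>" "\<sigma> > 0" using sphere_inner_le_1[of x y] x y \<epsilon> by (auto simp: \<sigma>_def)
      have "\<epsilon> * riesz \<epsilon> (\<gamma> + 1) y x \<le> \<sigma> * \<sigma> powr (- (\<gamma> + 1))"
        using \<sigma> by (simp add: riesz_def \<sigma>_def[symmetric] mult_right_mono)
      also have "\<dots> = riesz \<epsilon> \<gamma> y x"
        using \<sigma> powr_add[of \<sigma> "- (\<gamma> + 1)" 1]
        by (simp add: riesz_def \<sigma>_def[symmetric] mult.commute)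
      also have "\<dots> \<le> riesz 0 \<gamma> y x" using riesz_mono[of x y \<gamma> \<epsilon>] x y \<gamma> \<epsilon> by simp
      finally have "\<epsilon> * riesz \<epsilon> (\<gamma> + 1) y x * \<bar>u x\<bar> \<le> riesz 0 \<gamma> y x * \<bar>u x\<bar>"
        by (rule mult_right_mono) simp
      then show "norm (1 / real (Suc k) * (riesz (1 / real (Suc k)) (\<gamma> + 1) y x * u x))
          \<le> \<bar>riesz 0 \<gamma> y x * u x\<bar>"
        unfolding \<epsilon>_def[symmetric] using \<epsilon> by (simp add: abs_mult mult.assoc)
    qed
  qed (use borel_measurable_surf_continuous[OF u] integrable_riesz_mult in
    \<open>auto intro!: borel_measurable_times measurable_riesz borel_measurable_divide\<close>)
  then show ?thesis by simp
qed

end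

text \<open>The strict inequality \<open>2 * \<beta> < n - 2\<close> keeps the order
  \<open>\<beta> + 1\<close> in the integrable range, so the error term of order
  \<open>\<beta> + 2\<close> vanishes as \<epsilon> tends to 0.\<close>

lemma green_riesz:
  fixes u A :: "'a::euclidean_space \<Rightarrow> real"
  assumes dim: "DIM('a) \<ge> 4" and u: "has_sphere_laplacian u A" and y: "norm y = 1"
  defines "n \<equiv> real DIM('a) - 1"
  assumes \<beta>: "0 < \<beta>" "2 * \<beta> < n - 2"
  shows "(LINT x|surf. riesz 0 \<beta> y x * (\<beta> * (n - 1 - \<beta>) * u x - A x))
    = \<beta> * (n - 2 - 2 * \<beta>) * (LINT x|surf. riesz 0 (\<beta> + 1) y x * u x)"
proof -
  note c = has_sphere_laplacian_continuous[OF u]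
  let ?e = "\<lambda>k. 1 / real (Suc k)"
  have \<beta>1: "0 \<le> \<beta>" "2 * \<beta> < real DIM('a) - 1" and \<beta>2: "0 \<le> \<beta> + 1" "2 * (\<beta> + 1) < real DIM('a) - 1"
    using \<beta> by (simp_all add: n_def)
  have "(\<lambda>k. LINT x|surf. riesz (?e k) \<beta> y x * (\<beta> * (n - 1 - \<beta>) * u x - A x))
      \<longlonglongrightarrow> (LINT x|surf. riesz 0 \<beta> y x * (\<beta> * (n - 1 - \<beta>) * u x - A x))"
    by (rule riesz_reg_integral_tendsto[OF dim \<beta>1 y]) (intro continuous_intros c)
  moreover have "(\<lambda>k. (1 + ?e k) * \<beta> * (n - 2 - 2 * \<beta>) * (LINT x|surf. riesz (?e k) (\<beta> + 1) y x * u x)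
      + (2 + ?e k) * \<beta> * (\<beta> + 1) * (?e k * (LINT x|surf. riesz (?e k) (\<beta> + 1 + 1) y x * u x)))
      \<longlonglongrightarrow> (1 + 0) * \<beta> * (n - 2 - 2 * \<beta>) * (LINT x|surf. riesz 0 (\<beta> + 1) y x * u x)
      + (2 + 0) * \<beta> * (\<beta> + 1) * 0"
    by (intro tendsto_add tendsto_mult tendsto_const eps_tendsto_0
        riesz_reg_integral_tendsto[OF dim \<beta>2 y c(1)] riesz_reg_error_tendsto[OF dim \<beta>2 y c(1)])
  moreover have "(LINT x|surf. riesz (?e k) \<beta> y x * (\<beta> * (n - 1 - \<beta>) * u x - A x))
    = (1 + ?e k) * \<beta> * (n - 2 - 2 * \<beta>) * (LINT x|surf. riesz (?e k) (\<beta> + 1) y x * u x)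
      + (2 + ?e k) * \<beta> * (\<beta> + 1) * (?e k * (LINT x|surf. riesz (?e k) (\<beta> + 1 + 1) y x * u x))" for k
    using green_riesz_reg[OF u _ y, of "?e k" \<beta>] by (simp add: n_def add.assoc mult_ac)
  ultimately show ?thesis using LIMSEQ_unique by (simp del: of_nat_Suc) blast
qed

section \<open>The critical order\<close>

text \<open>The orthogonal reflection that exchanges \<open>y\<close> and \<open>z\<close> is the
  case \<open>t = 0\<close> of \<open>sphere_refl\<close>, with \<open>stretch\<close> equal to 1.
  This makes the constant of the representation formula independent of the pole.\<close>

lemma riesz_mass_indep:
  fixes y z :: "'a::euclidean_space"
  assumes dim: "DIM('a) \<ge> 2" and y: "norm y = 1" and z: "norm z = 1"
  shows "(LINT x|surf. riesz \<epsilon> \<gamma> y x) = (LINT x|surf. riesz \<epsilon> \<gamma> z x)"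
proof (cases "y = z")
  case False
  define e where "e = sgn (y - z)"
  have e: "norm e = 1" using False by (simp add: e_def norm_sgn)
  define r where "r = norm (y - z)"
  have r: "r > 0" using False by (simp add: r_def)
  have e': "e = (1 / r) *\<^sub>R (y - z)" by (simp add: e_def r_def sgn_div_norm divide_inverse)
  have yy: "y \<bullet> y = 1" and zz: "z \<bullet> z = 1" using y z by (simp_all add: norm_eq_1)
  have rr: "r * r = 2 * (1 - y \<bullet> z)"
    using yy zz by (simp add: r_def power2_norm_eq_inner power2_eq_square[symmetric]
        inner_diff_left inner_diff_right inner_commute)
  have "(LINT x|surf. riesz \<epsilon> \<gamma> y x) =
      (LINT x|surf. riesz \<epsilon> \<gamma> y (sphere_refl 0 e x) / stretch 0 e x ^ (DIM('a) - 1))"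
    by (rule integral_sphere_refl[OF e _ dim measurable_riesz]) simp
  also have "\<dots> = (LINT x|surf. riesz \<epsilon> \<gamma> z x)"
  proof (rule Bochner_Integration.integral_cong[OF refl])
    fix x :: 'a assume "x \<in> space surf"
    then have x: "norm x = 1" by simp
    have s: "stretch 0 e x = 1" using x by (simp add: stretch_def)
    then have "norm (cone_refl 0 e x) = 1" using norm_cone_refl[OF e, of 0 x] by simp
    then have "sphere_refl 0 e x = x - (2 * (x \<bullet> e)) *\<^sub>R e"
      by (simp add: sphere_refl_def sgn_div_norm) (simp add: cone_refl_def)
    then have "sphere_refl 0 e x \<bullet> y = x \<bullet> y - 2 * ((x \<bullet> y - x \<bullet> z) / r) * ((1 - y \<bullet> z) / r)"
      by (simp add: inner_diff_left e' inner_diff_right yy inner_commute[of z y])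
    also have "\<dots> = x \<bullet> y - (x \<bullet> y - x \<bullet> z) * (2 * (1 - y \<bullet> z)) / (r * r)"
      by (simp add: divide_simps) (simp add: algebra_simps)
    also have "\<dots> = x \<bullet> z" unfolding rr[symmetric] using r by simp
    finally show "riesz \<epsilon> \<gamma> y (sphere_refl 0 e x) / stretch 0 e x ^ (DIM('a) - 1)
        = riesz \<epsilon> \<gamma> z x"
      by (simp add: riesz_def s)
  qed
  finally show ?thesis .
qed simp

text \<open>Measuring the distance by \<open>1 - x \<bullet> y\<close> lets the second term cancel
  one power of the kernel, turning order \<open>\<beta> + 2\<close> into order
  \<open>\<beta> + 1\<close>.\<close>

lemma sphere_modulus_of_continuity:
  fixes u :: "'a::euclidean_space \<Rightarrow> real"
  assumes u: "continuous_on (sphere 0 1) u" and y: "norm y = 1" and \<eta>: "\<eta> > 0"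
  shows "\<exists>L\<ge>0. \<forall>x. norm x = 1 \<longrightarrow> \<bar>u x - u y\<bar> \<le> \<eta> + L * (1 - x \<bullet> y)"
proof -
  obtain M where M: "M \<ge> 0" "\<And>x. norm x = 1 \<Longrightarrow> norm (u x) \<le> M"
    using continuous_on_sphere_bounded[OF u] by blast
  obtain \<delta> where \<delta>: "\<delta> > 0" "\<And>x. norm x = 1 \<Longrightarrow> dist x y < \<delta> \<Longrightarrow> dist (u x) (u y) < \<eta>"
    using u \<eta> y unfolding continuous_on_iff by (metis mem_sphere_0)
  have "\<bar>u x - u y\<bar> \<le> \<eta> + 4 * M / \<delta>\<^sup>2 * (1 - x \<bullet> y)" if x: "norm x = 1" for x
  proof (cases "dist x y < \<delta>")
    case True
    then have "\<bar>u x - u y\<bar> \<le> \<eta>" using \<delta>(2)[OF x] by (simp add: dist_real_def)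
    moreover have "4 * M / \<delta>\<^sup>2 * (1 - x \<bullet> y) \<ge> 0" using M sphere_inner_le_1[OF x y] by simp
    ultimately show ?thesis by linarith
  next
    case False
    have "(norm (x - y))\<^sup>2 = 2 * (1 - x \<bullet> y)"
      using x y by (simp add: power2_norm_eq_inner inner_diff_left inner_diff_right inner_commute norm_eq_1)
    moreover have "\<delta>\<^sup>2 \<le> (norm (x - y))\<^sup>2"
      using False \<delta>(1) by (intro power_mono) (auto simp: dist_norm)
    ultimately have "2 * M * 1 \<le> 2 * M * (2 * (1 - x \<bullet> y) / \<delta>\<^sup>2)"
      using M(1) \<delta>(1) by (intro mult_left_mono) auto
    moreover have "\<bar>u x - u y\<bar> \<le> 2 * M"
      using M(2)[OF x] M(2)[OF y] by (simp add: abs_le_iff)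
    moreover have "4 * M / \<delta>\<^sup>2 * (1 - x \<bullet> y) = 2 * M * (2 * (1 - x \<bullet> y) / \<delta>\<^sup>2)" by simp
    ultimately show ?thesis using \<eta> by linarith
  qed
  then show ?thesis using M(1) by (intro exI[of _ "4 * M / \<delta>\<^sup>2"]) simp
qed

text \<open>
  At the critical order the regularization error does not vanish: it is an approximate identity.
  Its mass is read off from the case \<open>u = 1\<close>.
\<close>

lemma green_riesz_critical:
  fixes u A :: "'a::euclidean_space \<Rightarrow> real"
  assumes dim: "DIM('a) \<ge> 4" and u: "has_sphere_laplacian u A" and y: "norm y = 1"
  defines "n \<equiv> real DIM('a) - 1"
  defines "\<beta> \<equiv> n / 2 - 1"
  shows "(LINT x|surf. riesz 0 \<beta> y x * (\<beta> * (n - 1 - \<beta>) * u x - A x))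
    = \<beta> * (n - 1 - \<beta>) * (LINT x|surf. riesz 0 \<beta> y x) * u y"
proof -
  define \<epsilon> where "\<epsilon> = (\<lambda>k. 1 / real (Suc k))"
  have \<epsilon>: "\<epsilon> k > 0" for k by (simp add: \<epsilon>_def)
  have "real DIM('a) \<ge> 4" using of_nat_mono[OF dim, where 'a=real] by simp
  \<comment> \<open>This \<beta> is the root of the coefficient of the kernel of order
    \<open>\<beta> + 1\<close>, so in \<open>green_riesz_reg\<close> only the error term survives on
    the right.\<close>
  then have \<beta>: "0 < \<beta>" "2 * \<beta> < real DIM('a) - 1" "n - 2 - 2 * \<beta> = 0"
    by (simp_all add: \<beta>_def n_def field_simps)
  then have \<beta>1: "0 \<le> \<beta>" by simp
  have int: "integrable surf (\<lambda>x. riesz (\<epsilon> k) \<gamma> y x * f x)"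
    if "continuous_on (sphere 0 1) f" for k \<gamma> f
    by (intro integrable_surf_continuous continuous_on_mult continuous_on_riesz \<epsilon> y that)
  define J where "J = (\<lambda>k. \<epsilon> k * (2 + \<epsilon> k) * \<beta> * (\<beta> + 1))"
  have J: "J k \<ge> 0" for k using \<epsilon>[of k] \<beta> by (simp add: J_def)
  have reg: "(LINT x|surf. riesz (\<epsilon> k) \<beta> y x * (\<beta> * (n - 1 - \<beta>) * v x - B x))
      = J k * (LINT x|surf. riesz (\<epsilon> k) (\<beta> + 2) y x * v x)"
    if "has_sphere_laplacian v B" for k v B
    using green_riesz_reg[OF that \<epsilon>[of k] y, of \<beta>] \<beta>(3) by (simp add: n_def J_def)
  have lim: "(\<lambda>k. J k * (LINT x|surf. riesz (\<epsilon> k) (\<beta> + 2) y x * v x)) \<longlonglongrightarrow>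
      (LINT x|surf. riesz 0 \<beta> y x * (\<beta> * (n - 1 - \<beta>) * v x - B x))"
    if v: "has_sphere_laplacian v B" for v B
  proof -
    have "continuous_on (sphere 0 1) (\<lambda>x. \<beta> * (n - 1 - \<beta>) * v x - B x)"
      by (intro continuous_intros has_sphere_laplacian_continuous[OF v])
    note * = riesz_reg_integral_tendsto[OF dim \<beta>1 \<beta>(2) y this]
    have "1 / real (Suc k) = \<epsilon> k" for k by (simp add: \<epsilon>_def)
    from *[unfolded this] show ?thesis unfolding reg[OF v] .
  qed
  define I where "I = (LINT x|surf. riesz 0 \<beta> y x)"
  have "continuous_on (sphere (0::'a) 1) (\<lambda>x. 1::real)" by simp
  note one = this
  have I1: "(\<lambda>k. J k * (LINT x|surf. riesz (\<epsilon> k) (\<beta> + 2) y x)) \<longlonglongrightarrow> \<beta> * (n - 1 - \<beta>) * I"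
    using lim[OF has_sphere_laplacian_const[of 1]] by (simp add: I_def mult.commute)
  \<comment> \<open>With one order of singularity less, the same factor makes the integral vanish in
    the limit: the mass of the error kernel concentrates at \<open>y\<close>.\<close>
  have I2: "(\<lambda>k. J k * (LINT x|surf. riesz (\<epsilon> k) (\<beta> + 1) y x)) \<longlonglongrightarrow> 0"
  proof -
    have "(\<lambda>k. (2 + \<epsilon> k) * \<beta> * (\<beta> + 1) * (\<epsilon> k * (LINT x|surf. riesz (\<epsilon> k) (\<beta> + 1) y x * 1)))
        \<longlonglongrightarrow> (2 + 0) * \<beta> * (\<beta> + 1) * 0"
      unfolding \<epsilon>_def
      by (intro tendsto_mult tendsto_add tendsto_const eps_tendsto_0
          riesz_reg_error_tendsto[OF dim \<beta>1 \<beta>(2) y one])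
    then show ?thesis by (simp add: J_def mult_ac)
  qed
  define a where "a = (\<lambda>k. J k * (LINT x|surf. riesz (\<epsilon> k) (\<beta> + 2) y x * u x)
    - J k * (LINT x|surf. riesz (\<epsilon> k) (\<beta> + 2) y x) * u y)"
  define l where "l = (LINT x|surf. riesz 0 \<beta> y x * (\<beta> * (n - 1 - \<beta>) * u x - A x))
    - \<beta> * (n - 1 - \<beta>) * I * u y"
  have al: "a \<longlonglongrightarrow> l"
    unfolding a_def l_def by (intro tendsto_diff tendsto_mult tendsto_const lim[OF u] I1[simplified])
  note uc = has_sphere_laplacian_continuous(1)[OF u]
  \<comment> \<open>Replacing \<open>u x\<close> by \<open>u y\<close> costs \<eta> times the mass
    of the error kernel, which stays bounded, plus \<open>L\<close> times the vanishing integrals of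
    \<open>I2\<close>.\<close>
  have le: "\<bar>l\<bar> \<le> \<eta> * (\<beta> * (n - 1 - \<beta>) * I)" if \<eta>: "\<eta> > 0" for \<eta>
  proof -
    obtain L where L: "L \<ge> 0" "\<And>x. norm x = 1 \<Longrightarrow> \<bar>u x - u y\<bar> \<le> \<eta> + L * (1 - x \<bullet> y)"
      using sphere_modulus_of_continuity[OF uc y \<eta>] by blast
    have "\<bar>a k\<bar> \<le> \<eta> * (J k * (LINT x|surf. riesz (\<epsilon> k) (\<beta> + 2) y x))
        + L * (J k * (LINT x|surf. riesz (\<epsilon> k) (\<beta> + 1) y x))" for k
    proof -
      have i1: "integrable surf (riesz (\<epsilon> k) \<gamma> y)" for \<gamma>
        using int[OF one] by simp
      have ai: "a k = J k * (LINT x|surf. riesz (\<epsilon> k) (\<beta> + 2) y x * u x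
          - riesz (\<epsilon> k) (\<beta> + 2) y x * u y)"
        unfolding a_def using int[OF uc] i1 by (simp add: algebra_simps)
      have "\<bar>LINT x|surf. riesz (\<epsilon> k) (\<beta> + 2) y x * u x
          - riesz (\<epsilon> k) (\<beta> + 2) y x * u y\<bar>
        \<le> (LINT x|surf. \<eta> * riesz (\<epsilon> k) (\<beta> + 2) y x + L * riesz (\<epsilon> k) (\<beta> + 1) y x)"
      proof (rule order_trans[OF integral_abs_bound], rule integral_mono)
        fix x :: 'a assume "x \<in> space surf"
        then have x: "norm x = 1" by simp
        have s: "0 \<le> 1 - x \<bullet> y" "1 - x \<bullet> y \<le> 1 + \<epsilon> k - x \<bullet> y" "0 < 1 + \<epsilon> k - x \<bullet> y"
          using sphere_inner_le_1[OF x y] \<epsilon>[of k] by auto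
        have eq: "riesz (\<epsilon> k) (\<beta> + 2) y x * (1 + \<epsilon> k - x \<bullet> y) = riesz (\<epsilon> k) (\<beta> + 1) y x"
          using s powr_add[of "1 + \<epsilon> k - x \<bullet> y" "- (\<beta> + 2)" 1] by (simp add: riesz_def add.commute)
        have "\<bar>riesz (\<epsilon> k) (\<beta> + 2) y x * u x - riesz (\<epsilon> k) (\<beta> + 2) y x * u y\<bar>
            = riesz (\<epsilon> k) (\<beta> + 2) y x * \<bar>u x - u y\<bar>"
          by (simp add: abs_mult right_diff_distrib[symmetric])
        also have "\<dots> \<le> riesz (\<epsilon> k) (\<beta> + 2) y x * (\<eta> + L * (1 + \<epsilon> k - x \<bullet> y))"
          using L(2)[OF x] mult_left_mono[OF s(2) L(1)] by (intro mult_left_mono) auto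
        also have "\<dots> = \<eta> * riesz (\<epsilon> k) (\<beta> + 2) y x + L * riesz (\<epsilon> k) (\<beta> + 1) y x"
          unfolding eq[symmetric] by (simp add: algebra_simps)
        finally show "\<bar>riesz (\<epsilon> k) (\<beta> + 2) y x * u x - riesz (\<epsilon> k) (\<beta> + 2) y x * u y\<bar>
            \<le> \<eta> * riesz (\<epsilon> k) (\<beta> + 2) y x + L * riesz (\<epsilon> k) (\<beta> + 1) y x" .
      qed (use int[OF uc] i1 in auto)
      also have "\<dots> = \<eta> * (LINT x|surf. riesz (\<epsilon> k) (\<beta> + 2) y x)
          + L * (LINT x|surf. riesz (\<epsilon> k) (\<beta> + 1) y x)"
        using i1 by simp
      finally have "J k * \<bar>LINT x|surf. riesz (\<epsilon> k) (\<beta> + 2) y x * u x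
          - riesz (\<epsilon> k) (\<beta> + 2) y x * u y\<bar> \<le> J k * \<dots>"
        using J by (intro mult_left_mono)
      then show ?thesis unfolding ai abs_mult using J[of k] by (simp add: algebra_simps)
    qed
    moreover have "(\<lambda>k. \<eta> * (J k * (LINT x|surf. riesz (\<epsilon> k) (\<beta> + 2) y x))
        + L * (J k * (LINT x|surf. riesz (\<epsilon> k) (\<beta> + 1) y x)))
        \<longlonglongrightarrow> \<eta> * (\<beta> * (n - 1 - \<beta>) * I) + L * 0"
      by (intro tendsto_add tendsto_mult tendsto_const I1 I2)
    moreover have "(\<lambda>k. \<bar>a k\<bar>) \<longlonglongrightarrow> \<bar>l\<bar>" by (rule tendsto_rabs[OF al])
    ultimately show ?thesis by (simp add: LIMSEQ_le)
  qed
  have "(\<lambda>k. \<epsilon> k * (\<beta> * (n - 1 - \<beta>) * I)) \<longlonglongrightarrow> 0 * (\<beta> * (n - 1 - \<beta>) * I)"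
    unfolding \<epsilon>_def by (intro tendsto_mult eps_tendsto_0 tendsto_const)
  then have "\<bar>l\<bar> \<le> 0 * (\<beta> * (n - 1 - \<beta>) * I)"
    by (rule LIMSEQ_le_const) (use le \<epsilon> in blast)
  then show ?thesis by (simp add: l_def I_def)
qed

lemma riesz_mass_pos:
  fixes y :: "'a::euclidean_space"
  assumes dim: "DIM('a) \<ge> 4" and \<gamma>: "0 \<le> \<gamma>" "2 * \<gamma> < real DIM('a) - 1" and y: "norm y = 1"
  shows "(LINT x|surf. riesz 0 \<gamma> y x) > 0"
proof -
  interpret finite_measure "surf :: 'a measure" by (rule finite_measure_surf)
  have int: "integrable surf (riesz 0 \<gamma> y)"
    using riesz_mass_bounded[OF dim \<gamma>] y by blast
  have ne: "(LINT x|surf. riesz 0 \<gamma> y x) \<noteq> 0"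
  proof
    assume "(LINT x|surf. riesz 0 \<gamma> y x) = 0"
    then have "AE x in surf. riesz 0 \<gamma> y x = 0"
      by (subst (asm) integral_nonneg_eq_0_iff_AE[OF int]) auto
    then have "AE x in surf. x \<notin> sphere (0::'a) 1"
      using AE_surf_neq[OF dim y] AE_space
    proof eventually_elim
      case (elim x)
      then show ?case
        using sphere_inner_eq_1_iff[of x y] y by (simp add: riesz_def)
    qed
    then have "emeasure surf (sphere (0::'a) 1) = 0"
      by (subst (asm) AE_iff_measurable[where N="sphere 0 1"])
        (use sets.top[of "surf :: 'a measure"] in auto)
    then show False using emeasure_surf_pos by blast
  qed
  moreover have "(LINT x|surf. riesz 0 \<gamma> y x) \<ge> 0" by simp
  ultimately show ?thesis by linarith
qed

section \<open>GJMS operators\<close>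

lemma has_derivative_within_cong:
  assumes "x \<in> S" "\<And>y. y \<in> S \<Longrightarrow> f y = g y"
  shows "(f has_derivative D) (at x within S) \<longleftrightarrow> (g has_derivative D) (at x within S)"
  using has_derivative_transform[OF assms(1), of f g D] has_derivative_transform[OF assms(1), of g f D]
    assms(2) by auto

lemma sphere_grad_cong:
  assumes eq: "\<And>x. x \<in> sphere 0 1 \<Longrightarrow> f x = g x" and x: "x \<in> sphere 0 1"
  shows "sphere_grad f x = sphere_grad g x"
proof -
  have "(f has_derivative D) (at x within sphere 0 1) \<longleftrightarrow> (g has_derivative D) (at x within sphere 0 1)" for D
    by (rule has_derivative_within_cong[OF x eq])
  then show ?thesis by (simp add: sphere_grad_def sphere_deriv_def)
qed

lemma has_sphere_grad_differentiable: "has_sphere_grad f G \<Longrightarrow> f differentiable_on sphere 0 1"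
  unfolding differentiable_on_def differentiable_def using has_sphere_gradD(1) by (metis mem_sphere_0)

lemma Ck_sphere_cong:
  assumes "\<And>x. x \<in> sphere 0 1 \<Longrightarrow> f x = g x"
  shows "Ck_sphere k f \<longleftrightarrow> Ck_sphere k g"
  using assms
proof (induction k arbitrary: f g)
  case 0
  then show ?case using continuous_on_cong[OF refl, of "sphere 0 1" f g] by simp
next
  case (Suc k)
  have "(f has_derivative D) (at x within sphere 0 1) \<longleftrightarrow> (g has_derivative D) (at x within sphere 0 1)"
    if "x \<in> sphere 0 1" for x D
    by (rule has_derivative_within_cong[OF that Suc.prems])
  note * = this
  have "f differentiable_on sphere 0 1 \<longleftrightarrow> g differentiable_on sphere 0 1"
    unfolding differentiable_on_def differentiable_def by (intro ball_cong refl iff_exI *)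
  moreover have "Ck_sphere k (\<lambda>x. sphere_grad f x \<bullet> b) \<longleftrightarrow> Ck_sphere k (\<lambda>x. sphere_grad g x \<bullet> b)" for b
    by (rule Suc.IH, rule arg_cong[where f="\<lambda>z. z \<bullet> b"], rule sphere_grad_cong[OF Suc.prems])
  ultimately show ?case by simp
qed

lemma Ck_sphere_Suc_imp: "Ck_sphere (Suc k) f \<Longrightarrow> Ck_sphere k f"
proof (induction k arbitrary: f)
  case 0
  then show ?case by (simp add: differentiable_imp_continuous_on)
next
  case (Suc k)
  then show ?case by (metis Ck_sphere.simps(2))
qed

lemma Ck_sphere_mono: "Ck_sphere k f \<Longrightarrow> j \<le> k \<Longrightarrow> Ck_sphere j f"
  by (induction k) (auto simp: le_Suc_eq dest: Ck_sphere_Suc_imp simp del: Ck_sphere.simps)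

lemma Ck_sphere_has_grad: "Ck_sphere (Suc k) f \<Longrightarrow> has_sphere_grad f (sphere_grad f)"
  by (rule has_sphere_grad_Ck, erule Ck_sphere_mono, simp)

lemma Ck_sphere_Suc_iff:
  assumes "has_sphere_grad f G"
  shows "Ck_sphere (Suc k) f \<longleftrightarrow> (\<forall>b\<in>Basis. Ck_sphere k (\<lambda>x. G x \<bullet> b))"
proof -
  have "Ck_sphere k (\<lambda>x. sphere_grad f x \<bullet> b) \<longleftrightarrow> Ck_sphere k (\<lambda>x. G x \<bullet> b)" for b
    by (rule Ck_sphere_cong) (simp add: has_sphere_grad_unique[OF assms])
  then show ?thesis using has_sphere_grad_differentiable[OF assms] by simp
qed

lemma Ck_sphere_const: "Ck_sphere k (\<lambda>x. c)"
proof (induction k arbitrary: c)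
  case (Suc k)
  show ?case unfolding Ck_sphere_Suc_iff[OF has_sphere_grad_const] using Suc by simp
qed simp

lemma Ck_sphere_linear:
  assumes "Ck_sphere k f" "Ck_sphere k g"
  shows "Ck_sphere k (\<lambda>x. c * f x + d * g x)"
  using assms
proof (induction k arbitrary: f g)
  case 0
  then show ?case by (auto intro!: continuous_intros)
next
  case (Suc k)
  have "has_sphere_grad (\<lambda>x. c * f x + d * g x) (\<lambda>x. c *\<^sub>R sphere_grad f x + d *\<^sub>R sphere_grad g x)"
    by (intro has_sphere_grad_add has_sphere_grad_cmult Ck_sphere_has_grad[OF Suc.prems(1)]
        Ck_sphere_has_grad[OF Suc.prems(2)])
  then show ?case
    using Suc by (subst Ck_sphere_Suc_iff) (auto simp: inner_add_left)
qed

lemma Ck_sphere_sum: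
  assumes "\<And>i. i \<in> I \<Longrightarrow> Ck_sphere k (f i)"
  shows "Ck_sphere k (\<lambda>x. \<Sum>i\<in>I. f i x)"
  using assms
proof (induction I rule: infinite_finite_induct)
  case (insert i I)
  then have "Ck_sphere k (\<lambda>x. 1 * f i x + 1 * (\<Sum>i\<in>I. f i x))" by (intro Ck_sphere_linear) auto
  then show ?case using insert by simp
qed (simp_all add: Ck_sphere_const)

lemma laplace_beltrami_eq:
  assumes u: "has_sphere_laplacian u A" and x: "x \<in> sphere 0 1"
  shows "laplace_beltrami u x = A x"
proof -
  obtain U V where U: "has_sphere_grad u U"
    "\<And>b. b \<in> Basis \<Longrightarrow> has_sphere_grad (\<lambda>x. U x \<bullet> b) (V b)"
    "\<And>x. x \<in> sphere 0 1 \<Longrightarrow> A x = (\<Sum>b\<in>Basis. V b x \<bullet> b)"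
    using u unfolding has_sphere_laplacian_def by blast
  have gU: "sphere_grad u y = U y" if "y \<in> sphere 0 1" for y
    using has_sphere_grad_unique[OF U(1)] that by simp
  define D where "D = (\<lambda>h. \<Sum>b\<in>Basis. (V b x \<bullet> h) *\<^sub>R b)"
  have "(U has_derivative D) (at x within sphere 0 1)"
  proof (subst has_derivative_componentwise_within, intro ballI)
    fix b :: 'a assume b: "b \<in> Basis"
    have "D h \<bullet> b = V b x \<bullet> h" for h using b by (simp add: D_def)
    then show "((\<lambda>x. U x \<bullet> b) has_derivative (\<lambda>h. D h \<bullet> b)) (at x within sphere 0 1)"
      using has_sphere_gradD(1)[OF U(2)[OF b], of x] x by simp
  qed
  then have "(sphere_grad u has_derivative D) (at x within sphere 0 1)"
    by (rule has_derivative_transform[OF x, rotated]) (simp add: gU)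
  moreover have "D x = 0" using has_sphere_gradD(2)[OF U(2)] x by (simp add: D_def)
  ultimately have "sphere_deriv (sphere_grad u) x = D" by (intro sphere_deriv_eqI x)
  then have "laplace_beltrami u x = (\<Sum>b\<in>Basis. D b \<bullet> b)"
    by (simp add: laplace_beltrami_def sphere_div_def)
  also have "\<dots> = A x" unfolding U(3)[OF x] by (rule sum.cong[OF refl]) (simp add: D_def)
  finally show ?thesis .
qed

lemma Ck_sphere_laplacian:
  fixes u :: "'a::euclidean_space \<Rightarrow> real"
  assumes u: "Ck_sphere (Suc (Suc k)) u"
  shows "has_sphere_laplacian u (laplace_beltrami u)" and "Ck_sphere k (laplace_beltrami u)"
proof -
  define V where "V = (\<lambda>b. sphere_grad (\<lambda>x. sphere_grad u x \<bullet> b))"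
  have c: "Ck_sphere (Suc k) (\<lambda>x. sphere_grad u x \<bullet> b)" if "b \<in> Basis" for b
    using u that by (metis Ck_sphere.simps(2))
  have V: "has_sphere_grad (\<lambda>x. sphere_grad u x \<bullet> b) (V b)" if "b \<in> Basis" for b
    unfolding V_def by (rule Ck_sphere_has_grad[OF c[OF that]])
  have "has_sphere_laplacian u (\<lambda>x. \<Sum>b\<in>Basis. V b x \<bullet> b)"
    unfolding has_sphere_laplacian_def
    by (rule exI[of _ "sphere_grad u"], rule exI[of _ V]) (simp add: V Ck_sphere_has_grad[OF u])
  then have eq: "laplace_beltrami u x = (\<Sum>b\<in>Basis. V b x \<bullet> b)" if "x \<in> sphere 0 1" for x
    using that by (rule laplace_beltrami_eq)
  then show "has_sphere_laplacian u (laplace_beltrami u)"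
    unfolding has_sphere_laplacian_def
    by (intro exI[of _ "sphere_grad u"] exI[of _ V]) (simp add: V Ck_sphere_has_grad[OF u])
  have "Ck_sphere k (\<lambda>x. V b x \<bullet> b)" if "b \<in> Basis" for b
    using c[OF that] that unfolding V_def by (metis Ck_sphere.simps(2))
  then have "Ck_sphere k (\<lambda>x. \<Sum>b\<in>Basis. V b x \<bullet> b)" by (rule Ck_sphere_sum)
  then show "Ck_sphere k (laplace_beltrami u)"
    using Ck_sphere_cong[of "laplace_beltrami u" "\<lambda>x. \<Sum>b\<in>Basis. V b x \<bullet> b"] eq by blast
qed

lemma has_sphere_laplacian_linear:
  assumes "has_sphere_laplacian u A" "has_sphere_laplacian v B"
  shows "has_sphere_laplacian (\<lambda>x. c * u x + d * v x) (\<lambda>x. c * A x + d * B x)"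
proof -
  obtain U V where U: "has_sphere_grad u U"
    "\<And>b. b \<in> Basis \<Longrightarrow> has_sphere_grad (\<lambda>x. U x \<bullet> b) (V b)"
    "\<And>x. x \<in> sphere 0 1 \<Longrightarrow> A x = (\<Sum>b\<in>Basis. V b x \<bullet> b)"
    using assms(1) unfolding has_sphere_laplacian_def by blast
  obtain W Z where W: "has_sphere_grad v W"
    "\<And>b. b \<in> Basis \<Longrightarrow> has_sphere_grad (\<lambda>x. W x \<bullet> b) (Z b)"
    "\<And>x. x \<in> sphere 0 1 \<Longrightarrow> B x = (\<Sum>b\<in>Basis. Z b x \<bullet> b)"
    using assms(2) unfolding has_sphere_laplacian_def by blast
  show ?thesis
    unfolding has_sphere_laplacian_def
  proof (intro exI conjI ballI)
    show "has_sphere_grad (\<lambda>x. c * u x + d * v x) (\<lambda>x. c *\<^sub>R U x + d *\<^sub>R W x)"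
      by (intro has_sphere_grad_add has_sphere_grad_cmult U W)
    show "has_sphere_grad (\<lambda>x. (c *\<^sub>R U x + d *\<^sub>R W x) \<bullet> b) ((\<lambda>b x. c *\<^sub>R V b x + d *\<^sub>R Z b x) b)"
      if "b \<in> Basis" for b
      unfolding inner_add_left inner_scaleR_left
      by (intro has_sphere_grad_add has_sphere_grad_cmult U W that)
    show "c * A x + d * B x = (\<Sum>b\<in>Basis. (c *\<^sub>R V b x + d *\<^sub>R Z b x) \<bullet> b)" if "x \<in> sphere 0 1" for x
      by (simp add: U(3)[OF that] W(3)[OF that] inner_add_left sum.distrib sum_distrib_left)
  qed
qed

section \<open>Commuting the factors and inverting the product\<close>

text \<open>A single factor P_1 - a of the product, named so that factors can be commuted.\<close>

definition conformal_factor :: "real \<Rightarrow> ('a::euclidean_space \<Rightarrow> real) \<Rightarrow> 'a \<Rightarrow> real"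
  where "conformal_factor a u x = conformal_laplacian u x - a * u x"

lemma gjms_Suc: "gjms (Suc m) u = gjms m (conformal_factor (real (Suc m) * (real (Suc m) - 1)) u)"
  by (simp add: conformal_factor_def[abs_def])

lemma conformal_factor_eq:
  "conformal_factor a u x =
    ((real DIM('a) - 1) * (real DIM('a) - 3) / 4 - a) * u x + (- 1) * laplace_beltrami u x"
  for u :: "'a::euclidean_space \<Rightarrow> real"
  by (simp add: conformal_factor_def conformal_laplacian_def Let_def algebra_simps)

lemma Ck_sphere_conformal_factor:
  assumes "Ck_sphere (Suc (Suc k)) u"
  shows "Ck_sphere k (conformal_factor a u)"
proof -
  have "Ck_sphere k u" using assms by (rule Ck_sphere_mono) simp
  then show ?thesis
    unfolding conformal_factor_eq[abs_def] by (rule Ck_sphere_linear[OF _ Ck_sphere_laplacian(2)[OF assms]])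
qed

lemma conformal_factor_cong:
  assumes "\<And>x. x \<in> sphere 0 1 \<Longrightarrow> f x = g x" "x \<in> sphere 0 1"
  shows "conformal_factor a f x = conformal_factor a g x"
proof -
  have "(sphere_grad f has_derivative D) (at x within sphere 0 1) \<longleftrightarrow>
      (sphere_grad g has_derivative D) (at x within sphere 0 1)" for D
    by (rule has_derivative_within_cong[OF assms(2)], rule sphere_grad_cong[OF assms(1)])
  then have "laplace_beltrami f x = laplace_beltrami g x"
    by (simp add: laplace_beltrami_def sphere_div_def sphere_deriv_def)
  then show ?thesis using assms by (simp add: conformal_factor_eq)
qed

text \<open>The commutation rule holds only at points of the sphere; this locality lets it be used
  inside \<open>gjms\<close>.\<close>

lemma gjms_cong:
  assumes "\<And>x. x \<in> sphere 0 1 \<Longrightarrow> f x = g x" "x \<in> sphere 0 1"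
  shows "gjms m f x = gjms m g x"
  using assms
proof (induction m arbitrary: f g)
  case (Suc m)
  show ?case
    unfolding gjms_Suc by (rule Suc.IH) (use conformal_factor_cong Suc.prems in blast)+
qed simp

text \<open>Both sides are the same quadratic polynomial in the Laplacian, which acts linearly on
  the functions involved.\<close>

lemma conformal_factor_commute:
  fixes u :: "'a::euclidean_space \<Rightarrow> real"
  assumes u: "Ck_sphere 4 u" and x: "x \<in> sphere 0 1"
  shows "conformal_factor a (conformal_factor b u) x = conformal_factor b (conformal_factor a u) x"
proof -
  have "4 = Suc (Suc (Suc (Suc 0)))" by simp
  note u4 = u[unfolded this]
  have u2: "Ck_sphere (Suc (Suc 0)) u" by (rule Ck_sphere_mono[OF u4]) simp
  have "laplace_beltrami (conformal_factor a u) x =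
    ((real DIM('a) - 1) * (real DIM('a) - 3) / 4 - a) * laplace_beltrami u x
    + (- 1) * laplace_beltrami (laplace_beltrami u) x" for a
    unfolding conformal_factor_eq[abs_def]
    by (rule laplace_beltrami_eq[OF has_sphere_laplacian_linear[OF Ck_sphere_laplacian(1)[OF u2]
        Ck_sphere_laplacian(1)[OF Ck_sphere_laplacian(2)[OF u4]]] x])
  note lap = this
  define k where "k = (real DIM('a) - 1) * (real DIM('a) - 3) / 4"
  show ?thesis
    unfolding conformal_factor_eq[of a "conformal_factor b u"] conformal_factor_eq[of b "conformal_factor a u"]
      lap conformal_factor_eq[of _ u] k_def[symmetric]
    by (simp add: algebra_simps)
qed

text \<open>The recursion puts the factor of largest index innermost, while the induction in
  \<open>gjms_representation\<close> needs it outermost; commuting moves it across.\<close>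

lemma gjms_conformal_factor:
  assumes "Ck_sphere (2 * m + 2) u" "x \<in> sphere 0 1"
  shows "gjms m (conformal_factor a u) x = conformal_factor a (gjms m u) x"
  using assms
proof (induction m arbitrary: u x)
  case (Suc m)
  define b where "b = real (Suc m) * (real (Suc m) - 1)"
  have u: "Ck_sphere (Suc (Suc (2 * m + 2))) u" using Suc.prems(1) by simp
  have u4: "Ck_sphere 4 u" by (rule Ck_sphere_mono[OF u]) simp
  have "gjms (Suc m) (conformal_factor a u) x = gjms m (conformal_factor b (conformal_factor a u)) x"
    by (simp only: gjms_Suc b_def)
  also have "\<dots> = gjms m (conformal_factor a (conformal_factor b u)) x"
    by (rule gjms_cong[OF conformal_factor_commute[OF u4] Suc.prems(2)])
  also have "\<dots> = conformal_factor a (gjms m (conformal_factor b u)) x"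
    by (rule Suc.IH[OF Ck_sphere_conformal_factor[OF u] Suc.prems(2)])
  finally show ?case by (simp only: gjms_Suc b_def)
qed simp

lemma Ck_sphere_gjms: "Ck_sphere (2 * m + k) u \<Longrightarrow> Ck_sphere k (gjms m u)"
proof (induction m arbitrary: u)
  case (Suc m)
  show ?case
    unfolding gjms_Suc by (rule Suc.IH, rule Ck_sphere_conformal_factor) (use Suc.prems in simp)
qed simp

text \<open>Induction on the number of factors. The first one is inverted by the kernel of critical
  order. Each further factor, brought to the outside, is transferred to the kernel by Green's
  identity and raises its order by one, from \<open>n / 2 - real (Suc m)\<close> to
  \<open>n / 2 - real m\<close>, where the induction hypothesis applies.\<close>

lemma gjms_representation:
  fixes u :: "'a::euclidean_space \<Rightarrow> real"
  assumes dim: "DIM('a) \<ge> 4" and m: "m \<ge> 1" "2 * m < DIM('a) - 1" and u: "Ck_sphere (2 * m) u"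
  defines "n \<equiv> real DIM('a) - 1"
  shows "\<exists>K>0. \<forall>y. norm y = 1 \<longrightarrow>
    u y = K * (LINT x|surf. riesz 0 (n / 2 - real m) y x * gjms m u x)"
  using m u
proof (induction m rule: nat_induct_at_least)
  case base
  then have u: "Ck_sphere (Suc (Suc 0)) u" by (simp add: numeral_2_eq_2)
  note L = Ck_sphere_laplacian(1)[OF u]
  define \<beta> where "\<beta> = n / 2 - 1"
  have n4: "real DIM('a) \<ge> 4" using of_nat_mono[OF dim, where 'a=real] by simp
  then have \<beta>: "\<beta> > 0" "2 * \<beta> < real DIM('a) - 1" "n - 1 - \<beta> > 0"
    by (simp_all add: \<beta>_def n_def field_simps)
  obtain e :: 'a where "e \<in> Basis" using nonempty_Basis by blast
  then have e: "norm e = 1" by simp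
  \<comment> \<open>Formed at one fixed pole \<open>e\<close>; \<open>riesz_mass_indep\<close> makes
    it the right constant for every \<open>y\<close>.\<close>
  define c where "c = \<beta> * (n - 1 - \<beta>) * (LINT x|surf. riesz 0 \<beta> e x)"
  have c: "c > 0"
    unfolding c_def using \<beta> riesz_mass_pos[OF dim _ \<beta>(2) e] by simp
  have "u y = 1 / c * (LINT x|surf. riesz 0 (n / 2 - real 1) y x * gjms 1 u x)"
    if y: "norm y = 1" for y
  proof -
    have "(LINT x|surf. riesz 0 (n / 2 - real 1) y x * gjms 1 u x) =
        (LINT x|surf. riesz 0 \<beta> y x * (\<beta> * (n - 1 - \<beta>) * u x - laplace_beltrami u x))"
    proof (rule Bochner_Integration.integral_cong[OF refl])
      fix x :: 'a
      have k: "\<beta> * (n - 1 - \<beta>) = (real DIM('a) - 1) * (real DIM('a) - 3) / 4"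
        by (simp add: \<beta>_def n_def field_simps)
      have "gjms 1 u x = conformal_factor 0 u x" using gjms_Suc[of 0 u] by simp
      then have "gjms 1 u x = \<beta> * (n - 1 - \<beta>) * u x - laplace_beltrami u x"
        unfolding conformal_factor_eq k by simp
      then show "riesz 0 (n / 2 - real 1) y x * gjms 1 u x =
          riesz 0 \<beta> y x * (\<beta> * (n - 1 - \<beta>) * u x - laplace_beltrami u x)"
        by (simp add: \<beta>_def)
    qed
    also have "\<dots> = c * u y"
      using green_riesz_critical[OF dim L y] riesz_mass_indep[of y e 0 \<beta>] dim y e
      by (simp add: c_def \<beta>_def n_def)
    finally show ?thesis using c by simp
  qed
  then show ?case using c by (intro exI[of _ "1 / c"]) simp
next
  case (Suc m)
  have u: "Ck_sphere (2 * m + 2) u" using Suc.prems(2) by simp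
  have "Ck_sphere (Suc (Suc 0)) (gjms m u)" using Ck_sphere_gjms[OF u] by (simp add: numeral_2_eq_2)
  note L = Ck_sphere_laplacian(1)[OF this]
  define \<beta> where "\<beta> = n / 2 - real (Suc m)"
  have "real (2 * Suc m) < real (DIM('a) - 1)" using Suc.prems(1) by (simp only: of_nat_less_iff)
  then have "2 * real m + 2 < n" using dim by (simp add: n_def of_nat_diff)
  moreover have \<beta>2: "2 * \<beta> = n - 2 - 2 * real m" by (simp add: \<beta>_def)
  ultimately have \<beta>: "\<beta> > 0" "2 * \<beta> < n - 2" using Suc.hyps by auto
  then have c: "\<beta> * (n - 2 - 2 * \<beta>) > 0" by simp
  have "Ck_sphere (2 * m) u" by (rule Ck_sphere_mono[OF u]) simp
  then obtain K where K: "K > 0" "\<And>y. norm y = 1 \<Longrightarrow>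
      u y = K * (LINT x|surf. riesz 0 (n / 2 - real m) y x * gjms m u x)"
    using Suc.IH Suc.prems(1) by auto
  define d where "d = \<beta> * (n - 2 - 2 * \<beta>)"
  have "u y = K / d * (LINT x|surf. riesz 0 (n / 2 - real (Suc m)) y x * gjms (Suc m) u x)"
    if y: "norm y = 1" for y
  proof -
    have "(LINT x|surf. riesz 0 (n / 2 - real (Suc m)) y x * gjms (Suc m) u x) =
      (LINT x|surf. riesz 0 \<beta> y x * (\<beta> * (n - 1 - \<beta>) * gjms m u x - laplace_beltrami (gjms m u) x))"
    proof (rule Bochner_Integration.integral_cong[OF refl])
      fix x :: 'a assume x: "x \<in> space surf"
      \<comment> \<open>The zero-order coefficient in Green's identity is that of the factor of
        index \<open>Suc m\<close>.\<close>
      have "\<beta> * (n - 1 - \<beta>) = (real DIM('a) - 1) * (real DIM('a) - 3) / 4 - real (Suc m) * (real (Suc m) - 1)"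
        by (simp add: \<beta>_def n_def field_simps)
      then have "gjms (Suc m) u x = \<beta> * (n - 1 - \<beta>) * gjms m u x - laplace_beltrami (gjms m u) x"
        unfolding gjms_Suc using gjms_conformal_factor[OF u] x by (simp add: conformal_factor_eq)
      then show "riesz 0 (n / 2 - real (Suc m)) y x * gjms (Suc m) u x = riesz 0 \<beta> y x *
          (\<beta> * (n - 1 - \<beta>) * gjms m u x - laplace_beltrami (gjms m u) x)"
        by (simp only: \<beta>_def)
    qed
    also have "\<dots> = d * (LINT x|surf. riesz 0 (\<beta> + 1) y x * gjms m u x)"
      unfolding d_def n_def by (rule green_riesz[OF dim L y]) (use \<beta> in \<open>simp_all add: n_def\<close>)
    also have "\<beta> + 1 = n / 2 - real m" by (simp add: \<beta>_def)
    finally have *: "(LINT x|surf. riesz 0 (n / 2 - real (Suc m)) y x * gjms (Suc m) u x) =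
      d * (LINT x|surf. riesz 0 (n / 2 - real m) y x * gjms m u x)" .
    have "d > 0" using c by (simp only: d_def)
    then show ?thesis unfolding * using K(2)[OF y] by simp
  qed
  then show ?case using K(1) c by (intro exI[of _ "K / d"]) (simp add: d_def)
qed

section \<open>Moving caps\<close>

context
  fixes e :: "'a::euclidean_space" and t :: real
  assumes e: "norm e = 1" and t: "\<bar>t\<bar> < 1"
begin

lemma cone_refl_scaleR: "c \<ge> 0 \<Longrightarrow> cone_refl t e (c *\<^sub>R x) = c *\<^sub>R cone_refl t e x"
  and stretch_scaleR: "c \<ge> 0 \<Longrightarrow> stretch t e (c *\<^sub>R x) = c * stretch t e x"
  by (simp_all add: cone_refl_def stretch_def algebra_simps)

lemma sphere_refl_eq: "sphere_refl t e x = (1 / stretch t e x) *\<^sub>R cone_refl t e x"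
  by (simp add: sphere_refl_def sgn_div_norm norm_cone_refl[OF e t] divide_inverse)

lemma stretch_sphere_pos: "norm x = 1 \<Longrightarrow> stretch t e x > 0"
  by (rule stretch_pos[OF e t]) auto

lemma norm_sphere_refl: "norm x = 1 \<Longrightarrow> norm (sphere_refl t e x) = 1"
  using stretch_sphere_pos[of x] by (simp add: sphere_refl_eq norm_cone_refl[OF e t])

lemma sphere_refl_involution:
  assumes x: "norm x = 1"
  shows "sphere_refl t e (sphere_refl t e x) = x"
    and "stretch t e (sphere_refl t e x) = 1 / stretch t e x"
proof -
  have N: "stretch t e x > 0" using stretch_sphere_pos x by blast
  show *: "stretch t e (sphere_refl t e x) = 1 / stretch t e x"
    unfolding sphere_refl_eq[of x] using N x
    by (subst stretch_scaleR) (simp_all add: stretch_cone_refl[OF e t])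
  have "cone_refl t e (sphere_refl t e x) = (1 / stretch t e x) *\<^sub>R x"
    unfolding sphere_refl_eq[of x] using N
    by (subst cone_refl_scaleR) (simp_all add: cone_refl_involution[OF e t])
  then show "sphere_refl t e (sphere_refl t e x) = x"
    unfolding sphere_refl_eq[of "sphere_refl t e x"] * using N by simp
qed

lemma inner_sphere_refl:
  assumes "norm x = 1" "norm y = 1"
  shows "1 - sphere_refl t e x \<bullet> sphere_refl t e y
    = (1 - x \<bullet> y) / (stretch t e x * stretch t e y)"
proof -
  have "stretch t e x > 0" "stretch t e y > 0" using stretch_sphere_pos assms by blast+
  then show ?thesis
    using cone_refl_lorentz[OF e t, of x y] assms by (simp add: sphere_refl_eq field_simps)
qed

lemma inner_sphere_refl_mixed:
  assumes "norm x = 1" "norm y = 1"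
  shows "stretch t e y * (1 - x \<bullet> sphere_refl t e y)
    = 1 - x \<bullet> y + 2 * (x \<bullet> e - t) * (y \<bullet> e - t) / (1 - t\<^sup>2)"
proof -
  have "stretch t e y > 0" using stretch_sphere_pos assms by blast
  then have "stretch t e y * (1 - x \<bullet> sphere_refl t e y) = stretch t e y - x \<bullet> cone_refl t e y"
    by (simp add: sphere_refl_eq right_diff_distrib)
  then show ?thesis using cone_refl_lorentz_mixed[OF e t, of x y] assms by simp
qed

lemma sphere_refl_height:
  assumes "norm x = 1"
  shows "sphere_refl t e x \<bullet> e - t = - (x \<bullet> e - t) / stretch t e x"
proof -
  have "stretch t e x > 0" using stretch_sphere_pos assms by blast
  then show ?thesis
    using inner_cone_refl[OF e t, of x] assms by (simp add: sphere_refl_eq field_simps)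
qed

text \<open>For \<open>t > 0\<close>, \<open>stretch\<close> is below 1 exactly on the cap
  \<open>x \<bullet> e > t\<close>; this fixes the sign in the subcritical comparison.\<close>

lemma stretch_minus_1:
  assumes "norm x = 1"
  shows "stretch t e x - 1 = 2 * t * (t - x \<bullet> e) / (1 - t\<^sup>2)"
  using one_minus_power2_pos[OF t] assms
  by (simp add: stretch_def divide_simps) (simp add: algebra_simps power2_eq_square)

lemma sphere_refl_fixed:
  assumes "norm x = 1" "x \<bullet> e = t"
  shows "sphere_refl t e x = x" "stretch t e x = 1"
proof -
  show 1: "stretch t e x = 1" using stretch_minus_1[OF assms(1)] assms(2) by simp
  show "sphere_refl t e x = x"
    unfolding sphere_refl_eq 1 using assms by (simp add: cone_refl_def)
qed

end

section \<open>Null parallels and small sets\<close>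

text \<open>The cone over the parallel lies in the frontier of the convex cone \<open>C\<close>, and
  frontiers of convex sets are negligible. A step of length \<open>r\<close> against
  \<open>e\<close> lowers \<open>x \<bullet> e\<close> by \<open>r\<close> but
  \<open>t * norm x\<close> by at most \<open>t * r\<close>, so it leaves \<open>C\<close>.\<close>

lemma AE_surf_parallel:
  fixes e :: "'a::euclidean_space"
  assumes e: "norm e = 1" and t: "0 \<le> t" "t < 1"
  shows "AE x in surf. x \<bullet> e \<noteq> t"
proof -
  define C where "C = {x::'a. t * norm x \<le> x \<bullet> e}"
  have "convex C"
  proof (rule convexI)
    fix x y :: 'a and a b :: real
    assume xy: "x \<in> C" "y \<in> C" and ab: "0 \<le> a" "0 \<le> b"
    have "t * norm (a *\<^sub>R x + b *\<^sub>R y) \<le> t * (a * norm x + b * norm y)"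
      using norm_triangle_ineq[of "a *\<^sub>R x" "b *\<^sub>R y"] t ab by (intro mult_left_mono) auto
    also have "\<dots> = a * (t * norm x) + b * (t * norm y)" by (simp add: algebra_simps)
    also have "\<dots> \<le> a * (x \<bullet> e) + b * (y \<bullet> e)"
      using xy ab by (intro add_mono mult_left_mono) (auto simp: C_def)
    finally show "a *\<^sub>R x + b *\<^sub>R y \<in> C" by (simp add: C_def inner_add_left)
  qed
  then have "negligible (frontier C)" by (rule negligible_convex_frontier)
  moreover have "{x. x \<bullet> e = t * norm x} \<subseteq> frontier C"
  proof
    fix x assume "x \<in> {x. x \<bullet> e = t * norm x}"
    then have x: "x \<bullet> e = t * norm x" by simp
    have "x \<notin> interior C"
    proof
      assume "x \<in> interior C"
      then obtain r where r: "r > 0" "cball x r \<subseteq> C" unfolding mem_interior_cball by blast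
      have "x - r *\<^sub>R e \<in> cball x r" using r e by (simp add: dist_norm)
      then have "x - r *\<^sub>R e \<in> C" using r(2) by blast
      then have "t * norm (x - r *\<^sub>R e) \<le> (x - r *\<^sub>R e) \<bullet> e" by (simp add: C_def)
      moreover have "(x - r *\<^sub>R e) \<bullet> e = t * norm x - r"
        using e x by (simp add: inner_diff_left dot_square_norm)
      moreover have "norm x - r \<le> norm (x - r *\<^sub>R e)"
        using norm_triangle_ineq2[of x "r *\<^sub>R e"] r e by simp
      then have "t * (norm x - r) \<le> t * norm (x - r *\<^sub>R e)" using t by (intro mult_left_mono)
      ultimately have "r \<le> t * r" by (simp add: algebra_simps)
      then show False using r t by (simp add: mult_less_cancel_right2 not_le[symmetric])
    qed
    moreover have "x \<in> closure C" using x closure_subset by (fastforce simp: C_def)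
    ultimately show "x \<in> frontier C" by (simp add: frontier_def)
  qed
  ultimately have "negligible {x::'a. x \<bullet> e = t * norm x}" by (rule negligible_subset)
  moreover have "closed {x::'a. x \<bullet> e = t * norm x}"
    by (intro closed_Collect_eq continuous_intros)
  ultimately have null: "{x::'a. x \<bullet> e = t * norm x} \<in> null_sets lborel"
    by (simp add: negligible_iff_null_sets null_sets_completion_iff borel_closed)
  define B where "B = {x::'a. norm x = 1 \<and> x \<bullet> e = t}"
  have "closed {x::'a. norm x = 1 \<and> x \<bullet> e = t}"
    by (intro closed_Collect_conj closed_Collect_eq continuous_intros)
  then have Bs: "B \<in> sets surf"
    by (auto simp: B_def sets_restrict_space image_iff borel_closed intro!: bexI[of _ "{x. norm x = 1 \<and> x \<bullet> e = t}"])
  have "emeasure surf B = (\<integral>\<^sup>+x. indicator B x \<partial>surf)"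
    by (rule nn_integral_indicator[symmetric]) fact
  also have "\<dots> = (\<integral>\<^sup>+x. indicator B (sgn x) * indicator (- {0}) x *
    ennreal (cutoff (norm x) / norm x ^ DIM('a)) \<partial>lborel)"
    by (rule nn_integral_surf) (rule borel_measurable_indicator[OF Bs])
  also have "\<dots> = (\<integral>\<^sup>+x. 0 \<partial>(lborel :: 'a measure))"
  proof (rule nn_integral_cong_AE, rule AE_mp[OF AE_not_in[OF null]], intro AE_I2 impI)
    fix x :: 'a assume x: "x \<notin> {x. x \<bullet> e = t * norm x}"
    have "sgn x \<notin> B" if "x \<noteq> 0"
      using that x by (auto simp: B_def sgn_div_norm field_simps)
    then show "indicator B (sgn x) * indicator (- {0}) x *
      ennreal (cutoff (norm x) / norm x ^ DIM('a)) = 0"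
      by (cases "x = 0") auto
  qed
  finally have "B \<in> null_sets surf" using Bs by (simp add: null_sets_def)
  then have "AE x in surf. x \<notin> B" by (rule AE_not_in)
  then show ?thesis using AE_space by eventually_elim (auto simp: B_def)
qed

lemma powr_diff_le:
  fixes a b p :: real
  assumes "0 \<le> a" "a < b" "1 \<le> p"
  shows "b powr p - a powr p \<le> p * b powr (p - 1) * (b - a)"
proof -
  have deriv: "((\<lambda>z. z powr p) has_real_derivative p * z powr (p - 1)) (at z)" if "z > 0" for z
    using that by (auto intro!: derivative_eq_intros)
  have "\<exists>l z. a < z \<and> z < b \<and> ((\<lambda>z. z powr p) has_real_derivative l) (at z) \<and>
      b powr p - a powr p = (b - a) * l"
  proof (rule MVT[OF assms(2)])
    show "continuous_on {a..b} (\<lambda>z. z powr p)"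
      using assms by (intro continuous_on_powr' continuous_intros) auto
    show "(\<lambda>z. z powr p) differentiable at z" if "a < z" for z
      using deriv[of z] that assms(1) real_differentiable_def by auto
  qed
  then obtain l z where z: "a < z" "z < b" "((\<lambda>z. z powr p) has_real_derivative l) (at z)"
    "b powr p - a powr p = (b - a) * l" by blast
  have "l = p * z powr (p - 1)" using DERIV_unique[OF z(3) deriv] z(1) assms(1) by simp
  also have "\<dots> \<le> p * b powr (p - 1)"
    using z assms by (intro mult_left_mono powr_mono2) auto
  finally have "(b - a) * l \<le> (b - a) * (p * b powr (p - 1))"
    using assms by (intro mult_left_mono) auto
  then show ?thesis unfolding z(4) by (simp add: mult_ac)
qed

text \<open>The kernel is at most a small multiple of a more singular integrable kernel plus a constant.\<close>

lemma riesz_small_sets: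
  assumes dim: "DIM('a::euclidean_space) \<ge> 4" and \<gamma>: "0 \<le> \<gamma>" "2 * \<gamma> < real DIM('a) - 1" and \<eta>: "\<eta> > 0"
  shows "\<exists>\<kappa>>0. \<forall>y::'a. \<forall>B\<in>sets surf. norm y = 1 \<longrightarrow> measure surf B < \<kappa> \<longrightarrow>
    (LINT x|surf. indicator B x * riesz 0 \<gamma> y x) \<le> \<eta>"
proof -
  interpret finite_measure "surf :: 'a measure" by (rule finite_measure_surf)
  define \<gamma>' where "\<gamma>' = (\<gamma> + (real DIM('a) - 1) / 2) / 2"
  have \<gamma>': "\<gamma> < \<gamma>'" "2 * \<gamma>' < real DIM('a) - 1" "0 \<le> \<gamma>'" using \<gamma> by (simp_all add: \<gamma>'_def field_simps)
  obtain C where C: "norm y = 1 \<Longrightarrow> integrable surf (riesz 0 \<gamma>' y)"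
    "norm y = 1 \<Longrightarrow> (LINT x|surf. riesz 0 \<gamma>' y x) \<le> C" for y :: 'a
    using riesz_mass_bounded[OF dim \<gamma>'(3,2)] by blast
  have i: "integrable surf (riesz 0 \<gamma> y)" if "norm y = 1" for y :: 'a
    using riesz_mass_bounded[OF dim \<gamma>] that by blast
  define C' where "C' = max C 1"
  have C': "C' > 0" "C \<le> C'" by (simp_all add: C'_def)
  \<comment> \<open>Where the distance variable is at most \<rho>, the more singular kernel
    contributes at most \<eta> / 2. Elsewhere the kernel is at most
    \<open>\<rho> powr (- \<gamma>)\<close>, and \<kappa> is chosen so that a set of that measure
    contributes the other \<eta> / 2.\<close>
  define \<rho> where "\<rho> = (\<eta> / (2 * C')) powr (1 / (\<gamma>' - \<gamma>))"
  have \<rho>: "\<rho> > 0" using \<eta> C' by (simp add: \<rho>_def)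
  have \<rho>': "\<rho> powr (\<gamma>' - \<gamma>) = \<eta> / (2 * C')"
    using \<eta> C' \<gamma>' by (simp add: \<rho>_def powr_powr)
  define \<kappa> where "\<kappa> = \<eta> / 2 * \<rho> powr \<gamma>"
  have \<kappa>: "\<kappa> > 0" using \<eta> \<rho> by (simp add: \<kappa>_def)
  have "(LINT x|surf. indicator B x * riesz 0 \<gamma> y x) \<le> \<eta>"
    if y: "norm y = 1" and B: "B \<in> sets surf" "measure surf B < \<kappa>"
    for y :: 'a and B
  proof -
    have Bsub: "B \<subseteq> sphere 0 1" using sets.sets_into_space[OF B(1)] by simp
    have iB: "integrable surf (indicat_real B)"
      by (rule integrable_real_indicator[OF B(1)]) (simp add: emeasure_eq_measure)
    have "(LINT x|surf. indicator B x * riesz 0 \<gamma> y x) \<le>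
      (LINT x|surf. \<rho> powr (\<gamma>' - \<gamma>) * riesz 0 \<gamma>' y x + \<rho> powr (- \<gamma>) * indicator B x)"
    proof (rule integral_mono)
      show "integrable surf (\<lambda>x. indicator B x * riesz 0 \<gamma> y x)"
        using integrable_mult_indicator[OF B(1) i[OF y]] by simp
      fix x :: 'a assume "x \<in> space surf"
      then have s: "1 - x \<bullet> y \<ge> 0" using sphere_inner_le_1[of x y] y by simp
      define s' where "s' = 1 - x \<bullet> y"
      consider "s' = 0" | "0 < s'" "s' \<le> \<rho>" | "\<rho> < s'" using s by (force simp: s'_def)
      then have "s' powr (- \<gamma>) \<le> \<rho> powr (\<gamma>' - \<gamma>) * s' powr (- \<gamma>') + \<rho> powr (- \<gamma>)"
      proof cases
        case 2
        have "s' powr (- \<gamma>) = s' powr (\<gamma>' - \<gamma>) * s' powr (- \<gamma>')"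
          using 2 by (simp add: powr_add[symmetric])
        also have "\<dots> \<le> \<rho> powr (\<gamma>' - \<gamma>) * s' powr (- \<gamma>')"
          using 2 \<gamma>' by (intro mult_right_mono powr_mono2) auto
        finally show ?thesis by (simp add: add_increasing2)
      next
        case 3
        then have "s' powr (- \<gamma>) \<le> \<rho> powr (- \<gamma>)" using \<rho> \<gamma> by (intro powr_mono2') auto
        then show ?thesis by (simp add: add_increasing)
      qed simp
      then show "indicator B x * riesz 0 \<gamma> y x \<le>
          \<rho> powr (\<gamma>' - \<gamma>) * riesz 0 \<gamma>' y x + \<rho> powr (- \<gamma>) * indicator B x"
        by (simp add: riesz_def s'_def indicator_def)
    qed (intro Bochner_Integration.integrable_add integrable_mult_right C y iB)
    also have "\<dots> = \<rho> powr (\<gamma>' - \<gamma>) * (LINT x|surf. riesz 0 \<gamma>' y x)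
        + \<rho> powr (- \<gamma>) * measure surf B"
      using C(1)[OF y] iB Bsub by (simp add: Int_absorb2)
    also have "\<dots> \<le> \<eta> / (2 * C') * C' + \<rho> powr (- \<gamma>) * \<kappa>"
      unfolding \<rho>' using \<eta> C' C(2)[OF y] B(2)
      by (intro add_mono mult_left_mono) (auto intro: order_trans)
    also have "\<rho> powr (- \<gamma>) * \<kappa> = \<eta> / 2" using \<rho> by (simp add: \<kappa>_def powr_minus field_simps)
    finally show ?thesis using C' by simp
  qed
  then show ?thesis using \<kappa> by blast
qed

lemma (in finite_measure) measure_tendsto_0:
  assumes B: "\<And>k::nat. B k \<in> sets M" and AE: "AE x in M. \<forall>\<^sub>F k in sequentially. x \<notin> B k"
  shows "(\<lambda>k. measure M (B k)) \<longlonglongrightarrow> 0"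
proof -
  have "(\<lambda>k. \<integral>x. indicat_real (B k) x \<partial>M) \<longlonglongrightarrow> (\<integral>x. 0 \<partial>M)"
  proof (rule integral_dominated_convergence[where w="\<lambda>x. 1"])
    show "AE x in M. (\<lambda>k. indicat_real (B k) x) \<longlonglongrightarrow> 0"
      using AE
    proof eventually_elim
      case (elim x)
      then show ?case
        by (intro tendsto_eventually) (auto elim!: eventually_mono)
    qed
  qed (use B in \<open>auto simp: indicator_def\<close>)
  moreover have "(\<integral>x. indicat_real (B k) x \<partial>M) = measure M (B k)" for k
    using sets.sets_into_space[OF B[of k]] by (simp add: Int_absorb2)
  ultimately show ?thesis by simp
qed

section \<open>The integral equation and its Kelvin transform\<close>

text \<open>For \<alpha> = n / 2 - m the condition
  \<open>\<alpha> * p < real DIM('a) - 1 - \<alpha>\<close> is p < (n + 2 m) / (n - 2 m), since n -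
  \<alpha> = n / 2 + m.\<close>

locale subcritical_integral_equation =
  fixes u :: "'a::euclidean_space \<Rightarrow> real" and K \<alpha> p n :: real
  assumes dim: "DIM('a) \<ge> 4" and n: "n = real DIM('a) - 1"
    and \<alpha>: "0 < \<alpha>" "2 * \<alpha> < real DIM('a) - 1"
    and p: "1 \<le> p" "\<alpha> * p < real DIM('a) - 1 - \<alpha>"
    and K: "K > 0"
    and u_cont: "continuous_on (sphere 0 1) u"
    and u_nonneg: "\<And>x. norm x = 1 \<Longrightarrow> u x \<ge> 0"
    and u_eq: "\<And>y. norm y = 1 \<Longrightarrow>
      u y = K * (LINT x|surf. riesz 0 \<alpha> y x * u x powr p)"
begin

definition h :: "'a \<Rightarrow> real" where "h x = u x powr p"

text \<open>The Kelvin transform of \<open>u\<close>: the weight offsets the factor by which the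
  kernel scales at the outer point.\<close>

definition u_refl :: "real \<Rightarrow> 'a \<Rightarrow> 'a \<Rightarrow> real"
  where "u_refl t e x = stretch t e x powr (- \<alpha>) * u (sphere_refl t e x)"

text \<open>The exponent \<alpha> comes from the kernel at the integration point and
  \<open>- n\<close> from the Jacobian of the reflection, so that \<open>u_refl\<close> is the
  potential of \<open>h_refl\<close>. At the critical exponent this would be
  \<open>u_refl t e x powr p\<close>.\<close>

definition h_refl :: "real \<Rightarrow> 'a \<Rightarrow> 'a \<Rightarrow> real"
  where "h_refl t e x = stretch t e x powr (\<alpha> - n) * h (sphere_refl t e x)"

lemma h_cont: "continuous_on (sphere 0 1) h"
  unfolding h_def[abs_def] using u_nonneg p by (intro continuous_on_powr' continuous_intros u_cont) auto

lemma h_nonneg: "h x \<ge> 0"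
  by (simp add: h_def)

lemma integrable_riesz_bounded:
  fixes f :: "'a \<Rightarrow> real"
  assumes f: "f \<in> borel_measurable surf" "\<And>x. norm x = 1 \<Longrightarrow> \<bar>f x\<bar> \<le> M" and y: "norm y = 1"
  shows "integrable surf (\<lambda>x. riesz 0 \<alpha> y x * f x)"
proof -
  have "integrable surf (riesz 0 \<alpha> y)"
    using riesz_mass_bounded[OF dim less_imp_le[OF \<alpha>(1)] \<alpha>(2)] y by blast
  then show ?thesis
    using f by (intro Bochner_Integration.integrable_bound[of _ "\<lambda>x. riesz 0 \<alpha> y x * M"
          "\<lambda>x. riesz 0 \<alpha> y x * f x"])
      (auto intro!: AE_I2 borel_measurable_times measurable_riesz mult_left_mono
        intro: order_trans[OF _ abs_ge_self] simp: abs_mult)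
qed

text \<open>A zero of \<open>u\<close> forces the nonnegative integrand there, hence
  \<open>h\<close>, to vanish almost everywhere; the equation at \<open>z\<close> then gives
  \<open>u z = 0\<close>.\<close>

lemma u_pos:
  assumes "norm z = 1" "u z > 0" and y: "norm y = 1"
  shows "u y > 0"
proof (rule ccontr)
  assume "\<not> u y > 0"
  then have y0: "u y = 0" using u_nonneg[OF y] by simp
  have "(LINT x|surf. riesz 0 \<alpha> y x * h x) = 0"
    using u_eq[OF y] y0 K by (simp add: h_def)
  moreover have "integrable surf (\<lambda>x. riesz 0 \<alpha> y x * h x)"
    using integrable_riesz_mult[OF dim less_imp_le[OF \<alpha>(1)] \<alpha>(2) y h_cont] .
  ultimately have "AE x in surf. riesz 0 \<alpha> y x * h x = 0"
    by (subst (asm) integral_nonneg_eq_0_iff_AE) (auto simp: h_nonneg)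
  then have "AE x in surf. h x = 0"
    using AE_surf_neq[OF dim y] AE_space
  proof eventually_elim
    case (elim x)
    then show ?case using sphere_inner_eq_1_iff[of x y] y by (auto simp: riesz_def)
  qed
  then have "(LINT x|surf. riesz 0 \<alpha> z x * h x) = (\<integral>x. 0 \<partial>(surf :: 'a measure))"
    using borel_measurable_surf_continuous[OF h_cont]
    by (intro integral_cong_AE borel_measurable_times measurable_riesz) auto
  then show False using u_eq[OF assms(1)] assms(2) by (simp add: h_def)
qed

context
  fixes e :: 'a and t :: real
  assumes e: "norm e = 1" and t: "0 < t" "t < 1"
begin

lemma abs_t: "\<bar>t\<bar> < 1" using t by simp

lemma N_pos: "norm x = 1 \<Longrightarrow> stretch t e x > 0"
  by (rule stretch_sphere_pos[OF e abs_t])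

lemma N_less_1:
  assumes "norm x = 1" "x \<bullet> e > t"
  shows "stretch t e x < 1"
proof -
  have "2 * t * (t - x \<bullet> e) / (1 - t\<^sup>2) < 0"
    using assms t one_minus_power2_pos[OF abs_t] by (intro divide_neg_pos mult_pos_neg) auto
  then show ?thesis using stretch_minus_1[OF e abs_t assms(1)] by linarith
qed

lemma u_refl_measurable: "u_refl t e \<in> borel_measurable surf"
  and h_refl_measurable: "h_refl t e \<in> borel_measurable surf"
proof -
  have dim2: "DIM('a) \<ge> 2" using dim by simp
  note [measurable] = measurable_sphere_refl[OF e abs_t]
    measurable_stretch_sphere[OF e abs_t]
    borel_measurable_surf_continuous[OF u_cont] borel_measurable_surf_continuous[OF h_cont]
  show "u_refl t e \<in> borel_measurable surf" "h_refl t e \<in> borel_measurable surf"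
    unfolding u_refl_def[abs_def] h_refl_def[abs_def] by measurable
qed

lemma h_refl_bounded: "\<exists>M. \<forall>x. norm x = 1 \<longrightarrow> \<bar>h_refl t e x\<bar> \<le> M"
proof -
  obtain M where M: "M \<ge> 0" "\<And>x. norm x = 1 \<Longrightarrow> norm (h x) \<le> M"
    using continuous_on_sphere_bounded[OF h_cont] by blast
  have "continuous_on (sphere 0 1) (\<lambda>x. stretch t e x powr (\<alpha> - n))"
    unfolding stretch_def
    using N_pos one_minus_power2_pos[OF abs_t] by (intro continuous_intros) (force simp: stretch_def)+
  then obtain C where C: "C \<ge> 0" "\<And>x. norm x = 1 \<Longrightarrow> norm (stretch t e x powr (\<alpha> - n)) \<le> C"
    using continuous_on_sphere_bounded by blast
  have "\<bar>h_refl t e x\<bar> \<le> C * M" if x: "norm x = 1" for x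
    using M(2)[OF norm_sphere_refl[OF e abs_t x]] C(2)[OF x] C(1) M(1)
    by (auto simp: h_refl_def abs_mult intro!: mult_mono)
  then show ?thesis by blast
qed

lemma u_refl_eq:
  assumes x: "norm x = 1"
  shows "u_refl t e x = K * (LINT y|surf. riesz 0 \<alpha> x y * h_refl t e y)"
proof -
  have dim2: "DIM('a) \<ge> 2" using dim by simp
  let ?R = "sphere_refl t e" and ?N = "stretch t e"
  have Rx: "norm (?R x) = 1" by (rule norm_sphere_refl[OF e abs_t x])
  have "(\<lambda>y. riesz 0 \<alpha> (?R x) y * h y) \<in> borel_measurable surf"
    by (intro borel_measurable_times measurable_riesz borel_measurable_surf_continuous h_cont)
  then have "u (?R x) = K * (LINT y|surf. riesz 0 \<alpha> (?R x) (?R y) * h (?R y) / ?N y ^ (DIM('a) - 1))"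
    unfolding u_eq[OF Rx] h_def[symmetric]
    by (subst integral_sphere_refl[OF e abs_t dim2]) auto
  also have "(LINT y|surf. riesz 0 \<alpha> (?R x) (?R y) * h (?R y) / ?N y ^ (DIM('a) - 1))
      = (LINT y|surf. ?N x powr \<alpha> * (riesz 0 \<alpha> x y * h_refl t e y))"
  proof (rule Bochner_Integration.integral_cong[OF refl])
    fix y :: 'a assume "y \<in> space surf"
    then have y: "norm y = 1" by simp
    have N: "?N x > 0" "?N y > 0" using N_pos x y by auto
    have s: "1 - y \<bullet> x \<ge> 0" using sphere_inner_le_1[OF y x] by simp
    have "riesz 0 \<alpha> (?R x) (?R y) = ((1 - y \<bullet> x) / (?N y * ?N x)) powr (- \<alpha>)"
      using inner_sphere_refl[OF e abs_t y x] by (simp add: riesz_def)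
    also have "\<dots> = (1 - y \<bullet> x) powr (- \<alpha>) / (?N y powr (- \<alpha>) * ?N x powr (- \<alpha>))"
      using N s by (simp add: powr_divide powr_mult)
    also have "\<dots> = riesz 0 \<alpha> x y * ?N y powr \<alpha> * ?N x powr \<alpha>"
      by (simp add: riesz_def powr_minus divide_inverse)
    finally have "riesz 0 \<alpha> (?R x) (?R y) = riesz 0 \<alpha> x y * ?N y powr \<alpha> * ?N x powr \<alpha>" .
    moreover have "?N y powr (\<alpha> - n) = ?N y powr \<alpha> / ?N y ^ (DIM('a) - 1)"
      using N(2) dim2 by (simp add: powr_diff powr_realpow[symmetric] of_nat_diff n)
    ultimately show "riesz 0 \<alpha> (?R x) (?R y) * h (?R y) / ?N y ^ (DIM('a) - 1)
        = ?N x powr \<alpha> * (riesz 0 \<alpha> x y * h_refl t e y)"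
      by (simp add: h_refl_def)
  qed
  finally have "?N x powr (- \<alpha>) * u (?R x) =
      (?N x powr (- \<alpha>) * ?N x powr \<alpha>) * (K * (LINT y|surf. riesz 0 \<alpha> x y * h_refl t e y))"
    by simp
  moreover have "?N x powr (- \<alpha>) * ?N x powr \<alpha> = 1"
    using N_pos[OF x] by (simp add: powr_add[symmetric])
  ultimately show ?thesis by (simp add: u_refl_def)
qed

text \<open>As in the method of images: by \<open>inner_sphere_refl_mixed\<close> the base of the
  second power is \<open>stretch t e y * (1 - x \<bullet> sphere_refl t e y)\<close>, the kernel
  seen from the mirror image of \<open>y\<close> and folded back into the cap.\<close>

definition cap_kernel :: "'a \<Rightarrow> 'a \<Rightarrow> real"
  where "cap_kernel x y = (1 - x \<bullet> y) powr (- \<alpha>)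
    - (1 - x \<bullet> y + 2 * (x \<bullet> e - t) * (y \<bullet> e - t) / (1 - t\<^sup>2)) powr (- \<alpha>)"

definition cap :: "'a set" where "cap = {x. norm x = 1 \<and> x \<bullet> e > t}"

lemma cap_sets: "cap \<in> sets surf"
proof -
  have "open {x. t < x \<bullet> e}" by (intro open_Collect_less continuous_intros)
  then show ?thesis
    by (auto simp: cap_def sets_restrict_space image_iff borel_open intro!: bexI[of _ "{x. t < x \<bullet> e}"])
qed

text \<open>At \<open>y = x\<close> the first power in \<open>cap_kernel x y\<close> is the junk value \<open>0 powr (- \<alpha>) = 0\<close>.\<close>

lemma cap_kernel_bounds:
  assumes "x \<in> cap" "y \<in> cap" "y \<noteq> x"
  shows "0 < cap_kernel x y" "cap_kernel x y \<le> riesz 0 \<alpha> x y"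
proof -
  have xy: "norm x = 1" "norm y = 1" using assms by (auto simp: cap_def)
  have s: "0 < 1 - x \<bullet> y"
    using sphere_inner_le_1[OF xy] sphere_inner_eq_1_iff[OF xy] assms by simp
  have "2 * (x \<bullet> e - t) * (y \<bullet> e - t) / (1 - t\<^sup>2) > 0"
    using assms one_minus_power2_pos[OF abs_t] by (simp add: cap_def)
  then have "(1 - x \<bullet> y + 2 * (x \<bullet> e - t) * (y \<bullet> e - t) / (1 - t\<^sup>2)) powr (- \<alpha>) < (1 - x \<bullet> y) powr (- \<alpha>)"
    using s \<alpha> by (intro powr_less_mono2_neg) auto
  then show "0 < cap_kernel x y" by (simp add: cap_kernel_def)
  show "cap_kernel x y \<le> riesz 0 \<alpha> x y" by (simp add: cap_kernel_def riesz_def inner_commute)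
qed

text \<open>The two integral equations are subtracted, and the part outside the cap is reflected
  into it. The reflection exchanges \<open>h\<close> and \<open>h_refl\<close> up to weights, so
  this part reappears with the same difference \<open>h_refl t e y - h y\<close>, the opposite sign
  and the mirrored kernel.\<close>

lemma difference_eq:
  assumes x: "norm x = 1"
  shows "u_refl t e x - u x = K * (LINT y|surf. indicator cap y * (cap_kernel x y * (h_refl t e y - h y)))"
    and "integrable surf (\<lambda>y. indicator cap y * (cap_kernel x y * (h_refl t e y - h y)))"
proof -
  let ?R = "sphere_refl t e" and ?N = "stretch t e"
  have dim2: "DIM('a) \<ge> 2" using dim by simp
  note mR = measurable_sphere_refl[OF e abs_t]
  define F where "F = (\<lambda>y. riesz 0 \<alpha> x y * (h_refl t e y - h y))"
  note hm = borel_measurable_surf_continuous[OF h_cont]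
  obtain M1 where M1: "\<And>y. norm y = 1 \<Longrightarrow> \<bar>h_refl t e y\<bar> \<le> M1" using h_refl_bounded by blast
  obtain M2 where M2: "\<And>y. norm y = 1 \<Longrightarrow> norm (h y) \<le> M2"
    using continuous_on_sphere_bounded[OF h_cont] by blast
  have i1: "integrable surf (\<lambda>y. riesz 0 \<alpha> x y * h_refl t e y)"
    by (rule integrable_riesz_bounded[OF h_refl_measurable M1 x])
  have i2: "integrable surf (\<lambda>y. riesz 0 \<alpha> x y * h y)"
    by (rule integrable_riesz_bounded[OF hm _ x]) (use M2 in simp)
  have F: "integrable surf F"
    unfolding F_def right_diff_distrib by (intro Bochner_Integration.integrable_diff i1 i2)
  have w: "u_refl t e x - u x = K * (LINT y|surf. F y)"
    unfolding u_refl_eq[OF x] u_eq[OF x] F_def right_diff_distrib h_def[symmetric]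
    using i1 i2 by (simp add: right_diff_distrib)
  define G where "G = (\<lambda>y. (1 - indicator cap y) * F y)"
  have iDF: "integrable surf (\<lambda>y. indicator cap y * F y)"
    using integrable_mult_indicator[OF cap_sets F] by simp
  have G: "integrable surf G"
    unfolding G_def left_diff_distrib using iDF F by simp
  have Gm: "G \<in> borel_measurable surf" using G by (rule borel_measurable_integrable)
  have GR: "G (?R y) / ?N y ^ (DIM('a) - 1) = indicator cap y * (cap_kernel x y * (h_refl t e y - h y)) - indicator cap y * F y"
    if y: "norm y = 1" for y
  proof -
    have N: "?N y > 0" using N_pos y by auto
    have Ry: "norm (?R y) = 1" by (rule norm_sphere_refl[OF e abs_t y])
    have height: "?R y \<bullet> e - t = - (y \<bullet> e - t) / ?N y" by (rule sphere_refl_height[OF e abs_t y])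
    consider "y \<bullet> e > t" | "y \<bullet> e < t" | "y \<bullet> e = t" by linarith
    then show ?thesis
    proof cases
      case 1
      then have yD: "y \<in> cap" using y by (simp add: cap_def)
      have "?R y \<bullet> e - t < 0" unfolding height using 1 N by (simp add: divide_neg_pos)
      then have RyD: "?R y \<notin> cap" by (simp add: cap_def)
      have htR: "h_refl t e (?R y) = ?N y powr (n - \<alpha>) * h y"
        using N powr_minus_divide[of "?N y" "\<alpha> - n"]
        by (simp add: h_refl_def sphere_refl_involution[OF e abs_t y] powr_divide)
      have hR: "h (?R y) = ?N y powr (n - \<alpha>) * h_refl t e y"
        using N by (simp add: h_refl_def powr_add[symmetric])
      have N_n: "?N y powr (n - \<alpha>) / ?N y ^ (DIM('a) - 1) = ?N y powr (- \<alpha>)"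
      proof -
        have "?N y ^ (DIM('a) - 1) = ?N y powr n"
          using N dim2 by (simp add: powr_realpow[symmetric] of_nat_diff n)
        then show ?thesis by (simp add: powr_diff[symmetric])
      qed
      have s: "1 - x \<bullet> ?R y \<ge> 0" using sphere_inner_le_1[OF x Ry] by simp
      have "G (?R y) / ?N y ^ (DIM('a) - 1) =
          (1 - x \<bullet> ?R y) powr (- \<alpha>) * (?N y powr (n - \<alpha>) / ?N y ^ (DIM('a) - 1)) * (h y - h_refl t e y)"
        using RyD by (simp add: G_def F_def htR hR riesz_def inner_commute[of x] algebra_simps)
      also have "\<dots> = (?N y * (1 - x \<bullet> ?R y)) powr (- \<alpha>) * (h y - h_refl t e y)"
        unfolding N_n using N s by (simp add: powr_mult mult.commute)
      also have "\<dots> = (1 - x \<bullet> y + 2 * (x \<bullet> e - t) * (y \<bullet> e - t) / (1 - t\<^sup>2)) powr (- \<alpha>) * (h y - h_refl t e y)"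
        unfolding inner_sphere_refl_mixed[OF e abs_t x y] ..
      also have "\<dots> = cap_kernel x y * (h_refl t e y - h y) - F y"
        by (simp add: cap_kernel_def F_def riesz_def inner_commute[of x] algebra_simps)
      finally show ?thesis using yD by simp
    next
      case 2
      then have yD: "y \<notin> cap" by (simp add: cap_def)
      have "?R y \<bullet> e - t > 0" unfolding height using 2 N by simp
      then have "?R y \<in> cap" using Ry by (simp add: cap_def)
      then show ?thesis using yD by (simp add: G_def)
    next
      \<comment> \<open>On the mirror the point is fixed and belongs to the complement of the cap on
        both sides of the substitution; there \<open>h_refl\<close> equals \<open>h\<close> and
        \<open>F\<close> is 0.\<close>
      case 3
      then have "y \<notin> cap" by (simp add: cap_def)
      moreover have "h_refl t e y = h y" using sphere_refl_fixed[OF e abs_t y 3] by (simp add: h_refl_def)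
      ultimately show ?thesis using sphere_refl_fixed[OF e abs_t y 3] by (simp add: G_def F_def)
    qed
  qed
  have iGR: "integrable surf (\<lambda>y. G (?R y) / ?N y ^ (DIM('a) - 1))"
    by (rule integrable_sphere_refl[OF e abs_t dim2 Gm G])
  have iQF: "integrable surf (\<lambda>y. indicator cap y * (cap_kernel x y * (h_refl t e y - h y)) - indicator cap y * F y)"
    by (rule iffD1[OF Bochner_Integration.integrable_cong[OF refl] iGR]) (use GR in simp)
  have iQ: "integrable surf (\<lambda>y. (indicator cap y * (cap_kernel x y * (h_refl t e y - h y)) - indicator cap y * F y)
      + indicator cap y * F y)"
    by (rule Bochner_Integration.integrable_add[OF iQF iDF])
  then show iQ': "integrable surf (\<lambda>y. indicator cap y * (cap_kernel x y * (h_refl t e y - h y)))"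
    by simp
  have "(LINT y|surf. F y) = (LINT y|surf. indicator cap y * F y) + (LINT y|surf. G y)"
    using iDF F by (simp add: G_def left_diff_distrib)
  also have "(LINT y|surf. G y) = (LINT y|surf. G (?R y) / ?N y ^ (DIM('a) - 1))"
    by (rule integral_sphere_refl[OF e abs_t dim2 Gm])
  also have "\<dots> = (LINT y|surf. indicator cap y * (cap_kernel x y * (h_refl t e y - h y)) - indicator cap y * F y)"
    by (rule Bochner_Integration.integral_cong[OF refl]) (use GR in simp)
  also have "\<dots> = (LINT y|surf. indicator cap y * (cap_kernel x y * (h_refl t e y - h y)))
      - (LINT y|surf. indicator cap y * F y)"
    by (rule Bochner_Integration.integral_diff[OF iQ' iDF])
  finally show "u_refl t e x - u x = K * (LINT y|surf. indicator cap y * (cap_kernel x y * (h_refl t e y - h y)))"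
    unfolding w by simp
qed

lemma u_refl_nonneg: "norm x = 1 \<Longrightarrow> u_refl t e x \<ge> 0"
  unfolding u_refl_def using u_nonneg[OF norm_sphere_refl[OF e abs_t]] by simp

lemma u_refl_powr: "norm x = 1 \<Longrightarrow> u_refl t e x powr p = stretch t e x powr (- \<alpha> * p) * h (sphere_refl t e x)"
  unfolding u_refl_def h_def using u_nonneg[OF norm_sphere_refl[OF e abs_t]]
  by (simp add: powr_mult powr_powr)

text \<open>Here subcriticality enters: \<open>\<alpha> - n < - \<alpha> * p\<close>, and in the cap
  \<open>stretch\<close> is below 1, so the smaller exponent gives the larger weight.\<close>

lemma u_refl_powr_le_h_refl:
  assumes "x \<in> cap"
  shows "u_refl t e x powr p \<le> h_refl t e x"
proof -
  have x: "norm x = 1" "x \<bullet> e > t" using assms by (auto simp: cap_def)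
  have "stretch t e x powr (- \<alpha> * p) \<le> stretch t e x powr (\<alpha> - n)"
    using N_pos[OF x(1)] N_less_1[OF x] p n by (intro powr_mono') auto
  then show ?thesis
    unfolding u_refl_powr[OF x(1)] h_refl_def by (rule mult_right_mono) (rule h_nonneg)
qed

text \<open>The strict form excludes equality of \<open>u\<close> and its transform on a cap, as
  \<open>comparison_strict\<close> requires.\<close>

lemma u_refl_powr_less_h_refl:
  assumes "x \<in> cap" and pos: "\<And>x. norm x = 1 \<Longrightarrow> u x > 0"
  shows "u_refl t e x powr p < h_refl t e x"
proof -
  have x: "norm x = 1" "x \<bullet> e > t" using assms by (auto simp: cap_def)
  define N where "N = stretch t e x"
  have N: "0 < N" "N < 1" using N_pos[OF x(1)] N_less_1[OF x] by (auto simp: N_def)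
  have "ln N * (- \<alpha> * p) < ln N * (\<alpha> - n)"
    using N p n by (intro mult_strict_left_mono_neg) auto
  then have "N powr (- \<alpha> * p) < N powr (\<alpha> - n)"
    using N by (simp add: powr_def mult.commute)
  moreover have "h (sphere_refl t e x) > 0"
    unfolding h_def using pos[OF norm_sphere_refl[OF e abs_t x(1)]] by simp
  ultimately show ?thesis
    unfolding u_refl_powr[OF x(1)] h_refl_def N_def[symmetric] by (rule mult_strict_right_mono)
qed

definition bad_set :: "'a set" where "bad_set = {x. norm x = 1 \<and> x \<bullet> e > t \<and> u_refl t e x < u x}"

lemma bad_set_sets: "bad_set \<in> sets surf"
proof -
  note [measurable] = u_refl_measurable borel_measurable_surf_continuous[OF u_cont]
  have "{x \<in> space surf. u_refl t e x < u x} \<in> sets surf" by measurable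
  then have "{x \<in> space surf. u_refl t e x < u x} \<inter> cap \<in> sets surf"
    using cap_sets by (rule sets.Int)
  also have "{x \<in> space surf. u_refl t e x < u x} \<inter> cap = bad_set"
    by (auto simp: cap_def bad_set_def)
  finally show ?thesis .
qed

text \<open>A substitute for the maximum principle in narrow domains. Let \<open>W\<close> be the
  largest violation. On \<open>bad_set\<close> the mean value theorem bounds
  \<open>h - h_refl\<close> by \<open>p * M powr (p - 1) * W\<close>, on the rest of the cap this
  difference is nonpositive, and smallness of the kernel integral then yields
  \<open>W \<le> W / 2\<close>.\<close>

lemma comparison_of_small_set:
  assumes M: "\<And>x. norm x = 1 \<Longrightarrow> u x \<le> M"
    and small: "\<And>y. norm y = 1 \<Longrightarrow> 2 * (K * (p * M powr (p - 1))) *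
      (LINT x|surf. indicator bad_set x * riesz 0 \<alpha> y x) \<le> 1"
  shows "bad_set = {}"
proof (rule ccontr)
  assume ne: "bad_set \<noteq> {}"
  define W where "W = (SUP x\<in>bad_set. u x - u_refl t e x)"
  have bdd: "bdd_above ((\<lambda>x. u x - u_refl t e x) ` bad_set)"
  proof (rule bdd_aboveI2)
    fix x assume "x \<in> bad_set"
    then have "norm x = 1" by (simp add: bad_set_def)
    then show "u x - u_refl t e x \<le> M" using M[of x] u_refl_nonneg[of x] by simp
  qed
  have le_W: "u x - u_refl t e x \<le> W" if "x \<in> bad_set" for x
    unfolding W_def by (rule cSUP_upper[OF that bdd])
  obtain z where z: "z \<in> bad_set" using ne by blast
  then have W: "W > 0" using le_W[OF z] by (simp add: bad_set_def)
  define c where "c = p * M powr (p - 1) * W"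
  have c: "c \<ge> 0" using W p by (simp add: c_def)
  have "u x - u_refl t e x \<le> W / 2" if xB: "x \<in> bad_set" for x
  proof -
    have x: "norm x = 1" and xD: "x \<in> cap" using xB by (auto simp: bad_set_def cap_def)
    have int: "integrable surf (\<lambda>y. indicator bad_set y * riesz 0 \<alpha> x y)"
      using integrable_mult_indicator[OF bad_set_sets integrable_riesz_bounded[of "\<lambda>x. 1" 1, OF _ _ x]] by simp
    have "u x - u_refl t e x = - (u_refl t e x - u x)" by simp
    also have "\<dots> = K * (LINT y|surf. - (indicator cap y * (cap_kernel x y * (h_refl t e y - h y))))"
      unfolding difference_eq(1)[OF x] by simp
    also have "\<dots> \<le> K * (LINT y|surf. c * (indicator bad_set y * riesz 0 \<alpha> x y))"
    proof (intro mult_left_mono integral_mono_AE)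
      show "AE y in surf. - (indicator cap y * (cap_kernel x y * (h_refl t e y - h y)))
          \<le> c * (indicator bad_set y * riesz 0 \<alpha> x y)"
        using AE_surf_neq[OF dim x] AE_space
      proof eventually_elim
        case (elim y)
        then have y: "norm y = 1" "y \<noteq> x" by auto
        show ?case
        proof (cases "y \<in> cap")
          case True
          note Qb = cap_kernel_bounds[OF xD True y(2)]
          have 1: "h y - h_refl t e y \<le> u y powr p - u_refl t e y powr p"
            using u_refl_powr_le_h_refl[OF True] by (simp add: h_def)
          show ?thesis
          proof (cases "y \<in> bad_set")
            case yB: True
            then have "u_refl t e y < u y" by (simp add: bad_set_def)
            then have "u y powr p - u_refl t e y powr p \<le> p * u y powr (p - 1) * (u y - u_refl t e y)"
              using u_refl_nonneg[OF y(1)] p by (intro powr_diff_le)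
            also have "\<dots> \<le> p * M powr (p - 1) * W"
              using le_W[OF yB] M[OF y(1)] u_nonneg[OF y(1)] p \<open>u_refl t e y < u y\<close>
              by (intro mult_mono powr_mono2) auto
            finally have "h y - h_refl t e y \<le> c" using 1 by (simp add: c_def)
            then have "cap_kernel x y * (h y - h_refl t e y) \<le> riesz 0 \<alpha> x y * c"
              using Qb c by (intro order_trans[OF mult_left_mono mult_right_mono]) auto
            then show ?thesis using True yB by (simp add: algebra_simps)
          next
            \<comment> \<open>Off \<open>bad_set\<close> the comparison holds, so these points can
              only help and are estimated by 0.\<close>
            case False
            then have "u y \<le> u_refl t e y" using True by (auto simp: bad_set_def cap_def)
            then have "u y powr p \<le> u_refl t e y powr p"
              using u_nonneg[OF y(1)] p by (intro powr_mono2) auto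
            then have "cap_kernel x y * (h y - h_refl t e y) \<le> 0"
              using 1 Qb by (intro mult_nonneg_nonpos) auto
            then show ?thesis using True False by (simp add: algebra_simps)
          qed
        qed (auto simp: bad_set_def cap_def)
      qed
    qed (use difference_eq(2)[OF x] int K in auto)
    also have "\<dots> = (2 * (K * (p * M powr (p - 1))) *
        (LINT y|surf. indicator bad_set y * riesz 0 \<alpha> x y)) * (W / 2)"
      by (simp add: c_def)
    also have "\<dots> \<le> 1 * (W / 2)" using small[OF x] W by (intro mult_right_mono) auto
    finally show ?thesis by simp
  qed
  then have "W \<le> W / 2" unfolding W_def using ne by (intro cSUP_least)
  then show False using W by simp
qed

text \<open>In the cap the kernel is positive off the diagonal and \<open>h < h_refl\<close>, so
  equality at a single point would make the cap null. For a null cap the claim is vacuous.\<close>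

lemma comparison_strict:
  assumes pos: "\<And>x. norm x = 1 \<Longrightarrow> u x > 0" and bad_set: "bad_set = {}"
  shows "AE x in surf. x \<in> cap \<longrightarrow> u x < u_refl t e x"
proof (cases "AE x in surf. x \<notin> cap")
  case True
  then show ?thesis by eventually_elim simp
next
  case False
  have "u x < u_refl t e x" if xD: "x \<in> cap" for x
  proof -
    have x: "norm x = 1" using xD by (simp add: cap_def)
    have le: "u y \<le> u_refl t e y" if "y \<in> cap" for y using bad_set that by (auto simp: bad_set_def cap_def)
    have hht: "h y < h_refl t e y" if "y \<in> cap" for y
    proof -
      have "norm y = 1" using that by (simp add: cap_def)
      then have "u y powr p \<le> u_refl t e y powr p"
        using le[OF that] u_nonneg p by (intro powr_mono2) auto
      then show ?thesis using u_refl_powr_less_h_refl[OF that pos] by (simp add: h_def)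
    qed
    have F: "AE y in surf. y \<in> cap \<longrightarrow> cap_kernel x y * (h_refl t e y - h y) > 0"
      using AE_surf_neq[OF dim x]
      by eventually_elim (use cap_kernel_bounds(1)[OF xD] hht in auto)
    have "u_refl t e x \<noteq> u x"
    proof
      assume "u_refl t e x = u x"
      then have "(LINT y|surf. indicator cap y * (cap_kernel x y * (h_refl t e y - h y))) = 0"
        using difference_eq(1)[OF x] K by simp
      moreover have "AE y in surf. 0 \<le> indicator cap y * (cap_kernel x y * (h_refl t e y - h y))"
        using F by eventually_elim (auto simp: indicator_def)
      ultimately have "AE y in surf. indicator cap y * (cap_kernel x y * (h_refl t e y - h y)) = 0"
        by (subst (asm) integral_nonneg_eq_0_iff_AE[OF difference_eq(2)[OF x]]) auto
      then have "AE y in surf. y \<notin> cap"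
        using F by eventually_elim (auto simp: indicator_def)
      then show False using False by simp
    qed
    then show ?thesis using le[OF xD] by simp
  qed
  then show ?thesis by simp
qed

end
end

section \<open>Varying the cap\<close>

context subcritical_integral_equation
begin

text \<open>The interval contains 0 in its interior so that the final limit, as \<open>t\<close>
  decreases to 0, is covered.\<close>

lemma u_refl_continuous_parameter:
  assumes e: "norm e = 1" and x: "norm x = 1"
  shows "continuous_on {- 1<..<1} (\<lambda>t. u_refl t e x)"
proof -
  have k: "1 - t\<^sup>2 \<noteq> 0" if "t \<in> {- 1<..<1}" for t :: real
  proof -
    have "\<bar>t\<bar> < 1" using that by auto
    then show ?thesis using one_minus_power2_pos[of t] by simp
  qed
  have N: "stretch t e x > 0" if "t \<in> {- 1<..<1}" for t
    using stretch_sphere_pos[OF e _ x, of t] that by auto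
  have cN: "continuous_on {- 1<..<1} (\<lambda>t. stretch t e x)"
    unfolding stretch_def using k by (intro continuous_intros) auto
  have cR: "continuous_on {- 1<..<1} (\<lambda>t. cone_refl t e x)"
    unfolding cone_refl_def using k by (intro continuous_intros) auto
  have "continuous_on {- 1<..<1} (\<lambda>t. (1 / stretch t e x) *\<^sub>R cone_refl t e x)"
    using N by (intro continuous_intros cN cR) force
  then have "continuous_on {- 1<..<1} (\<lambda>t. sphere_refl t e x)"
    by (rule continuous_on_eq) (auto simp: sphere_refl_eq[OF e])
  moreover have "(\<lambda>t. sphere_refl t e x) ` {- 1<..<1} \<subseteq> sphere 0 1"
    using norm_sphere_refl[OF e _ x] by auto
  ultimately have "continuous_on {- 1<..<1} (\<lambda>t. u (sphere_refl t e x))"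
    by (rule continuous_on_compose2[OF u_cont])
  then show ?thesis
    unfolding u_refl_def using N by (intro continuous_intros cN) force
qed

text \<open>The threshold depends only on a bound for \<open>u\<close> and on the kernel. Its
  uniformity in \<open>t\<close> is what allows one \<kappa> to serve along a whole sequence of
  caps.\<close>

lemma comparison_of_small_measure:
  "\<exists>\<kappa>>0. \<forall>e t. norm e = 1 \<longrightarrow> 0 < t \<longrightarrow> t < 1 \<longrightarrow> measure surf (bad_set e t) < \<kappa> \<longrightarrow> bad_set e t = {}"
proof -
  obtain M0 where M0: "\<And>x. norm x = 1 \<Longrightarrow> norm (u x) \<le> M0"
    using continuous_on_sphere_bounded[OF u_cont] by blast
  define M where "M = max M0 1"
  have M: "u x \<le> M" if "norm x = 1" for x using M0[OF that] by (simp add: M_def)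
  have "M > 0" by (simp add: M_def)
  define c where "c = 2 * (K * (p * M powr (p - 1)))"
  have c: "c > 0" using K p \<open>M > 0\<close> by (simp add: c_def)
  have "1 / c > 0" using c by simp
  from riesz_small_sets[OF dim less_imp_le[OF \<alpha>(1)] \<alpha>(2) this]
  obtain \<kappa> where \<kappa>: "\<kappa> > 0" and small: "bad_set \<in> sets surf \<Longrightarrow> norm y = 1 \<Longrightarrow>
      measure surf bad_set < \<kappa> \<Longrightarrow> (LINT x|surf. indicator bad_set x * riesz 0 \<alpha> y x) \<le> 1 / c"
    for y :: 'a and bad_set by blast
  have "bad_set e t = {}" if e: "norm e = 1" and t: "0 < t" "t < 1" and m: "measure surf (bad_set e t) < \<kappa>" for e t
  proof (rule comparison_of_small_set[OF e t M])
    fix y :: 'a assume "norm y = 1"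
    from small[OF bad_set_sets[OF e t] this m]
    show "2 * (K * (p * M powr (p - 1))) *
        (LINT x|surf. indicator (bad_set e t) x * riesz 0 \<alpha> y x) \<le> 1"
      unfolding c_def[symmetric] using c by (simp add: field_simps)
  qed
  with \<kappa> show ?thesis by blast
qed

text \<open>
  Moving caps: the parameters \<open>t\<close> for which the comparison holds in the cap \<open>x \<bullet> e > t\<close> form a
  nonempty, open and closed subset of \<open>{0<..<1}\<close>.
\<close>

lemma moving_caps:
  assumes pos: "\<And>x. norm x = 1 \<Longrightarrow> u x > 0" and e: "norm e = 1" and t: "0 < t" "t < 1"
  shows "bad_set e t = {}"
proof -
  interpret finite_measure "surf :: 'a measure" by (rule finite_measure_surf)
  define S where "S = {0<..<1::real}"
  define A where "A = {t\<in>S. bad_set e t = {}}"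
  obtain \<kappa> where \<kappa>: "\<kappa> > 0" and \<kappa>': "norm e = 1 \<Longrightarrow> 0 < t \<Longrightarrow> t < 1 \<Longrightarrow>
      measure surf (bad_set e t) < \<kappa> \<Longrightarrow> bad_set e t = {}" for e t
    using comparison_of_small_measure by blast
  have \<kappa>: "\<kappa> > 0" "t \<in> S \<Longrightarrow> measure surf (bad_set e t) < \<kappa> \<Longrightarrow> t \<in> A" for t
    using \<kappa> \<kappa>'[OF e, of t] unfolding A_def S_def by simp_all
  have bad_set: "x \<in> bad_set e t \<longleftrightarrow> norm x = 1 \<and> x \<bullet> e > t \<and> u_refl t e x < u x" if "t \<in> S" for t x
    using that by (simp add: bad_set_def[OF e] S_def)
  have Bs: "bad_set e t \<in> sets surf" if "t \<in> S" for t
    using bad_set_sets[OF e] that by (auto simp: S_def)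
  \<comment> \<open>Shared by nonemptiness and openness: if almost every point eventually leaves the
    bad sets, their measures tend to 0, so one of them is below \<kappa> and hence empty.\<close>
  have seq: "\<exists>k. s k \<in> A"
    if s: "\<And>k. s k \<in> S" and AE: "AE x in surf. \<forall>\<^sub>F k in sequentially. x \<notin> bad_set e (s k)" for s
  proof -
    have "(\<lambda>k. measure surf (bad_set e (s k))) \<longlonglongrightarrow> 0"
      by (rule measure_tendsto_0[OF Bs[OF s] AE])
    then have "\<forall>\<^sub>F k in sequentially. measure surf (bad_set e (s k)) < \<kappa>"
      using \<kappa>(1) by (rule order_tendstoD(2))
    then have "\<exists>k. measure surf (bad_set e (s k)) < \<kappa>"
      by (rule eventually_happens'[OF sequentially_bot])
    then show ?thesis using \<kappa>(2)[OF s] by blast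
  qed
  have "A \<noteq> {}"
  proof -
    \<comment> \<open>The caps shrink to the single point \<open>e\<close>, which is null. The
      double \<open>Suc\<close> makes \<open>s 0 = 1 / 2\<close>, so every term lies in
      \<open>S\<close>.\<close>
    define s where "s = (\<lambda>k. 1 - 1 / real (Suc (Suc k)))"
    have s: "s k \<in> S" for k by (auto simp: s_def S_def divide_simps)
    have s_lim: "s \<longlonglongrightarrow> 1 - 0"
      unfolding s_def by (rule tendsto_diff[OF tendsto_const LIMSEQ_Suc[OF eps_tendsto_0]])
    have "AE x in surf. \<forall>\<^sub>F k in sequentially. x \<notin> bad_set e (s k)"
      using AE_surf_neq[OF dim e] AE_space
    proof eventually_elim
      case (elim x)
      then have "x \<bullet> e < 1 - 0"
        using sphere_inner_le_1[of x e] sphere_inner_eq_1_iff[of x e] e by (simp add: order_less_le)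
      then have "\<forall>\<^sub>F k in sequentially. x \<bullet> e < s k" using s_lim by (intro order_tendstoD(1))
      then show ?case by eventually_elim (simp add: bad_set[OF s])
    qed
    then show ?thesis using seq[of s, OF s] by blast
  qed
  moreover have "openin (top_of_set S) A"
    unfolding openin_euclidean_subtopology_iff
  proof (intro conjI ballI)
    fix t0 assume "t0 \<in> A"
    then have t0: "0 < t0" "t0 < 1" "bad_set e t0 = {}" by (auto simp: A_def S_def)
    show "\<exists>d>0. \<forall>t\<in>S. dist t t0 < d \<longrightarrow> t \<in> A"
    proof (rule ccontr)
      assume "\<not> ?thesis"
      then have "\<exists>t. t \<in> S \<and> dist t t0 < 1 / real (Suc k) \<and> t \<notin> A" for k
        by (metis of_nat_0_less_iff zero_less_Suc zero_less_divide_1_iff)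
      then obtain s where s: "\<And>k. s k \<in> S" "\<And>k. dist (s k) t0 < 1 / real (Suc k)" "\<And>k. s k \<notin> A"
        by metis
      have s_lim: "s \<longlonglongrightarrow> t0"
      proof (rule LIM_zero_cancel, rule Lim_null_comparison[OF always_eventually eps_tendsto_0], intro allI)
        show "norm (s k - t0) \<le> 1 / real (Suc k)" for k using s(2)[of k] by (simp add: dist_norm)
      qed
      \<comment> \<open>Almost every point leaves the bad sets: below height \<open>t0\<close> it
        drops out of the caps, above \<open>t0\<close> the strict inequality persists by continuity
        in \<open>t\<close>, and the parallel at height \<open>t0\<close> is null.\<close>
      have "AE x in surf. x \<in> cap e t0 \<longrightarrow> u x < u_refl t0 e x"
        by (rule comparison_strict[OF e t0(1,2) _ t0(3)]) (rule pos)
      then have "AE x in surf. \<forall>\<^sub>F k in sequentially. x \<notin> bad_set e (s k)"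
        using
          AE_surf_parallel[OF e less_imp_le[OF t0(1)] t0(2)] AE_space
      proof eventually_elim
        case (elim x)
        then have x: "norm x = 1" by simp
        consider "x \<bullet> e < t0" | "x \<bullet> e > t0" using elim by linarith
        then show ?case
        proof cases
          case 1
          then have "\<forall>\<^sub>F k in sequentially. x \<bullet> e < s k" using s_lim by (intro order_tendstoD(1))
          then show ?thesis by eventually_elim (simp add: bad_set[OF s(1)])
        next
          case 2
          then have "u x < u_refl t0 e x" using elim x by (simp add: cap_def[OF e t0(1,2)])
          moreover have "(\<lambda>k. u_refl (s k) e x) \<longlonglongrightarrow> u_refl t0 e x"
            by (rule continuous_on_tendsto_compose[OF u_refl_continuous_parameter[OF e x] s_lim])
              (use t0 s(1) in \<open>auto simp: S_def intro!: always_eventually less_trans[of "- 1" 0 "s _"]\<close>)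
          ultimately have "\<forall>\<^sub>F k in sequentially. u x < u_refl (s k) e x" by (intro order_tendstoD(1))
          then show ?thesis by eventually_elim (simp add: bad_set[OF s(1)])
        qed
      qed
      then show False using seq[of s, OF s(1)] s(3) by blast
    qed
  qed (auto simp: A_def)
  moreover have "closedin (top_of_set S) A"
  proof -
    \<comment> \<open>For fixed \<open>x\<close> membership is a disjunction of two closed
      conditions on \<open>t\<close>: the cap misses \<open>x\<close>, or the comparison holds at
      \<open>x\<close>.\<close>
    have "closedin (top_of_set S) (\<Inter>x\<in>sphere 0 1. (S \<inter> (\<lambda>t. t) -` {x \<bullet> e..}) \<union> (S \<inter> (\<lambda>t. u_refl t e x) -` {u x..}))"
    proof (intro closedin_INT closedin_Un continuous_closedin_preimage continuous_on_id)
      show "continuous_on S (\<lambda>t. u_refl t e x)" if "x \<in> sphere 0 1" for x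
        by (rule continuous_on_subset[OF u_refl_continuous_parameter[OF e]]) (use that in \<open>auto simp: S_def\<close>)
    qed (use e in auto)
    also have "(\<Inter>x\<in>sphere 0 1. (S \<inter> (\<lambda>t. t) -` {x \<bullet> e..}) \<union> (S \<inter> (\<lambda>t. u_refl t e x) -` {u x..})) = A"
    proof (intro equalityI subsetI)
      fix t assume "t \<in> (\<Inter>x\<in>sphere 0 1. (S \<inter> (\<lambda>t. t) -` {x \<bullet> e..}) \<union> (S \<inter> (\<lambda>t. u_refl t e x) -` {u x..}))"
      then have *: "t \<in> S \<and> (x \<bullet> e \<le> t \<or> u x \<le> u_refl t e x)" if "norm x = 1" for x using that by auto
      then have "t \<in> S" using e by blast
      moreover have "x \<notin> bad_set e t" for x using bad_set[OF \<open>t \<in> S\<close>, of x] *[of x] by auto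
      ultimately show "t \<in> A" by (auto simp: A_def)
    next
      fix t assume "t \<in> A"
      then have t: "t \<in> S" "bad_set e t = {}" by (auto simp: A_def)
      have "x \<bullet> e \<le> t \<or> u x \<le> u_refl t e x" if "norm x = 1" for x
        using bad_set[OF t(1), of x] t(2) that by auto
      then show "t \<in> (\<Inter>x\<in>sphere 0 1. (S \<inter> (\<lambda>t. t) -` {x \<bullet> e..}) \<union> (S \<inter> (\<lambda>t. u_refl t e x) -` {u x..}))"
        using t(1) by auto
    qed
    finally show ?thesis .
  qed
  moreover have "connected S" by (simp add: S_def)
  ultimately have "A = S" unfolding connected_clopen by blast
  then have "t \<in> A" using t by (simp add: S_def)
  then show ?thesis by (simp add: A_def)
qed

text \<open>Each \<open>x\<close> with \<open>x \<bullet> e > 0\<close> lies in the caps for all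
  small \<open>t\<close>. As \<open>t\<close> tends to 0 the conformal factor becomes 1 and the
  Kelvin transform becomes plain reflection.\<close>

lemma reflection_le:
  assumes pos: "\<And>x. norm x = 1 \<Longrightarrow> u x > 0" and e: "norm e = 1" and x: "norm x = 1" "x \<bullet> e > 0"
  shows "u x \<le> u (x - (2 * (x \<bullet> e)) *\<^sub>R e)"
proof -
  define s where "s = (\<lambda>k. 1 / real (Suc (Suc k)))"
  have s: "0 < s k" "s k < 1" for k by (auto simp: s_def)
  have s_lim: "s \<longlonglongrightarrow> 0" unfolding s_def by (rule LIMSEQ_Suc[OF eps_tendsto_0])
  have "(\<lambda>k. u_refl (s k) e x) \<longlonglongrightarrow> u_refl 0 e x"
  proof (rule continuous_on_tendsto_compose[OF u_refl_continuous_parameter[OF e x(1)] s_lim _ always_eventually])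
    show "\<forall>k. s k \<in> {- 1<..<1}" using s(2) less_trans[OF _ s(1), of "- 1"] by simp
  qed simp
  moreover have "\<forall>\<^sub>F k in sequentially. u x \<le> u_refl (s k) e x"
    using order_tendstoD(2)[OF s_lim x(2)]
  proof eventually_elim
    case (elim k)
    then show ?case using moving_caps[OF pos e s[of k]] x(1) by (auto simp: bad_set_def[OF e s] not_less)
  qed
  ultimately have "u x \<le> u_refl 0 e x"
    by (rule tendsto_lowerbound) simp
  moreover have "stretch 0 e x = 1" using x by (simp add: stretch_def)
  then have "u_refl 0 e x = u (x - (2 * (x \<bullet> e)) *\<^sub>R e)"
    using sphere_refl_eq[OF e, of 0 x] by (simp add: u_refl_def cone_refl_def)
  ultimately show ?thesis by simp
qed

lemma solution_constant: "u constant_on sphere 0 1"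
proof (cases "\<exists>z. norm z = 1 \<and> u z > 0")
  case False
  then have "u x = 0" if "norm x = 1" for x using u_nonneg[OF that] that by fastforce
  then show ?thesis by (auto simp: constant_on_def)
next
  case True
  then have pos: "\<And>x. norm x = 1 \<Longrightarrow> u x > 0" using u_pos by blast
  have le: "u x \<le> u y" if x: "norm x = 1" and y: "norm y = 1" for x y
  proof (cases "x = y")
    case False
    define r where "r = norm (x - y)"
    have r: "r > 0" using False by (simp add: r_def)
    \<comment> \<open>The normal of the hyperplane bisecting \<open>x\<close> and \<open>y\<close>,
      directed to the side of \<open>x\<close>, which has height \<open>r / 2\<close>. Exchanging
      the two points gives the reverse inequality.\<close>
    define e where "e = (1 / r) *\<^sub>R (x - y)"
    have e: "norm e = 1" using r by (simp add: e_def r_def)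
    have xx: "x \<bullet> x = 1" "y \<bullet> y = 1" using x y by (simp_all add: norm_eq_1)
    have rr: "r * r = 2 * (1 - x \<bullet> y)"
      using xx by (simp add: r_def power2_norm_eq_inner power2_eq_square[symmetric]
          inner_diff_left inner_diff_right inner_commute)
    have xe: "2 * (x \<bullet> e) = r" using r rr xx by (simp add: e_def inner_diff_right field_simps)
    have "u x \<le> u (x - (2 * (x \<bullet> e)) *\<^sub>R e)"
      using xe r by (intro reflection_le[OF pos e x]) auto
    also have "x - (2 * (x \<bullet> e)) *\<^sub>R e = y" unfolding xe using r by (simp add: e_def)
    finally show ?thesis .
  qed simp
  obtain z :: 'a where "norm z = 1" using True by blast
  then have "\<forall>x\<in>sphere 0 1. u x = u z" using le by (auto intro: antisym)
  then show ?thesis unfolding constant_on_def by blast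
qed

end

theorem theorem1p1:
  fixes m n :: nat and p :: real and u :: "'a::euclidean_space \<Rightarrow> real"
  assumes "DIM('a) = n + 1"
    and "m \<ge> 1" and "n > 2 * m"
    and "1 \<le> p" and "p < (real n + 2 * real m) / (real n - 2 * real m)"
    and "Ck_sphere (2 * m) u"
    and "\<forall>x\<in>sphere 0 1. u x \<ge> 0"
    and "\<forall>x\<in>sphere 0 1. gjms m u x = u x powr p"
  shows "u constant_on sphere 0 1"
proof -
  \<comment> \<open>\<open>n > 2 * m \<ge> 2\<close> gives \<open>n \<ge> 3\<close>, which leaves
    room for kernel orders strictly between 1 and n / 2.\<close>
  have dim: "DIM('a) \<ge> 4" using assms(1-3) by linarith
  have n: "real DIM('a) - 1 = real n" using assms(1) by simp
  define \<alpha> where "\<alpha> = real n / 2 - real m"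
  have nm: "real n > 2 * real m" using assms(3) by linarith
  have "2 * m < DIM('a) - 1" using assms(1,3) by simp
  then obtain K where K: "K > 0" "\<And>y. norm y = 1 \<Longrightarrow>
      u y = K * (LINT x|surf. riesz 0 \<alpha> y x * gjms m u x)"
    using gjms_representation[OF dim assms(2) _ assms(6)] unfolding n \<alpha>_def by blast
  have "u y = K * (LINT x|surf. riesz 0 \<alpha> y x * u x powr p)" if "norm y = 1" for y
    unfolding K(2)[OF that]
    by (intro arg_cong[where f="\<lambda>z. K * z"] Bochner_Integration.integral_cong refl) (use assms(8) in simp)
  \<comment> \<open>Subcriticality multiplied by the positive number \<alpha> = (n - 2 m) / 2; the
    right side becomes (n + 2 m) / 2 = n - \<alpha>.\<close>
  moreover have "\<alpha> * p < real n - \<alpha>"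
    using assms(5) nm by (simp add: \<alpha>_def field_simps)
  ultimately interpret subcritical_integral_equation u K \<alpha> p "real n"
    using dim n nm assms(2,4,7) K(1) Ck_sphere_mono[OF assms(6), of 0]
    by unfold_locales (auto simp: \<alpha>_def)
  show ?thesis by (rule solution_constant)
qed

end
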